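(* Let $m\geq 2$ and $n=1$, and for $\omega>1/m$ let $\tau=\frac{\omega-1/m}{\omega+1}$. Then there exist constants $C\geq1$ and $\epsilon>0$ such that for all $\omega\in(1-\epsilon,1)$, \[ C^{-1}(1-\omega)\leq \dim_H(\mathrm{Sing}_{m,1}(\omega))\leq C(1-\omega), \] the same estimate holds with $1-\omega$ replaced by $\frac{m-1}{2m}-\tau$, and $\dim_P(\mathrm{Sing}_{m,1}(\omega))=1$.
   Context: Real $m\times 1$ matrices are identified with $\mathbb{R}^{m}$; $\dim_H,\dim_P$ denote Hausdorff and packing dimension. Fix norms $\|\cdot\|$ on $\mathbb{R}^m$ and $\mathbb{R}$. The uniform exponent of irrationality $\hat\omega(A)$ of an $m\times 1$ matrix $A$ is the supremum of all $\omega$ such that for all sufficiently large $Q$ there exist $p\in\mathbb{Z}^m$, $q\in\mathbb{Z}$ with $\|Aq+p\|\leq Q^{-\omega}$ and $0<|q|\leq Q$. $\mathrm{Sing}_{m,1}(\omega)=\{A:\hat\omega(A)=\omega\}$. *)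

theory Defs
  imports "HOL-Analysis.Analysis"
begin

definition is_norm :: "('a::real_vector \<Rightarrow> real) \<Rightarrow> bool" where
  "is_norm N \<longleftrightarrow>
     (\<forall>x. N x = 0 \<longleftrightarrow> x = 0) \<and>
     (\<forall>c x. N (c *\<^sub>R x) = \<bar>c\<bar> * N x) \<and>
     (\<forall>x y. N (x + y) \<le> N x + N y)"

text \<open>The power \<open>|U|\<^sup>s\<close> of the diameter, with the conventions
  \<open>|U|\<^sup>0 = 1\<close> for \<open>U \<noteq> {}\<close> and \<open>|{}|\<^sup>s = 0\<close>
  (whereas \<open>0 powr 0 = 0\<close> in the library).\<close>

definition diam_pow :: "real \<Rightarrow> 'a::metric_space set \<Rightarrow> ennreal" where
  "diam_pow s U = (if U = {} then 0 else if s = 0 then 1 else ennreal (diameter U powr s))"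

text \<open>Boundedness has to be required separately, since \<open>diameter\<close> is unspecified on unbounded sets.
  Finite covers are included, as members of the sequence may be empty.\<close>

definition hausdorff_premeasure :: "real \<Rightarrow> real \<Rightarrow> 'a::metric_space set \<Rightarrow> ennreal" where
  "hausdorff_premeasure s \<delta> S =
     (INF U \<in> {U :: nat \<Rightarrow> 'a set. S \<subseteq> (\<Union>i. U i) \<and> (\<forall>i. bounded (U i) \<and> diameter (U i) \<le> \<delta>)}.
        \<Sum>i. diam_pow s (U i))"

definition hausdorff_measure :: "real \<Rightarrow> 'a::metric_space set \<Rightarrow> ennreal" where
  "hausdorff_measure s S = (SUP \<delta> \<in> {0<..}. hausdorff_premeasure s \<delta> S)"

definition hausdorff_dim :: "'a::metric_space set \<Rightarrow> ereal" where
  "hausdorff_dim S = Inf (ereal ` {s. 0 \<le> s \<and> hausdorff_measure s S = 0})"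

text \<open>A packing is given by its set of pairs (centre, radius). In Euclidean space a ball of radius
  \<open>r\<close> has diameter \<open>2 * r\<close>.\<close>

definition packings :: "real \<Rightarrow> 'a::euclidean_space set \<Rightarrow> ('a \<times> real) set set" where
  "packings \<delta> S = {P. countable P \<and> P \<subseteq> S \<times> {0<..\<delta>} \<and> disjoint_family_on (\<lambda>(x, r). cball x r) P}"

definition packing_premeasure :: "real \<Rightarrow> 'a::euclidean_space set \<Rightarrow> ennreal" where
  "packing_premeasure s S =
     (INF \<delta> \<in> {0<..}. SUP P \<in> packings \<delta> S. \<Sum>\<^sub>\<infinity>(x, r)\<in>P. ennreal ((2 * r) powr s))"

text \<open>The premeasure is not countably subadditive, hence the second infimum.\<close>

definition packing_measure :: "real \<Rightarrow> 'a::euclidean_space set \<Rightarrow> ennreal" where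
  "packing_measure s S =
     (INF E \<in> {E :: nat \<Rightarrow> 'a set. S \<subseteq> (\<Union>i. E i)}. \<Sum>i. packing_premeasure s (E i))"

definition packing_dim :: "'a::euclidean_space set \<Rightarrow> ereal" where
  "packing_dim S = Inf (ereal ` {s. 0 \<le> s \<and> packing_measure s S = 0})"

text \<open>An \<open>m \<times> 1\<close> matrix is a vector \<open>A\<close> in \<open>\<real>\<^sup>m\<close>, so that the product \<open>A q\<close> is \<open>q *\<^sub>R A\<close>.
  The norms \<open>N\<close> on \<open>\<real>\<^sup>m\<close> and \<open>N1\<close> on \<open>\<real>\<close> are parameters; the supremum is taken in the
  extended reals, as it is infinite for instance for rational \<open>A\<close>.\<close>

definition uniform_exponent ::
    "(real ^ 'm \<Rightarrow> real) \<Rightarrow> (real \<Rightarrow> real) \<Rightarrow> real ^ 'm \<Rightarrow> ereal" where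
  "uniform_exponent N N1 A = Sup (ereal ` {\<omega>. \<forall>\<^sub>F Q in at_top.
     \<exists>(p :: int ^ 'm) (q :: int).
       N (of_int q *\<^sub>R A + (\<chi> i. of_int (p $ i))) \<le> Q powr (- \<omega>) \<and>
       0 < N1 (of_int q) \<and> N1 (of_int q) \<le> Q})"

definition Sing :: "(real ^ 'm \<Rightarrow> real) \<Rightarrow> (real \<Rightarrow> real) \<Rightarrow> real \<Rightarrow> (real ^ 'm) set" where
  "Sing N N1 \<omega> = {A. uniform_exponent N N1 A = ereal \<omega>}"

end

(*
  Let A lie in Sing(omega) with omega close to 1, and let P_j be a rational point approximating A
  with denominator at most 2^j. Three consecutive noncollinear points have a nonzero integer
  3 x 3 minor, so whenever the line through P_{j-1}, P_j changes at a point P_c, the approximation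
  by P_c remains the best one until a time j >= omega c / (1 - omega). Since a point of a rational line has
  exponent at least 1, the line changes infinitely often. Thus A is approximable to order about
  1 / (1 - omega) by rational points, whence dim_H <= C (1 - omega). Moreover A stays close to rational
  line segments whose total length converges, so that A can be covered by O(1 / rho) balls of radius
  rho, whence dim_P <= 1.

  For the lower bounds take A = (x, y, 0, ..., 0), where x = sum_{j even} w_j / n_j and y = sum_{j odd} w_j / n_j,
  with n_j = 2^(K^j) for even j and 3^(K^j) for odd j, and each w_j ranging over an interval chosen
  such that the error after the j-th term is about 1 / (n_j n_{j+1}^lam), lam = 1 / (1 - omega). Such points
  have exponent exactly omega. Reading the w_j as digits of a real number t in [0,1) gives a map t -> A
  with Hoelder inverse of exponent 1 / (3 (lam + 1)), which bounds dim_H from below.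
  As K tends to infinity, the points separated at scale 1 / n_j number n_j^(1 - o(1)), which gives dim_P >= 1.
*)
theory Submission
  imports Defs
begin

section \<open>Hausdorff and packing dimension\<close>

text \<open>The upper bounds rest on one determinant: in the minor of the points of indices c - 1, c
  and j the dominant product is the denominator at j times the two earlier errors, 2^(j - w c - w j)
  up to a constant. It cannot be small, so (1 - w) j is at least w c - O(1). Here w lies strictly
  below \<omega>, since the supremum defining the exponent need not be attained; the gap also
  absorbs the constants coming from the norms. In the construction the obstacle is to bound the
  exponent from above, that is, to rule out every denominator and not only the intended ones.
  Alternating powers of 2 and 3 serve this purpose: \<open>n j\<close> divides
  \<open>n (j + 2)\<close>, so each coordinate is a series with nested denominators, whereas
  \<open>n j\<close> and \<open>n (j + 1)\<close> are coprime, so a denominator good for both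
  coordinates is a multiple of their product. The value of lam is forced: at time n^lam the error is
  n^(1 - lam), and this equals (n^lam)^(-\<omega>) exactly when lam = 1 / (1 - \<omega>). Only the
  order of magnitude in 1 - \<omega> matters for Hausdorff dimension, so one admissible K suffices
  there; for packing dimension K has to grow as s approaches 1.\<close>

lemma hausdorff_premeasure_mono:
  "S \<subseteq> T \<Longrightarrow> hausdorff_premeasure s \<delta> S \<le> hausdorff_premeasure s \<delta> T"
  unfolding hausdorff_premeasure_def by (rule INF_superset_mono) auto

text \<open>Near-optimal covers of the \<open>S k\<close>, with slack
  \<open>e / 2 ^ (k + 1)\<close>, are merged into one sequence by \<open>prod_decode\<close>.
  \<open>ennreal_le_epsilon\<close> supplies finiteness of the sum, without which adding a slack
  would not give a strictly larger value.\<close>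

lemma hausdorff_premeasure_UN_le:
  "hausdorff_premeasure s \<delta> (\<Union>k. S k) \<le> (\<Sum>k. hausdorff_premeasure s \<delta> (S k))"
proof (rule ennreal_le_epsilon)
  fix e :: real
  assume fin: "(\<Sum>k. hausdorff_premeasure s \<delta> (S k)) < top" and e: "0 < e"
  define h where "h k = ennreal (e * (1/2) ^ Suc k)" for k
  have "\<exists>U. S k \<subseteq> (\<Union>i. U i) \<and> (\<forall>i. bounded (U i) \<and> diameter (U i) \<le> \<delta>) \<and>
      (\<Sum>i. diam_pow s (U i)) \<le> hausdorff_premeasure s \<delta> (S k) + h k" for k
  proof -
    have "hausdorff_premeasure s \<delta> (S k) < top"
      using ennreal_suminf_lessD[OF fin] .
    then obtain x where "0 \<le> x" "hausdorff_premeasure s \<delta> (S k) = ennreal x"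
      using less_top_ennreal by blast
    then have "hausdorff_premeasure s \<delta> (S k) < hausdorff_premeasure s \<delta> (S k) + h k"
      using e by (simp add: h_def ennreal_plus[symmetric] ennreal_less_iff del: ennreal_plus)
    then show ?thesis
      unfolding hausdorff_premeasure_def[of s \<delta> "S k"] INF_less_iff
      by (auto simp: less_imp_le)
  qed
  then obtain U where U: "\<And>k. S k \<subseteq> (\<Union>i. U k i)"
      "\<And>k i. bounded (U k i)" "\<And>k i. diameter (U k i) \<le> \<delta>"
      "\<And>k. (\<Sum>i. diam_pow s (U k i)) \<le> hausdorff_premeasure s \<delta> (S k) + h k"
    by metis
  define V where "V n = (case prod_decode n of (k, i) \<Rightarrow> U k i)" for n
  have cov: "(\<Union>k. S k) \<subseteq> (\<Union>n. V n)"
  proof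
    fix x assume "x \<in> (\<Union>k. S k)"
    then obtain k i where "x \<in> U k i" using U(1) by blast
    then have "x \<in> V (prod_encode (k, i))" by (simp add: V_def)
    then show "x \<in> (\<Union>n. V n)" by blast
  qed
  have "hausdorff_premeasure s \<delta> (\<Union>k. S k) \<le> (\<Sum>n. diam_pow s (V n))"
    unfolding hausdorff_premeasure_def
    by (rule INF_lower) (use cov U(2,3) in \<open>auto simp: V_def split: prod.split\<close>)
  also have "\<dots> = (\<Sum>k. \<Sum>i. diam_pow s (U k i))"
  proof -
    have "(\<lambda>n. diam_pow s (V n)) = (\<lambda>n. (\<lambda>(k, i). diam_pow s (U k i)) (prod_decode n))"
      by (auto simp: V_def fun_eq_iff split: prod.split)
    then show ?thesis
      by (simp only:) (rule suminf_ennreal_2dimen, simp)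
  qed
  also have "\<dots> \<le> (\<Sum>k. hausdorff_premeasure s \<delta> (S k) + h k)"
    by (intro suminf_le U(4)) auto
  also have "\<dots> = (\<Sum>k. hausdorff_premeasure s \<delta> (S k)) + (\<Sum>k. h k)"
    by (intro suminf_add[symmetric]) auto
  also have "(\<Sum>k. h k) = ennreal e"
  proof -
    have "(\<lambda>k. e * (1/2) ^ Suc k) sums (e * 1)"
      by (intro sums_mult power_half_series)
    then show ?thesis
      unfolding h_def using e by (intro suminf_ennreal_eq) auto
  qed
  finally show "hausdorff_premeasure s \<delta> (\<Union>k. S k)
      \<le> (\<Sum>k. hausdorff_premeasure s \<delta> (S k)) + ennreal e" .
qed

lemma hausdorff_premeasure_le_diam_pow:
  assumes "bounded U" "diameter U \<le> \<delta>" "0 \<le> \<delta>"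
  shows "hausdorff_premeasure s \<delta> U \<le> diam_pow s U"
proof -
  have "hausdorff_premeasure s \<delta> U \<le> (\<Sum>i::nat. diam_pow s (if i = 0 then U else {}))"
    unfolding hausdorff_premeasure_def
    by (rule INF_lower) (use assms in \<open>auto intro: exI[of _ 0]\<close>)
  also have "\<dots> = (\<Sum>i\<in>{0::nat}. diam_pow s (if i = 0 then U else {}))"
    by (rule suminf_finite) (auto simp: diam_pow_def)
  finally show ?thesis by simp
qed

lemma hausdorff_premeasure_empty [simp]:
  "0 \<le> \<delta> \<Longrightarrow> hausdorff_premeasure s \<delta> {} = 0"
  using hausdorff_premeasure_le_diam_pow[of "{}" \<delta> s] by (simp add: diam_pow_def)

lemma hausdorff_premeasure_finite_UN_le:
  assumes "finite F" "0 \<le> \<delta>"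
  shows "hausdorff_premeasure s \<delta> (\<Union>x\<in>F. U x) \<le> (\<Sum>x\<in>F. hausdorff_premeasure s \<delta> (U x))"
  using assms(1)
proof induction
  case (insert x F)
  define S where "S k = (if k = (0::nat) then U x else if k = 1 then (\<Union>x\<in>F. U x) else {})" for k
  have "(\<Union>x\<in>insert x F. U x) = (\<Union>k. S k)"
    by (auto simp: S_def split: if_splits)
  then have "hausdorff_premeasure s \<delta> (\<Union>x\<in>insert x F. U x) \<le> (\<Sum>k. hausdorff_premeasure s \<delta> (S k))"
    using hausdorff_premeasure_UN_le[of s \<delta> S] by simp
  also have "\<dots> = (\<Sum>k\<in>{0,1}. hausdorff_premeasure s \<delta> (S k))"
    by (rule suminf_finite) (use assms(2) in \<open>auto simp: S_def\<close>)
  also have "\<dots> = hausdorff_premeasure s \<delta> (U x) + hausdorff_premeasure s \<delta> (\<Union>x\<in>F. U x)"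
    by (simp add: S_def)
  also have "\<dots> \<le> hausdorff_premeasure s \<delta> (U x) + (\<Sum>x\<in>F. hausdorff_premeasure s \<delta> (U x))"
    by (intro add_left_mono insert.IH)
  finally show ?case using insert.hyps by simp
qed (use assms(2) in auto)

lemma hausdorff_dim_le: "0 \<le> s \<Longrightarrow> hausdorff_measure s S = 0 \<Longrightarrow> hausdorff_dim S \<le> ereal s"
  unfolding hausdorff_dim_def by (rule Inf_lower) auto

lemma hausdorff_measure_UN_eq_0:
  assumes "\<And>k::nat. hausdorff_measure s (S k) = 0"
  shows "hausdorff_measure s (\<Union>k. S k) = 0"
proof -
  have "hausdorff_premeasure s \<delta> (\<Union>k. S k) \<le> 0" if "\<delta> > 0" for \<delta>
  proof -
    have "hausdorff_premeasure s \<delta> (S k) = 0" for k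
    proof -
      have "hausdorff_premeasure s \<delta> (S k) \<le> hausdorff_measure s (S k)"
        unfolding hausdorff_measure_def by (rule SUP_upper) (use that in auto)
      then show ?thesis using assms by simp
    qed
    then show ?thesis using hausdorff_premeasure_UN_le[of s \<delta> S] by simp
  qed
  then show ?thesis
    unfolding hausdorff_measure_def by (auto intro!: antisym SUP_least)
qed

lemma hausdorff_measure_mono: "S \<subseteq> T \<Longrightarrow> hausdorff_measure s S \<le> hausdorff_measure s T"
  unfolding hausdorff_measure_def by (intro SUP_mono') (auto intro: hausdorff_premeasure_mono)

lemma diam_pow_cball_le:
  fixes x :: "'a::euclidean_space"
  assumes "0 \<le> r" "0 < s"
  shows "diam_pow s (cball x r) \<le> ennreal ((2 * r) powr s)"
  using assms by (auto simp: diam_pow_def intro!: ennreal_leI powr_mono2)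

text \<open>The convergence half of the Borel-Cantelli lemma: every point lies in balls of
  arbitrarily large index, so each tail of the family covers \<open>S\<close>, and the tails of a
  convergent series tend to 0.\<close>

lemma hausdorff_measure_limsup_eq_0:
  fixes S :: "'a::euclidean_space set" and X :: "nat \<Rightarrow> 'a set"
  assumes S: "\<And>x c0. x \<in> S \<Longrightarrow> \<exists>c\<ge>c0. \<exists>y\<in>X c. dist x y \<le> r c"
    and X: "\<And>c. finite (X c)" and r: "\<And>c. 0 \<le> r c" "r \<longlonglongrightarrow> 0" and s: "0 < s"
    and sm: "summable (\<lambda>c. real (card (X c)) * r c powr s)"
  shows "hausdorff_measure s S = 0"
proof -
  have "hausdorff_premeasure s \<delta> S \<le> 0" if \<delta>: "\<delta> > 0" for \<delta>
  proof (rule ennreal_le_epsilon)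
    fix e :: real assume e: "0 < e"
    define a where "a c = real (card (X c)) * (2 * r c) powr s" for c
    have a0: "0 \<le> a c" for c by (simp add: a_def)
    have "summable (\<lambda>c. 2 powr s * (real (card (X c)) * r c powr s))"
      using sm by (rule summable_mult)
    moreover have "(\<lambda>c. 2 powr s * (real (card (X c)) * r c powr s)) = a"
      using r(1) by (auto simp: a_def powr_mult)
    ultimately have sma: "summable a" by simp
    obtain c1 where c1: "\<And>c. c \<ge> c1 \<Longrightarrow> norm (\<Sum>i. a (i + c)) < e"
      using suminf_exist_split[OF e sma] by blast
    have "\<forall>\<^sub>F c in sequentially. r c < \<delta> / 2"
      using r(2) \<delta> by (intro order_tendstoD(2)) auto
    then obtain c2 where c2: "\<And>c. c \<ge> c2 \<Longrightarrow> r c < \<delta> / 2"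
      unfolding eventually_sequentially by blast
    \<comment> \<open>Beyond \<open>c1\<close> the tail sums to less than \<open>e\<close>; beyond
      \<open>c2\<close> the balls have diameter at most \<open>\<delta>\<close>.\<close>
    define c0 where "c0 = max c1 c2"
    have "S \<subseteq> (\<Union>i. \<Union>y\<in>X (i + c0). cball y (r (i + c0)))"
    proof
      fix x assume "x \<in> S"
      then obtain c y where "c \<ge> c0" "y \<in> X c" "dist x y \<le> r c" using S by blast
      then have "x \<in> (\<Union>y\<in>X (c - c0 + c0). cball y (r (c - c0 + c0)))"
        by (auto simp: dist_commute)
      then show "x \<in> (\<Union>i. \<Union>y\<in>X (i + c0). cball y (r (i + c0)))" by blast
    qed
    then have "hausdorff_premeasure s \<delta> S \<le>
        hausdorff_premeasure s \<delta> (\<Union>i. \<Union>y\<in>X (i + c0). cball y (r (i + c0)))"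
      by (rule hausdorff_premeasure_mono)
    also have "\<dots> \<le> (\<Sum>i. hausdorff_premeasure s \<delta> (\<Union>y\<in>X (i + c0). cball y (r (i + c0))))"
      by (rule hausdorff_premeasure_UN_le)
    also have "\<dots> \<le> (\<Sum>i. ennreal (a (i + c0)))"
    proof (intro suminf_le allI)
      fix i
      have "hausdorff_premeasure s \<delta> (\<Union>y\<in>X (i + c0). cball y (r (i + c0))) \<le>
          (\<Sum>y\<in>X (i + c0). hausdorff_premeasure s \<delta> (cball y (r (i + c0))))"
        using X \<delta> by (intro hausdorff_premeasure_finite_UN_le) auto
      also have "\<dots> \<le> (\<Sum>y\<in>X (i + c0). ennreal ((2 * r (i + c0)) powr s))"
      proof (intro sum_mono order.trans[OF hausdorff_premeasure_le_diam_pow diam_pow_cball_le])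
        show "diameter (cball y (r (i + c0))) \<le> \<delta>" for y :: 'a
        proof -
          have "c2 \<le> i + c0" by (simp add: c0_def)
          then show ?thesis using c2[of "i + c0"] r(1)[of "i + c0"] by simp
        qed
      qed (use \<delta> r s in auto)
      also have "\<dots> = ennreal (a (i + c0))"
        by (simp add: a_def ennreal_mult ennreal_of_nat_eq_real_of_nat)
      finally show "hausdorff_premeasure s \<delta> (\<Union>y\<in>X (i + c0). cball y (r (i + c0)))
          \<le> ennreal (a (i + c0))" .
    qed auto
    also have "\<dots> = ennreal (\<Sum>i. a (i + c0))"
      using a0 sma by (intro suminf_ennreal_eq) (auto simp: summable_iff_shift intro: summable_sums)
    also have "\<dots> \<le> ennreal e"
      using c1[of c0] by (intro ennreal_leI) (auto simp: c0_def)
    finally show "hausdorff_premeasure s \<delta> S \<le> 0 + ennreal e" by simp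
  qed
  then show ?thesis
    unfolding hausdorff_measure_def by (auto intro!: antisym SUP_least)
qed

section \<open>Lower bounds for Hausdorff dimension\<close>

lemma real_interval_cover_suminf_ge:
  fixes a b :: "nat \<Rightarrow> real"
  assumes "{0..<1} \<subseteq> (\<Union>i. {a i..b i})" "\<And>i. a i \<le> b i"
  shows "1 \<le> (\<Sum>i. ennreal (b i - a i))"
proof -
  have "1 = emeasure lborel {0..<1::real}" by simp
  also have "\<dots> \<le> emeasure lborel (\<Union>i. {a i..b i})"
    using assms(1) by (intro emeasure_mono) auto
  also have "\<dots> \<le> (\<Sum>i. emeasure lborel {a i..b i})"
    by (rule emeasure_subadditive_countably) auto
  finally show ?thesis using assms(2) by simp
qed

text \<open>A cover of the set pulls back to a cover of the unit interval, so that Lebesgue measure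
  can play the part of the mass distribution.\<close>

lemma hausdorff_dim_ge_Hoelder_inverse:
  fixes A :: "real \<Rightarrow> 'a::metric_space"
  assumes A: "\<And>t. t \<in> {0..<1} \<Longrightarrow> A t \<in> S" and s: "0 < s" and C: "0 < C"
    and hoelder: "\<And>t u. t \<in> {0..<1} \<Longrightarrow> u \<in> {0..<1} \<Longrightarrow> \<bar>t - u\<bar> \<le> C * dist (A t) (A u) powr s"
  shows "ereal s \<le> hausdorff_dim S"
  unfolding hausdorff_dim_def
proof (rule Inf_greatest, clarsimp)
  fix s' assume s': "0 \<le> s'" "hausdorff_measure s' S = 0"
  show "s \<le> s'"
  proof (rule ccontr)
    assume "\<not> s \<le> s'"
    \<comment> \<open>Scale 1 is enough: for diameters at most 1, passing from \<open>s\<close> to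
      the smaller exponent \<open>s'\<close> only increases the powers.\<close>
    have "ennreal (inverse C) \<le> hausdorff_premeasure s' 1 S"
      unfolding hausdorff_premeasure_def
    proof (rule INF_greatest, clarsimp)
      fix U :: "nat \<Rightarrow> 'a set"
      assume U: "S \<subseteq> (\<Union>i. U i)" "\<forall>i. bounded (U i) \<and> diameter (U i) \<le> 1"
      define T where "T i = {t \<in> {0..<1}. A t \<in> U i}" for i
      \<comment> \<open>The preimage \<open>T i\<close> need not be measurable. It is replaced by an
        interval that starts at its infimum and is as long as the Hoelder bound permits.\<close>
      have "\<exists>a b. a \<le> b \<and> T i \<subseteq> {a..b} \<and> ennreal (b - a) \<le> C * diam_pow s' (U i)" for i
      proof (cases "T i = {}")
        case True
        then show ?thesis by (intro exI[of _ 0]) auto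
      next
        case False
        have bd: "bounded (U i)" "diameter (U i) \<le> 1" using U by auto
        have d0: "0 \<le> diameter (U i)" by (rule diameter_ge_0[OF bd(1)])
        define D where "D = C * diameter (U i) powr s"
        have D: "\<bar>t - u\<bar> \<le> D" if "t \<in> T i" "u \<in> T i" for t u
        proof -
          have "\<bar>t - u\<bar> \<le> C * dist (A t) (A u) powr s"
            using that by (intro hoelder) (auto simp: T_def)
          also have "\<dots> \<le> D"
            unfolding D_def using that C s diameter_bounded_bound[OF bd(1), of "A t" "A u"]
            by (intro mult_left_mono powr_mono2) (auto simp: T_def)
          finally show ?thesis .
        qed
        have bdd: "bdd_below (T i)" by (rule bdd_belowI[of _ 0]) (auto simp: T_def)
        define a where "a = Inf (T i)"
        have "T i \<subseteq> {a..a + D}"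
        proof
          fix t assume t: "t \<in> T i"
          have "t - D \<le> a"
            unfolding a_def using False D[OF t] by (intro cInf_greatest) (force simp: abs_le_iff)+
          moreover have "a \<le> t" unfolding a_def by (rule cInf_lower[OF t bdd])
          ultimately show "t \<in> {a..a + D}" by auto
        qed
        moreover have "0 \<le> D" using C by (simp add: D_def)
        moreover have "ennreal D \<le> C * diam_pow s' (U i)"
        \<comment> \<open>Exponent 0 is treated separately because \<open>diam_pow 0\<close> counts
          every nonempty set as 1, even a single point.\<close>
        proof (cases "s' = 0")
          case True
          have "U i \<noteq> {}" using False by (auto simp: T_def)
          moreover have "diameter (U i) powr s \<le> 1"
            using powr_mono2[of s "diameter (U i)" 1] d0 bd s by simp
          ultimately show ?thesis using True C
            by (auto simp: diam_pow_def D_def intro!: ennreal_leI)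
        next
          case s'': False
          have "U i \<noteq> {}" using False by (auto simp: T_def)
          moreover have "diameter (U i) powr s \<le> diameter (U i) powr s'"
            using d0 bd \<open>\<not> s \<le> s'\<close> s' by (intro powr_mono') auto
          ultimately show ?thesis using s'' C
            by (auto simp: diam_pow_def D_def ennreal_mult'[symmetric] intro!: ennreal_leI)
        qed
        ultimately show ?thesis by (intro exI[of _ a] exI[of _ "a + D"]) auto
      qed
      then obtain a b where ab: "\<And>i. a i \<le> b i" "\<And>i. T i \<subseteq> {a i..b i}"
          "\<And>i. ennreal (b i - a i) \<le> C * diam_pow s' (U i)" by metis
      have "{0..<1} \<subseteq> (\<Union>i. {a i..b i})"
      proof
        fix t :: real assume t: "t \<in> {0..<1}"
        then obtain i where "A t \<in> U i" using A U(1) by blast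
        then have "t \<in> T i" using t by (simp add: T_def)
        then show "t \<in> (\<Union>i. {a i..b i})" using ab(2) by blast
      qed
      then have "1 \<le> (\<Sum>i. ennreal (b i - a i))"
        using ab(1) by (rule real_interval_cover_suminf_ge)
      also have "\<dots> \<le> (\<Sum>i. C * diam_pow s' (U i))"
        by (intro suminf_le ab) auto
      also have "\<dots> = C * (\<Sum>i. diam_pow s' (U i))" by simp
      finally have "ennreal (inverse C) * 1 \<le> ennreal (inverse C) * (C * (\<Sum>i. diam_pow s' (U i)))"
        by (rule mult_left_mono) simp
      also have "\<dots> = (\<Sum>i. diam_pow s' (U i))"
        using C by (simp add: mult.assoc[symmetric] ennreal_mult'[symmetric])
      finally show "ennreal (inverse C) \<le> (\<Sum>i. diam_pow s' (U i))" by simp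
    qed
    also have "\<dots> \<le> hausdorff_measure s' S"
      unfolding hausdorff_measure_def by (rule SUP_upper) auto
    finally show False using s' C by simp
  qed
qed

text \<open>The balls of a packing are sorted by dyadic size of their radii. At each level their
  number is at most the size of a net, because disjoint balls cannot share a net point; the
  resulting sums form the tail of a geometric series of ratio \<open>2 powr (d - s)\<close>.\<close>

lemma packing_premeasure_eq_0:
  fixes E :: "'a::euclidean_space set"
  assumes cover: "\<And>\<rho>. 0 < \<rho> \<Longrightarrow> \<rho> \<le> 1 \<Longrightarrow>
      \<exists>X. finite X \<and> real (card X) \<le> C * \<rho> powr (- d) \<and> (\<forall>x\<in>E. \<exists>y\<in>X. dist x y \<le> \<rho>)"
    and s: "d < s" "0 \<le> s" and C: "0 \<le> C"
  shows "packing_premeasure s E = 0"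
proof -
  have "packing_premeasure s E \<le> 0 + ennreal e" if e: "0 < e" for e
  proof -
    \<comment> \<open>The product of the net bound \<open>C * \<rho> powr (- d)\<close> at
      \<open>\<rho> = (1/2) ^ Suc k\<close> and the largest summand
      \<open>(2 * (1/2) ^ k) powr s\<close>.\<close>
    define a where "a k = C * 2 powr (d + s) * (2 powr (d - s)) ^ k" for k :: nat
    have "2 powr (d - s) < 2 powr 0" using s by (intro powr_less_mono) auto
    then have "norm (2 powr (d - s)) < 1" by simp
    then have "summable a" unfolding a_def by (intro summable_mult summable_geometric)
    then obtain k0 where k0: "\<And>m n. m \<ge> k0 \<Longrightarrow> norm (sum a {m..<n}) < e"
      using e unfolding summable_Cauchy by blast
    have a0: "0 \<le> a k" for k using C by (simp add: a_def)
    define \<delta> :: real where "\<delta> = (1/2) ^ k0"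
    have "(\<Sum>\<^sub>\<infinity>(x, r)\<in>P. ennreal ((2 * r) powr s)) \<le> ennreal e" if P: "P \<in> packings \<delta> E" for P
    proof -
      have "sum (\<lambda>(x, r). ennreal ((2 * r) powr s)) F \<le> ennreal e" if F: "finite F" "F \<subseteq> P" for F
      proof -
        have rad: "0 < r" "r \<le> \<delta>" "x \<in> E" if "(x, r) \<in> F" for x r
          using that P F by (auto simp: packings_def)
        have "\<exists>k\<ge>k0. (1/2) ^ Suc k < snd z \<and> snd z \<le> (1/2) ^ k" if z: "z \<in> F" for z
        proof -
          have r: "0 < snd z" "snd z \<le> \<delta>" using rad[of "fst z" "snd z"] z by auto
          obtain n where "(1/2) ^ n < snd z" using real_arch_pow_inv[of "snd z" "1/2"] r by auto
          define l where "l = (LEAST n. (1/2) ^ n < snd z)"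
          have l: "(1/2) ^ l < snd z" unfolding l_def by (rule LeastI) fact
          have "(1/2) ^ l < ((1/2) ^ k0 :: real)"
            using less_le_trans[OF l r(2)] by (simp only: \<delta>_def)
          then have "k0 < l"
            by (subst (asm) power_strict_decreasing_iff) simp_all
          then have k: "l = Suc (l - 1)" "k0 \<le> l - 1" by linarith+
          have "l - 1 < l" using k by linarith
          then have "\<not> (1/2) ^ (l - 1) < snd z" unfolding l_def by (rule not_less_Least)
          then have "snd z \<le> (1/2) ^ (l - 1)" by (rule leI)
          moreover have "(1/2) ^ Suc (l - 1) < snd z" using l k(1) by metis
          ultimately show ?thesis using k(2) by metis
        qed
        then obtain h where h: "\<And>z. z \<in> F \<Longrightarrow> h z \<ge> k0" "\<And>z. z \<in> F \<Longrightarrow> (1/2) ^ Suc (h z) < snd z"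
            "\<And>z. z \<in> F \<Longrightarrow> snd z \<le> (1/2) ^ h z" by metis
        have level: "(\<Sum>z | z \<in> F \<and> h z = k. (2 * snd z) powr s) \<le> a k" for k
        proof -
          define Fk where "Fk = {z \<in> F. h z = k}"
          have fin: "finite Fk" using F by (simp add: Fk_def)
          define \<rho> :: real where "\<rho> = (1/2) ^ Suc k"
          have \<rho>: "0 < \<rho>" "\<rho> \<le> 1" unfolding \<rho>_def by (auto intro!: power_le_one simp del: power_Suc)
          obtain X where X: "finite X" "real (card X) \<le> C * \<rho> powr (- d)"
              "\<forall>x\<in>E. \<exists>y\<in>X. dist x y \<le> \<rho>"
            using cover[OF \<rho>] by blast
          have "\<forall>z\<in>Fk. \<exists>y\<in>X. dist (fst z) y \<le> \<rho>"
            using X(3) rad by (auto simp: Fk_def)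
          then obtain f where f: "\<And>z. z \<in> Fk \<Longrightarrow> f z \<in> X" "\<And>z. z \<in> Fk \<Longrightarrow> dist (fst z) (f z) \<le> \<rho>"
            by metis
          have "inj_on f Fk"
          \<comment> \<open>Radii at level \<open>k\<close> exceed \<open>\<rho>\<close>, so a net
            point serving two centres would lie in both balls.\<close>
          proof (rule inj_onI, rule ccontr)
            fix z w assume zw: "z \<in> Fk" "w \<in> Fk" "f z = f w" "z \<noteq> w"
            have "disjoint_family_on (\<lambda>(x, r). cball x r) P"
              using P by (simp add: packings_def)
            moreover have "z \<in> P" "w \<in> P" using zw F by (auto simp: Fk_def)
            ultimately have "cball (fst z) (snd z) \<inter> cball (fst w) (snd w) = {}"
              using zw(4) unfolding disjoint_family_on_def case_prod_unfold by blast
            moreover have "f z \<in> cball (fst z) (snd z)"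
              using f(2)[OF zw(1)] h(2)[of z] zw(1) by (simp add: Fk_def \<rho>_def)
            moreover have "f z \<in> cball (fst w) (snd w)"
              using f(2)[OF zw(2)] h(2)[of w] zw(2) by (simp add: zw(3) Fk_def \<rho>_def)
            ultimately show False by blast
          qed
          then have "card Fk \<le> card X" using f(1) X(1) by (intro card_inj_on_le[of f]) auto
          then have card: "real (card Fk) \<le> C * \<rho> powr (- d)" using X(2) by linarith
          have pw: "((1/2) ^ n :: real) = 2 powr (- real n)" for n
            by (simp add: powr_minus powr_realpow power_one_over inverse_eq_divide)
          have "(\<Sum>z\<in>Fk. (2 * snd z) powr s) \<le> (\<Sum>z\<in>Fk. (2 * (1/2) ^ k) powr s)"
          proof (intro sum_mono powr_mono2)
            fix z assume "z \<in> Fk"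
            then show "0 \<le> 2 * snd z" "2 * snd z \<le> 2 * (1/2) ^ k"
              using rad[of "fst z" "snd z"] h(3)[of z] by (auto simp: Fk_def)
          qed (use s in auto)
          also have "\<dots> = real (card Fk) * (2 * (1/2) ^ k) powr s" by simp
          also have "\<dots> \<le> (C * \<rho> powr (- d)) * (2 * (1/2) ^ k) powr s"
            using card by (intro mult_right_mono) auto
          also have "\<dots> = a k"
          proof -
            have "2 * (1/2) ^ k = 2 powr (1 - real k)"
              unfolding pw by (simp add: powr_diff powr_minus divide_inverse)
            moreover have "(2 powr (d - s)) ^ k = 2 powr ((d - s) * real k)"
              by (simp add: powr_powr flip: powr_realpow[of "2 powr (d - s)" k])
            moreover have "\<rho> powr (- d) = 2 powr (real (Suc k) * d)"
              unfolding \<rho>_def pw by (simp add: powr_powr algebra_simps)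
            moreover have "real (Suc k) * d + (1 - real k) * s = d + s + (d - s) * real k"
              by (simp add: algebra_simps)
            ultimately show ?thesis
              unfolding a_def by (simp add: powr_powr mult.assoc flip: powr_add)
          qed
          finally show ?thesis by (simp add: Fk_def)
        qed
        have "(\<Sum>z\<in>F. (2 * snd z) powr s) = (\<Sum>k\<in>h ` F. \<Sum>z | z \<in> F \<and> h z = k. (2 * snd z) powr s)"
          by (rule sum.image_gen[OF F(1)])
        also have "\<dots> \<le> (\<Sum>k\<in>h ` F. a k)" by (intro sum_mono level)
        also have "\<dots> \<le> (\<Sum>k\<in>{k0..<Suc (Max (h ` F \<union> {0}))}. a k)"
          using F(1) h(1) a0 by (intro sum_mono2) (auto simp: less_Suc_eq_le)
        also have "\<dots> \<le> e" using k0[of k0 "Suc (Max (h ` F \<union> {0}))"] by simp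
        finally have "ennreal (\<Sum>z\<in>F. (2 * snd z) powr s) \<le> ennreal e" by (rule ennreal_leI)
        then show ?thesis by (simp add: case_prod_unfold sum_ennreal)
      qed
      then show ?thesis
        by (subst nonneg_infsum_complete) (auto intro!: SUP_least)
    qed
    then have "(SUP P \<in> packings \<delta> E. \<Sum>\<^sub>\<infinity>(x, r)\<in>P. ennreal ((2 * r) powr s)) \<le> ennreal e"
      by (rule SUP_least)
    moreover have "packing_premeasure s E
        \<le> (SUP P \<in> packings \<delta> E. \<Sum>\<^sub>\<infinity>(x, r)\<in>P. ennreal ((2 * r) powr s))"
      unfolding packing_premeasure_def by (rule INF_lower) (simp add: \<delta>_def)
    ultimately show ?thesis by simp
  qed
  then have "packing_premeasure s E \<le> 0" by (rule ennreal_le_epsilon) blast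
  then show ?thesis by simp
qed

text \<open>The infimum over countable covers in \<open>packing_measure\<close> allows the constant
  \<open>C\<close> to depend on the piece \<open>E i\<close>.\<close>

lemma packing_dim_le:
  fixes E :: "nat \<Rightarrow> 'a::euclidean_space set"
  assumes S: "S \<subseteq> (\<Union>i. E i)" and d: "0 \<le> d"
    and cover: "\<And>i. \<exists>C\<ge>0. \<forall>\<rho>. 0 < \<rho> \<and> \<rho> \<le> 1 \<longrightarrow>
      (\<exists>X. finite X \<and> real (card X) \<le> C * \<rho> powr (- d) \<and> (\<forall>x\<in>E i. \<exists>y\<in>X. dist x y \<le> \<rho>))"
  shows "packing_dim S \<le> ereal d"
proof (rule ereal_le_epsilon2)
  fix e :: real assume e: "0 < e"
  have "packing_premeasure (d + e) (E i) = 0" for i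
  proof -
    obtain C where "C \<ge> 0" "\<forall>\<rho>. 0 < \<rho> \<and> \<rho> \<le> 1 \<longrightarrow>
      (\<exists>X. finite X \<and> real (card X) \<le> C * \<rho> powr (- d) \<and> (\<forall>x\<in>E i. \<exists>y\<in>X. dist x y \<le> \<rho>))"
      using cover by blast
    then show ?thesis using d e by (intro packing_premeasure_eq_0[where C = C and d = d]) auto
  qed
  then have "packing_measure (d + e) S \<le> 0"
    unfolding packing_measure_def using S by (intro INF_lower2[of E]) auto
  then show "packing_dim S \<le> ereal d + ereal e"
    unfolding packing_dim_def using d e by (auto intro!: Inf_lower)
qed

text \<open>Balls of one common radius around separated points already form a packing, and
  \<open>B\<close> is arbitrary at every scale.\<close>

lemma packing_premeasure_eq_top:
  fixes E :: "'a::euclidean_space set"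
  assumes sep: "\<And>B \<delta>. 0 < \<delta> \<Longrightarrow> \<exists>X r. finite X \<and> X \<subseteq> E \<and> 0 < r \<and> r \<le> \<delta> \<and> B \<le> real (card X) * (2 * r) powr s \<and>
      (\<forall>x\<in>X. \<forall>y\<in>X. x \<noteq> y \<longrightarrow> 2 * r < dist x y)"
  shows "packing_premeasure s E = top"
proof -
  have "(SUP P \<in> packings \<delta> E. \<Sum>\<^sub>\<infinity>(x, r)\<in>P. ennreal ((2 * r) powr s)) = top" if \<delta>: "0 < \<delta>" for \<delta>
  proof -
    have "of_nat n \<le> (SUP P \<in> packings \<delta> E. \<Sum>\<^sub>\<infinity>(x, r)\<in>P. ennreal ((2 * r) powr s))" for n
    proof -
      obtain X r where X: "finite X" "X \<subseteq> E" "0 < r" "r \<le> \<delta>" "real n \<le> real (card X) * (2 * r) powr s"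
          "\<forall>x\<in>X. \<forall>y\<in>X. x \<noteq> y \<longrightarrow> 2 * r < dist x y"
        using sep[OF \<delta>, of n] by blast
      have disj: "cball x r \<inter> cball y r = {}" if "x \<in> X" "y \<in> X" "x \<noteq> y" for x y
        using X(6) that by (intro disjoint_cballI) fastforce
      have "X \<times> {r} \<in> packings \<delta> E"
        using X disj by (auto simp: packings_def disjoint_family_on_def intro: countable_finite)
      moreover have "of_nat n \<le> (\<Sum>\<^sub>\<infinity>(x, r)\<in>X \<times> {r}. ennreal ((2 * r) powr s))"
      proof -
        have "(\<Sum>\<^sub>\<infinity>(x, r)\<in>X \<times> {r}. ennreal ((2 * r) powr s)) = (\<Sum>(x, r)\<in>X \<times> {r}. ennreal ((2 * r) powr s))"
          using X(1) by (intro infsum_finite) auto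
        also have "\<dots> = (\<Sum>z\<in>X \<times> {r}. ennreal ((2 * r) powr s))"
          by (intro sum.cong) auto
        also have "\<dots> = ennreal (real (card X) * (2 * r) powr s)"
          by (simp add: ennreal_mult ennreal_of_nat_eq_real_of_nat card_cartesian_product)
        finally show ?thesis using ennreal_leI[OF X(5)] by (simp add: ennreal_of_nat_eq_real_of_nat)
      qed
      ultimately show ?thesis by (rule SUP_upper2)
    qed
    then show ?thesis
      by (metis ennreal_SUP_of_nat_eq_top SUP_least top.extremum_unique)
  qed
  then show ?thesis unfolding packing_premeasure_def by auto
qed

text \<open>Of countably many pieces covering \<open>S\<close>, one meets a fixed proportion of the cells
  \<open>\<lfloor>t * M j\<rfloor> = k\<close> for every \<open>j\<close>: otherwise the cells met would cover the unit interval
  with total length less than \<open>1\<close>.\<close>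

lemma packing_measure_neq_0:
  fixes A :: "real \<Rightarrow> 'a::euclidean_space" and M :: "nat \<Rightarrow> nat" and r :: "nat \<Rightarrow> real"
  assumes A: "\<And>t. t \<in> {0..<1} \<Longrightarrow> A t \<in> S"
    and M: "\<And>j. 0 < M j" and r: "\<And>j. 0 < r j" "r \<longlonglongrightarrow> 0"
    and sep: "\<And>j t u. t \<in> {0..<1} \<Longrightarrow> u \<in> {0..<1} \<Longrightarrow> \<lfloor>t * real (M j)\<rfloor> \<noteq> \<lfloor>u * real (M j)\<rfloor> \<Longrightarrow> 2 * r j < dist (A t) (A u)"
    and lim: "filterlim (\<lambda>j. real (M j) * (2 * r j) powr s) at_top sequentially"
  shows "packing_measure s S \<noteq> 0"
proof -
  have "(\<Sum>i. packing_premeasure s (E i)) = top" if S: "S \<subseteq> (\<Union>i. E i)" for E :: "nat \<Rightarrow> 'a set"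
  proof -
    define K where "K i j = (\<lambda>t. \<lfloor>t * real (M j)\<rfloor>) ` {t \<in> {0..<1}. A t \<in> E i}" for i j
    have K_sub: "K i j \<subseteq> {0..<int (M j)}" for i j
    proof
      fix k assume "k \<in> K i j"
      then obtain t where t: "0 \<le> t" "t < 1" "k = \<lfloor>t * real (M j)\<rfloor>" by (auto simp: K_def)
      have "t * real (M j) < 1 * real (M j)" using t M[of j] by (intro mult_strict_right_mono) auto
      then show "k \<in> {0..<int (M j)}" using t by (auto simp: floor_less_iff)
    qed
    have K_fin: "finite (K i j)" for i j using K_sub by (rule finite_subset) simp
    \<comment> \<open>The proportions add up to 1/2. Whole closed cells are measured in place of the
      pieces, which need not be measurable, and the level \<open>J i\<close> at which a piece falls
      short may vary with \<open>i\<close>.\<close>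
    have "\<exists>i. \<forall>j. (1/2) ^ (i + 2) * real (M j) \<le> real (card (K i j))"
    proof (rule ccontr)
      assume "\<not> ?thesis"
      then obtain J where J: "\<And>i. real (card (K i (J i))) < (1/2) ^ (i + 2) * real (M (J i))"
        by (metis not_le)
      define I where "I i k = {real_of_int k / real (M (J i))..(real_of_int k + 1) / real (M (J i))}" for i k
      define V where "V i = (\<Union>k\<in>K i (J i). I i k)" for i
      have Vm: "V i \<in> sets lborel" for i
        unfolding V_def I_def using K_fin by (intro sets.finite_UN) auto
      have "{0..<1} \<subseteq> (\<Union>i. V i)"
      proof
        fix t :: real assume t: "t \<in> {0..<1}"
        then obtain i where i: "A t \<in> E i" using A S by blast
        have "\<lfloor>t * real (M (J i))\<rfloor> \<in> K i (J i)" using t i by (auto simp: K_def)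
        moreover have "t \<in> I i \<lfloor>t * real (M (J i))\<rfloor>"
          unfolding I_def using M[of "J i"] real_of_int_floor_add_one_ge[of "t * real (M (J i))"]
          by (auto simp: field_simps)
        ultimately show "t \<in> (\<Union>i. V i)" by (auto simp: V_def)
      qed
      then have "emeasure lborel {0..<1::real} \<le> emeasure lborel (\<Union>i. V i)"
        using Vm by (intro emeasure_mono) auto
      then have "1 \<le> emeasure lborel (\<Union>i. V i)" by simp
      also have "\<dots> \<le> (\<Sum>i. emeasure lborel (V i))"
        using Vm by (intro emeasure_subadditive_countably) auto
      also have "\<dots> \<le> (\<Sum>i. ennreal ((1/2) * (1/2) ^ Suc i))"
      proof (intro suminf_le allI)
        fix i
        have "emeasure lborel (V i) \<le> (\<Sum>k\<in>K i (J i). emeasure lborel (I i k))"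
          unfolding V_def using K_fin by (intro emeasure_subadditive_finite) (auto simp: I_def)
        also have "\<dots> = (\<Sum>k\<in>K i (J i). ennreal (1 / real (M (J i))))"
          unfolding I_def using M[of "J i"]
          by (intro sum.cong refl, subst emeasure_lborel_Icc) (auto simp: field_simps)
        also have "\<dots> = ennreal (real (card (K i (J i))) / real (M (J i)))"
          by (simp add: ennreal_of_nat_eq_real_of_nat ennreal_mult'[symmetric])
        also have "\<dots> \<le> ennreal ((1/2) * (1/2) ^ Suc i)"
          using J[of i] M[of "J i"] by (intro ennreal_leI) (auto simp: field_simps)
        finally show "emeasure lborel (V i) \<le> ennreal ((1/2) * (1/2) ^ Suc i)" .
      qed auto
      also have "\<dots> = ennreal (1/2 * 1)"
        by (intro suminf_ennreal_eq sums_mult power_half_series) auto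
      finally have "ennreal 1 \<le> ennreal (1/2)" by simp
      then have "(1::real) \<le> 1/2" by (subst (asm) ennreal_le_iff) auto
      then show False by simp
    qed
    then obtain i where i: "\<And>j. (1/2) ^ (i + 2) * real (M j) \<le> real (card (K i j))" by blast
    have "packing_premeasure s (E i) = top"
    proof (rule packing_premeasure_eq_top)
      fix B \<delta> :: real assume \<delta>: "0 < \<delta>"
      have "\<forall>\<^sub>F j in sequentially. r j < \<delta>" using r(2) \<delta> by (intro order_tendstoD(2)) auto
      moreover have "\<forall>\<^sub>F j in sequentially. B * 2 ^ (i + 2) \<le> real (M j) * (2 * r j) powr s"
        using lim unfolding filterlim_at_top by blast
      ultimately obtain j where j: "r j < \<delta>" "B * 2 ^ (i + 2) \<le> real (M j) * (2 * r j) powr s"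
        using eventually_happens[OF eventually_conj] by fastforce
      have "\<forall>k\<in>K i j. \<exists>t\<in>{0..<1}. A t \<in> E i \<and> \<lfloor>t * real (M j)\<rfloor> = k"
        by (auto simp: K_def)
      then obtain T where T: "\<And>k. k \<in> K i j \<Longrightarrow> T k \<in> {0..<1} \<and> A (T k) \<in> E i \<and> \<lfloor>T k * real (M j)\<rfloor> = k"
        by metis
      have sepT: "2 * r j < dist (A (T k)) (A (T l))" if "k \<in> K i j" "l \<in> K i j" "k \<noteq> l" for k l
        using T[OF that(1)] T[OF that(2)] that(3) by (intro sep) auto
      then have "inj_on (\<lambda>k. A (T k)) (K i j)"
        using r(1)[of j] by (intro inj_onI) (metis dist_self less_le_trans mult_pos_pos not_less_iff_gr_or_eq zero_less_numeral)
      then have card: "card ((\<lambda>k. A (T k)) ` K i j) = card (K i j)" by (rule card_image)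
      show "\<exists>X r. finite X \<and> X \<subseteq> E i \<and> 0 < r \<and> r \<le> \<delta> \<and> B \<le> real (card X) * (2 * r) powr s \<and>
          (\<forall>x\<in>X. \<forall>y\<in>X. x \<noteq> y \<longrightarrow> 2 * r < dist x y)"
      proof (intro exI[of _ "(\<lambda>k. A (T k)) ` K i j"] exI[of _ "r j"] conjI)
        have "B \<le> (1/2) ^ (i + 2) * (real (M j) * (2 * r j) powr s)"
          using j(2) by (simp add: field_simps power_divide)
        also have "\<dots> \<le> real (card (K i j)) * (2 * r j) powr s"
          using mult_right_mono[OF i[of j], of "(2 * r j) powr s"] by (simp add: mult.assoc)
        finally show "B \<le> real (card ((\<lambda>k. A (T k)) ` K i j)) * (2 * r j) powr s"
          by (simp add: card)
        show "\<forall>x\<in>(\<lambda>k. A (T k)) ` K i j. \<forall>y\<in>(\<lambda>k. A (T k)) ` K i j. x \<noteq> y \<longrightarrow> 2 * r j < dist x y"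
        proof (intro ballI impI)
          fix x y assume xy: "x \<in> (\<lambda>k. A (T k)) ` K i j" "y \<in> (\<lambda>k. A (T k)) ` K i j" "x \<noteq> y"
          from xy(1) obtain k where k: "k \<in> K i j" "x = A (T k)" by (rule imageE)
          from xy(2) obtain l where l: "l \<in> K i j" "y = A (T l)" by (rule imageE)
          have "k \<noteq> l" using xy(3) k(2) l(2) by metis
          then show "2 * r j < dist x y" using sepT[OF k(1) l(1)] k(2) l(2) by metis
        qed
        show "(\<lambda>k. A (T k)) ` K i j \<subseteq> E i"
        proof (rule image_subsetI)
          fix k assume "k \<in> K i j"
          from T[OF this] show "A (T k) \<in> E i" by (elim conjE)
        qed
      qed (use K_fin j(1) r(1) in \<open>auto intro: less_imp_le\<close>)
    qed
    show ?thesis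
    proof (rule ccontr)
      assume "\<not> ?thesis"
      then have "(\<Sum>i. packing_premeasure s (E i)) < top" by (simp add: less_top)
      from ennreal_suminf_lessD[OF this, of i] show False
        using \<open>packing_premeasure s (E i) = top\<close> by simp
    qed
  qed
  then have "top \<le> packing_measure s S"
    unfolding packing_measure_def by (intro INF_greatest) simp
  then show ?thesis by (auto simp: top_unique)
qed

section \<open>Norms and uniform exponents\<close>

lemma two_powr_power: "(2 powr a) ^ n = 2 powr (a * real n)" for a :: real
  by (simp add: powr_power mult.commute)

lemma is_norm_nonneg:
  assumes "is_norm N"
  shows "0 \<le> N x"
proof -
  have "N (x + (- 1) *\<^sub>R x) \<le> N x + N ((- 1) *\<^sub>R x)"
    using assms unfolding is_norm_def by blast
  moreover have "N ((- 1) *\<^sub>R x) = \<bar>- 1\<bar> * N x" "N 0 = 0"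
    using assms unfolding is_norm_def by blast+
  ultimately show ?thesis by simp
qed

lemma is_norm_le_norm:
  fixes N :: "'a::euclidean_space \<Rightarrow> real"
  assumes N: "is_norm N"
  shows "\<exists>C>0. \<forall>x. N x \<le> C * norm x"
proof (intro exI conjI allI)
  define C where "C = (\<Sum>b\<in>Basis. N b) + 1"
  show "0 < C"
    unfolding C_def using is_norm_nonneg[OF N] by (intro add_nonneg_pos sum_nonneg) auto
  fix x :: 'a
  have sum: "N (\<Sum>b\<in>B. f b) \<le> (\<Sum>b\<in>B. N (f b))" if "finite B" for B and f :: "'a \<Rightarrow> 'a"
    using that
  proof induction
    case empty
    have "N 0 = 0" using N unfolding is_norm_def by blast
    then show ?case by simp
  next
    case (insert b B)
    have "N (f b + (\<Sum>b\<in>B. f b)) \<le> N (f b) + N (\<Sum>b\<in>B. f b)"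
      using N unfolding is_norm_def by blast
    then show ?case using insert by simp
  qed
  have "N x = N (\<Sum>b\<in>Basis. (x \<bullet> b) *\<^sub>R b)" by (simp add: euclidean_representation)
  also have "\<dots> \<le> (\<Sum>b\<in>Basis. N ((x \<bullet> b) *\<^sub>R b))" by (rule sum) simp
  also have "\<dots> = (\<Sum>b\<in>Basis. \<bar>x \<bullet> b\<bar> * N b)"
    using N unfolding is_norm_def by (intro sum.cong) auto
  also have "\<dots> \<le> (\<Sum>b\<in>Basis. norm x * N b)"
    using is_norm_nonneg[OF N] by (intro sum_mono mult_right_mono Basis_le_norm) auto
  also have "\<dots> = norm x * (\<Sum>b\<in>Basis. N b)" by (simp add: sum_distrib_left)
  also have "\<dots> \<le> C * norm x" unfolding C_def by (simp add: algebra_simps)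
  finally show "N x \<le> C * norm x" .
qed

lemma is_norm_ge_norm:
  fixes N :: "'a::euclidean_space \<Rightarrow> real"
  assumes N: "is_norm N"
  shows "\<exists>c>0. \<forall>x. c * norm x \<le> N x"
proof -
  obtain C where C: "C > 0" "\<And>x. N x \<le> C * norm x" using is_norm_le_norm[OF N] by blast
  have tri: "N (x + y) \<le> N x + N y" and hom: "N (c *\<^sub>R x) = \<bar>c\<bar> * N x"
    and zero: "N x = 0 \<longleftrightarrow> x = 0" for x y c
    using N unfolding is_norm_def by blast+
  have "N x - N y \<le> C * norm (x - y)" for x y
    using tri[of "x - y" y] C(2)[of "x - y"] by simp
  then have lip: "\<bar>N x - N y\<bar> \<le> C * norm (x - y)" for x y
    by (metis abs_le_iff minus_diff_eq norm_minus_commute)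
  have "C-lipschitz_on (sphere 0 1) N"
    using lip C(1) by (intro lipschitz_onI) (auto simp: dist_norm)
  then have cont: "continuous_on (sphere 0 1) N" by (rule lipschitz_on_continuous_on)
  have "sphere (0::'a) 1 \<noteq> {}" by simp
  then obtain z :: 'a where "z \<in> sphere 0 1" "\<forall>y\<in>sphere 0 1. N z \<le> N y"
    using continuous_attains_inf[OF compact_sphere _ cont] by blast
  then have z: "norm z = 1" "\<And>y. norm y = 1 \<Longrightarrow> N z \<le> N y" by auto
  have "z \<noteq> 0" using z(1) by auto
  then have "N z > 0" using is_norm_nonneg[OF N, of z] zero[of z] by linarith
  moreover have "N z * norm x \<le> N x" for x
  proof (cases "x = 0")
    case True
    then show ?thesis using zero[of 0] by simp
  next
    case False
    have "N z \<le> N ((1 / norm x) *\<^sub>R x)" using False by (intro z(2)) simp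
    then show ?thesis using False by (simp add: hom field_simps)
  qed
  ultimately show ?thesis by blast
qed

lemma is_norm_real:
  assumes "is_norm (N1 :: real \<Rightarrow> real)"
  shows "N1 x = \<bar>x\<bar> * N1 1" "0 < N1 1"
proof -
  show "N1 x = \<bar>x\<bar> * N1 1"
    using assms unfolding is_norm_def by (metis mult.right_neutral real_scaleR_def)
  show "0 < N1 1"
    using assms is_norm_nonneg[OF assms, of 1] unfolding is_norm_def by (metis less_le one_neq_zero)
qed

section \<open>Integer vectors and approximability at dyadic scales\<close>

definition ivec :: "int ^ 'm \<Rightarrow> real ^ 'm" where
  "ivec p = (\<chi> i. of_int (p $ i))"

lemma ivec_nth [simp]: "ivec p $ i = of_int (p $ i)"
  by (simp add: ivec_def)

lemma ivec_add: "ivec (p + r) = ivec p + ivec r"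
  and ivec_diff: "ivec (p - r) = ivec p - ivec r"
  and ivec_minus: "ivec (- p) = - ivec p"
  by (simp_all add: vec_eq_iff)

lemma ivec_scale: "ivec (k *s p) = of_int k *\<^sub>R ivec p"
  by (simp add: vec_eq_iff)

text \<open>A normalised form of the exponent condition: dyadic bounds on the denominator, the
  Euclidean norm, positive \<open>q\<close>, and a minus sign so that \<open>p / q\<close>
  approximates \<open>A\<close>. The starting index \<open>J\<close> is explicit, so that the union
  over \<open>J\<close> is countable and each piece is uniform.\<close>

definition approximable :: "real \<Rightarrow> nat \<Rightarrow> (real ^ 'm) set" where
  "approximable w J = {A. \<forall>j\<ge>J. \<exists>p q. 0 < q \<and> of_int q \<le> (2::real) ^ j \<and>
     norm (of_int q *\<^sub>R A - ivec p) \<le> 2 powr (- (w * real j))}"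

lemma exponent_set_downward:
  assumes "ereal w < uniform_exponent N N1 A"
  shows "\<exists>v>w. \<forall>\<^sub>F Q in at_top. \<exists>p q.
     N (of_int q *\<^sub>R A + ivec p) \<le> Q powr (- v) \<and> 0 < N1 (of_int q) \<and> N1 (of_int q) \<le> Q"
  using assms unfolding uniform_exponent_def ivec_def less_Sup_iff by auto

text \<open>Both norms cost only constant factors, which the gap between \<open>v\<close> and
  \<open>w\<close> absorbs for large \<open>j\<close>. Sampling at \<open>Q = k * 2 ^ j\<close>
  turns the bound on \<open>N1\<close> into one on \<open>q\<close>, and a negative \<open>q\<close>
  is replaced by its opposite.\<close>

lemma approximable_of_exponent:
  fixes N :: "real ^ 'm \<Rightarrow> real"
  assumes N: "is_norm N" and N1: "is_norm N1" and A: "ereal w < uniform_exponent N N1 A"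
  shows "A \<in> (\<Union>J. approximable w J)"
proof -
  obtain c where c: "c > 0" "\<And>x. c * norm x \<le> N x" using is_norm_ge_norm[OF N] by blast
  note N1' = is_norm_real[OF N1]
  define k where "k = N1 1"
  have k: "k > 0" "N1 x = \<bar>x\<bar> * k" for x unfolding k_def by (fact N1')+
  obtain v where v: "v > w" "\<forall>\<^sub>F Q in at_top. \<exists>p q.
     N (of_int q *\<^sub>R A + ivec p) \<le> Q powr (- v) \<and> 0 < N1 (of_int q) \<and> N1 (of_int q) \<le> Q"
    using exponent_set_downward[OF A] by blast
  have "filterlim (\<lambda>j. 2 ^ j :: real) at_top sequentially"
    by (rule filterlim_at_infinity_imp_filterlim_at_top[OF filterlim_realpow_sequentially_gt1]) auto
  then have "filterlim (\<lambda>j. k * 2 ^ j) at_top sequentially"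
    using k(1) by (rule filterlim_tendsto_pos_mult_at_top[OF tendsto_const, rotated])
  then have ev1: "\<forall>\<^sub>F j in sequentially. \<exists>p q.
     N (of_int q *\<^sub>R A + ivec p) \<le> (k * 2 ^ j) powr (- v) \<and> 0 < N1 (of_int q) \<and> N1 (of_int q) \<le> k * 2 ^ j"
    using v(2) by (rule eventually_compose_filterlim[rotated])
  have "(\<lambda>j. k powr (- v) / c * 2 powr (- ((v - w) * real j))) \<longlonglongrightarrow> k powr (- v) / c * 0"
  proof (rule tendsto_mult_left)
    have "(\<lambda>j. (2 powr (- (v - w))) ^ j) \<longlonglongrightarrow> 0"
      using v(1) powr_less_mono[of "- (v - w)" 0 2] by (intro LIMSEQ_realpow_zero) auto
    moreover have "(2 powr (- (v - w))) ^ j = 2 powr (- ((v - w) * real j))" for j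
      by (simp only: two_powr_power mult_minus_left)
    ultimately show "(\<lambda>j. 2 powr (- ((v - w) * real j))) \<longlonglongrightarrow> 0" by simp
  qed
  then have "\<forall>\<^sub>F j in sequentially. k powr (- v) / c * 2 powr (- ((v - w) * real j)) < 1"
    by (intro order_tendstoD(2)[where y = "k powr (- v) / c * 0"]) auto
  with ev1 have "\<forall>\<^sub>F j in sequentially. \<exists>p q. 0 < q \<and> of_int q \<le> (2::real) ^ j \<and>
     norm (of_int q *\<^sub>R A - ivec p) \<le> 2 powr (- (w * real j))"
  proof eventually_elim
    case (elim j)
    then obtain p q where pq: "N (of_int q *\<^sub>R A + ivec p) \<le> (k * 2 ^ j) powr (- v)"
      "0 < N1 (of_int q)" "N1 (of_int q) \<le> k * 2 ^ j" by blast
    have q: "q \<noteq> 0" "\<bar>of_int q\<bar> \<le> (2::real) ^ j"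
      using pq(2,3) k(1) unfolding k(2) by auto
    have "c * norm (of_int q *\<^sub>R A + ivec p) \<le> (k * 2 ^ j) powr (- v)"
      using c(2) pq(1) by (rule order.trans)
    also have "\<dots> = k powr (- v) * 2 powr (- ((v - w) * real j)) * 2 powr (- (w * real j))"
      using k(1) by (simp add: powr_mult powr_powr algebra_simps powr_add[symmetric] flip: powr_realpow)
    also have "k powr (- v) * 2 powr (- ((v - w) * real j)) \<le> c"
      using elim(2) c(1) by (simp add: field_simps)
    finally have "c * norm (of_int q *\<^sub>R A + ivec p) \<le> c * 2 powr (- (w * real j))"
      by simp
    then have err: "norm (of_int q *\<^sub>R A + ivec p) \<le> 2 powr (- (w * real j))"
      using c(1) by simp
    show ?case
    proof (cases "q > 0")
      case True
      then show ?thesis using q err by (intro exI[of _ "- p"] exI[of _ q]) (simp add: ivec_minus)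
    next
      case False
      have "norm (of_int (- q) *\<^sub>R A - ivec p) = norm (- (of_int q *\<^sub>R A + ivec p))" by simp
      then have "norm (of_int (- q) *\<^sub>R A - ivec p) = norm (of_int q *\<^sub>R A + ivec p)"
        by (simp only: norm_minus_cancel)
      then show ?thesis using False q err by (intro exI[of _ p] exI[of _ "- q"]) auto
    qed
  qed
  then show ?thesis unfolding approximable_def eventually_sequentially by blast
qed

text \<open>On a rational line the problem is one-dimensional: Dirichlet's theorem for the single
  parameter \<open>s\<close> gives errors of order \<open>1 / Q\<close>, up to factors depending
  only on the line.\<close>

lemma exponent_ge_1_rational_line:
  fixes N :: "real ^ 'm \<Rightarrow> real"
  assumes N: "is_norm N" and N1: "is_norm N1" and D: "0 < D"
    and A: "of_int D *\<^sub>R A = ivec a + s *\<^sub>R ivec b"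
  shows "1 \<le> uniform_exponent N N1 A"
proof (rule ccontr)
  assume "\<not> 1 \<le> uniform_exponent N N1 A"
  then obtain v where v: "uniform_exponent N N1 A < ereal v" "ereal v < 1"
    using ereal_dense2[of "uniform_exponent N N1 A" 1] unfolding not_le by blast
  obtain C where C: "C > 0" "\<And>x. N x \<le> C * norm x" using is_norm_le_norm[OF N] by blast
  define k where "k = N1 1"
  have k: "k > 0" "N1 x = \<bar>x\<bar> * k" for x
    unfolding k_def using is_norm_real[OF N1] by blast+
  define E where "E = C * norm (ivec b) * (2 * k * of_int D)"
  have E0: "E \<ge> 0" unfolding E_def using C(1) k(1) D by simp
  have "((\<lambda>Q. Q powr (- (1 - v))) \<longlongrightarrow> 0) at_top"
    using v(2) by (intro tendsto_neg_powr filterlim_ident) auto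
  then have "((\<lambda>Q. E * Q powr (- (1 - v))) \<longlongrightarrow> E * 0) at_top"
    by (intro tendsto_mult tendsto_const)
  then have "\<forall>\<^sub>F Q in at_top. E * Q powr (- (1 - v)) < 1"
    by (intro order_tendstoD(2)[where y = "E * 0"]) auto
  moreover have "\<forall>\<^sub>F Q in at_top. k * of_int D \<le> Q" "\<forall>\<^sub>F Q in at_top. (0::real) < Q"
    by (intro eventually_ge_at_top eventually_gt_at_top)+
  ultimately have "\<forall>\<^sub>F Q in at_top. \<exists>(p :: int ^ 'm) q. N (of_int q *\<^sub>R A + ivec p) \<le> Q powr (- v) \<and>
       0 < N1 (of_int q) \<and> N1 (of_int q) \<le> Q"
  proof eventually_elim
    case (elim Q)
    \<comment> \<open>The denominator used will be \<open>l * D\<close>; bounding \<open>l\<close>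
      by \<open>x\<close> keeps it within the allowed size \<open>Q\<close> after multiplication by
      \<open>N1 1\<close>.\<close>
    define x where "x = Q / (k * of_int D)"
    have x: "1 \<le> x" using elim D k(1) by (simp add: x_def)
    define n where "n = nat \<lfloor>x\<rfloor>"
    have n: "0 < n" "real n \<le> x" "x \<le> 2 * real n"
    proof -
      have "1 \<le> \<lfloor>x\<rfloor>" using x by simp
      then have "real n = of_int \<lfloor>x\<rfloor>" "0 < n" by (auto simp: n_def)
      moreover have "of_int \<lfloor>x\<rfloor> \<le> x" "x < of_int \<lfloor>x\<rfloor> + 1" by linarith+
      ultimately show "0 < n" "real n \<le> x" "x \<le> 2 * real n" by linarith+
    qed
    obtain h l where hl: "0 < l" "l \<le> int n" "\<bar>of_int l * s - of_int h\<bar> < 1 / real n"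
      using Dirichlet_approx[OF n(1)] by blast
    define q where "q = l * D"
    define p where "p = - (l *s a + h *s b)"
    have pv: "ivec p = - (of_int l *\<^sub>R ivec a) - of_int h *\<^sub>R ivec b"
      unfolding p_def ivec_minus ivec_add ivec_scale by simp
    have qv: "of_int q *\<^sub>R A = of_int l *\<^sub>R (of_int D *\<^sub>R A)" by (simp add: q_def)
    have "of_int q *\<^sub>R A + ivec p = (of_int l * s - of_int h) *\<^sub>R ivec b"
      unfolding pv qv A by (simp add: algebra_simps)
    then have "N (of_int q *\<^sub>R A + ivec p) \<le> C * (\<bar>of_int l * s - of_int h\<bar> * norm (ivec b))"
      using C(2)[of "(of_int l * s - of_int h) *\<^sub>R ivec b"] by simp
    also have "\<dots> \<le> C * (2 / x * norm (ivec b))"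
    proof (intro mult_left_mono mult_right_mono)
      have "1 / real n \<le> 2 / x" using n x by (simp add: field_simps)
      then show "\<bar>of_int l * s - of_int h\<bar> \<le> 2 / x" using hl(3) by linarith
    qed (use C(1) in auto)
    also have "\<dots> = E / Q" unfolding E_def x_def using elim k(1) D by (simp add: field_simps)
    also have "\<dots> = (E * Q powr (- (1 - v))) * Q powr (- v)"
      using elim(3) by (simp add: powr_diff powr_minus field_simps)
    also have "\<dots> \<le> Q powr (- v)"
      using elim(1) by (intro mult_left_le_one_le) (auto simp: E0)
    finally have "N (of_int q *\<^sub>R A + ivec p) \<le> Q powr (- v)" .
    moreover have "(0::real) < of_int q" using hl D by (simp add: q_def)
    moreover have "of_int q * k \<le> Q"
    proof -
      have "of_int q * k \<le> real n * of_int D * k"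
        unfolding q_def of_int_mult using hl(2) D k(1) of_int_le_iff[of l "int n", where 'a = real]
        by (intro mult_right_mono) auto
      also have "\<dots> \<le> x * of_int D * k" using n D k(1) by (intro mult_right_mono) auto
      also have "\<dots> = Q" using D k(1) by (simp add: x_def)
      finally show ?thesis .
    qed
    ultimately show ?case
      using k by (intro exI[of _ p] exI[of _ q]) (simp add: mult_pos_pos)
  qed
  then have "ereal v \<le> uniform_exponent N N1 A"
    unfolding uniform_exponent_def ivec_def by (intro Sup_upper) auto
  then show False using v(1) by simp
qed

section \<open>Rational points and changes of line\<close>

definition ratpt :: "int ^ 'm \<Rightarrow> int \<Rightarrow> real ^ 'm" where
  "ratpt p q = (1 / of_int q) *\<^sub>R ivec p"

lemma norm_diff_ratpt:
  assumes "0 < q"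
  shows "of_int q * norm (A - ratpt p q) = norm (of_int q *\<^sub>R A - ivec p)"
proof -
  have "of_int q *\<^sub>R A - ivec p = of_int q *\<^sub>R (A - ratpt p q)"
    using assms by (simp add: ratpt_def algebra_simps)
  then show ?thesis using assms by simp
qed

lemma norm_diff_ratpt_le:
  assumes "0 < q"
  shows "norm (A - ratpt p q) \<le> norm (of_int q *\<^sub>R A - ivec p)"
proof -
  have "1 * norm (A - ratpt p q) \<le> of_int q * norm (A - ratpt p q)"
    using assms by (intro mult_right_mono) auto
  then show ?thesis using norm_diff_ratpt[OF assms, of A p] by simp
qed

lemma not_collinear_minor:
  fixes u v :: "real ^ 'm"
  assumes "\<not> collinear {0, u, v}"
  shows "\<exists>a b. u $ a * v $ b - u $ b * v $ a \<noteq> 0"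
proof (rule ccontr)
  assume H: "\<nexists>a b. u $ a * v $ b - u $ b * v $ a \<noteq> 0"
  have "u \<noteq> 0" using assms by (auto simp: collinear_lemma)
  then obtain a where a: "u $ a \<noteq> 0" by (auto simp: vec_eq_iff)
  have "v $ b = (v $ a / u $ a) * u $ b" for b
    using H a by (auto simp: field_simps)
  then have "v = (v $ a / u $ a) *\<^sub>R u"
    unfolding vec_eq_iff vector_scaleR_component real_scaleR_def by blast
  then show False using assms unfolding collinear_lemma by blast
qed

text \<open>The \<open>3 \<times> 3\<close> minor of three noncollinear rational points, formed with the column of the
  denominators, is a nonzero integer. It does not change when the numerators are replaced by the
  errors of approximation to a common \<open>A\<close>.\<close>

lemma noncollinear_errors:
  fixes A :: "real ^ 'm" and p1 p2 p3 :: "int ^ 'm" and q1 q2 q3 :: int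
  assumes q: "0 < q1" "0 < q2" "0 < q3"
    and nc: "\<not> collinear {ratpt p1 q1, ratpt p2 q2, ratpt p3 q3}"
  defines "e1 \<equiv> of_int q1 *\<^sub>R A - ivec p1" and "e2 \<equiv> of_int q2 *\<^sub>R A - ivec p2"
    and "e3 \<equiv> of_int q3 *\<^sub>R A - ivec p3"
  shows "1 \<le> 2 * (of_int q1 * (norm e2 * norm e3) + of_int q2 * (norm e1 * norm e3)
    + of_int q3 * (norm e1 * norm e2))"
proof -
  have "\<not> collinear {0, ratpt p1 q1 - ratpt p2 q2, ratpt p3 q3 - ratpt p2 q2}"
    using nc by (subst collinear_3[symmetric]) auto
  then obtain a b where ab: "(ratpt p1 q1 - ratpt p2 q2) $ a * (ratpt p3 q3 - ratpt p2 q2) $ b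
      - (ratpt p1 q1 - ratpt p2 q2) $ b * (ratpt p3 q3 - ratpt p2 q2) $ a \<noteq> 0" (is "?m \<noteq> 0")
    using not_collinear_minor by blast
  define d where "d = q1 * (p2 $ a * p3 $ b - p2 $ b * p3 $ a) - q2 * (p1 $ a * p3 $ b - p1 $ b * p3 $ a)
    + q3 * (p1 $ a * p2 $ b - p1 $ b * p2 $ a)"
  have num: "of_int (r $ i) = of_int k * ratpt r k $ i" if "0 < k" for r :: "int ^ 'm" and k i
    using that by (simp add: ratpt_def)
  have "of_int d = - (of_int q1 * of_int q2 * of_int q3 * ?m)"
    unfolding d_def of_int_add of_int_diff of_int_mult num[OF q(1), where r = p1] num[OF q(2), where r = p2] num[OF q(3), where r = p3]
      vector_minus_component by (simp only: algebra_simps)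
  then have "d \<noteq> 0" using ab q by auto
  then have "1 \<le> \<bar>of_int d :: real\<bar>" by linarith
  \<comment> \<open>Column operations with the denominator column replace numerators by errors; two
    columns change sign, so the determinant does not.\<close>
  also have "of_int d = of_int q1 * (e2 $ a * e3 $ b - e2 $ b * e3 $ a)
      - of_int q2 * (e1 $ a * e3 $ b - e1 $ b * e3 $ a) + of_int q3 * (e1 $ a * e2 $ b - e1 $ b * e2 $ a)"
    unfolding d_def e1_def e2_def e3_def by (simp add: algebra_simps)
  also have "\<bar>\<dots>\<bar> \<le> of_int q1 * \<bar>e2 $ a * e3 $ b - e2 $ b * e3 $ a\<bar>
      + of_int q2 * \<bar>e1 $ a * e3 $ b - e1 $ b * e3 $ a\<bar> + of_int q3 * \<bar>e1 $ a * e2 $ b - e1 $ b * e2 $ a\<bar>"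
  proof -
    have tri: "\<bar>x - y + z\<bar> \<le> \<bar>x\<bar> + \<bar>y\<bar> + \<bar>z\<bar>" for x y z :: real by linarith
    show ?thesis by (rule order.trans[OF tri]) (use q in \<open>simp add: abs_mult\<close>)
  qed
  also have "\<dots> \<le> of_int q1 * (2 * (norm e2 * norm e3)) + of_int q2 * (2 * (norm e1 * norm e3))
      + of_int q3 * (2 * (norm e1 * norm e2))"
  proof -
    have "\<bar>x $ a * y $ b - x $ b * y $ a\<bar> \<le> 2 * (norm x * norm y)" for x y :: "real ^ 'm"
    proof -
      have "\<bar>x $ a * y $ b\<bar> \<le> norm x * norm y" "\<bar>x $ b * y $ a\<bar> \<le> norm x * norm y"
        unfolding abs_mult by (intro mult_mono component_le_norm_cart norm_ge_zero abs_ge_zero)+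
      then show ?thesis by linarith
    qed
    then show ?thesis using q by (intro add_mono mult_left_mono) auto
  qed
  finally show ?thesis by (simp add: algebra_simps)
qed

lemma collinear_insert_line:
  assumes "a \<noteq> b" "a \<in> S" "b \<in> S" "collinear S" "collinear {x, a, b}"
  shows "collinear (insert x S)"
proof -
  have "S = insert a (insert b S)" using assms by auto
  then have "\<forall>y\<in>S. collinear {a, b, y}"
    using assms(4) collinear_triples[OF assms(1), of S] by auto
  moreover have "collinear {a, b, x}" using assms(5) by (simp add: insert_commute)
  ultimately have "collinear (insert a (insert b (insert x S)))"
    by (subst collinear_triples[OF assms(1)]) auto
  moreover have "insert a (insert b (insert x S)) = insert x S" using assms by auto
  ultimately show ?thesis by simp
qed

text \<open>The last change of line before time \<open>n\<close>: the points of indices \<open>c, \<dots>, n\<close> lie on a line,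
  the \<open>c\<close>-th point being the intersection of that line with the previous one, and \<open>j\<close> is the
  first index at which the point moves on. The line is then forced to be long relative to
  the height of that point.\<close>

lemma change_of_line:
  fixes A :: "real ^ 'm" and p :: "nat \<Rightarrow> int ^ 'm" and q :: "nat \<Rightarrow> int"
  assumes w: "0 < w" "w < 1" and n: "J \<le> n"
    and pq: "\<And>j. J \<le> j \<Longrightarrow> 0 < q j \<and> of_int (q j) \<le> (2::real) ^ j \<and>
      norm (of_int (q j) *\<^sub>R A - ivec (p j)) \<le> 2 powr (- (w * real j))"
  defines "P \<equiv> \<lambda>j. ratpt (p j) (q j)"
  obtains (const) "\<forall>j\<in>{J..n}. P j = P J"
  | (change) c j p1 q1 s where "J \<le> c" "c < j" "j \<le> n" "0 < q1" "of_int q1 \<le> (2::real) ^ c"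
      "norm (of_int q1 *\<^sub>R A - ivec p1) \<le> 2 powr (- (w * real (j - 1)))"
      "P n = ratpt p1 q1 + s *\<^sub>R ivec (q1 *s p j - q j *s p1)"
      "c = J \<or> w * real c - 5 \<le> (1 - w) * real j"
      "\<not> collinear (P ` {J..n}) \<Longrightarrow> J < c"
proof -
  \<comment> \<open>The point \<open>P n\<close> alone is a collinear block, so a least starting
    index exists; by minimality, adding \<open>P (c - 1)\<close> destroys collinearity unless
    \<open>c = J\<close>.\<close>
  have "\<exists>c. J \<le> c \<and> c \<le> n \<and> collinear (P ` {c..n})"
    using n by (intro exI[of _ n]) simp
  then obtain c where "J \<le> c \<and> c \<le> n \<and> collinear (P ` {c..n})"
    and least: "\<forall>k<c. \<not> (J \<le> k \<and> k \<le> n \<and> collinear (P ` {k..n}))"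
    using exists_least_iff[of "\<lambda>c. J \<le> c \<and> c \<le> n \<and> collinear (P ` {c..n})"] by meson
  then have c: "J \<le> c" "c \<le> n" "collinear (P ` {c..n})" by auto
  have c_min: "\<not> collinear (P ` {c - 1..n})" if "J < c"
    using least[rule_format, of "c - 1"] that c(2) by auto
  show thesis
  proof (cases "\<forall>i\<in>{c..n}. P i = P c")
    case True
    \<comment> \<open>A constant block could be extended backwards by one more point, since two
      points are always collinear.\<close>
    have "c = J"
    proof (rule ccontr)
      assume "c \<noteq> J"
      then have "J < c" using c by simp
      have "{c - 1..n} = insert (c - 1) {c..n}" using \<open>J < c\<close> c by auto
      have "P i \<in> {P (c - 1), P c}" if "i \<in> {c - 1..n}" for i
        using that unfolding \<open>{c - 1..n} = insert (c - 1) {c..n}\<close> using True by blast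
      then have "P ` {c - 1..n} \<subseteq> {P (c - 1), P c}" by (rule image_subsetI)
      then have "collinear (P ` {c - 1..n})" by (rule collinear_subset[OF collinear_2])
      then show False using c_min[OF \<open>J < c\<close>] by simp
    qed
    then show thesis using True by (intro const) blast
  next
    case False
    then have "\<exists>j. c \<le> j \<and> j \<le> n \<and> P j \<noteq> P c" by auto
    then obtain j where "c \<le> j \<and> j \<le> n \<and> P j \<noteq> P c"
      and least_j: "\<forall>k<j. \<not> (c \<le> k \<and> k \<le> n \<and> P k \<noteq> P c)"
      using exists_least_iff[of "\<lambda>j. c \<le> j \<and> j \<le> n \<and> P j \<noteq> P c"] by meson
    then have j: "c < j" "j \<le> n" "P j \<noteq> P c" by (auto simp: le_less)
    have Pj1: "P (j - 1) = P c"
      using least_j[rule_format, of "j - 1"] j(1,2) by auto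
    \<comment> \<open>\<open>P c\<close> and \<open>P (j - 1)\<close> are the same point, possibly
      with different denominators. The smaller one obeys the height bound of index \<open>c\<close>
      and, the error being denominator times distance, also the error bound of index
      \<open>j - 1\<close>.\<close>
    define q1 where "q1 = (if q c \<le> q (j - 1) then q c else q (j - 1))"
    define p1 where "p1 = (if q c \<le> q (j - 1) then p c else p (j - 1))"
    have Jj: "J \<le> j - 1" "J \<le> j" using c j by auto
    have q1: "0 < q1" "q1 \<le> q c" "q1 \<le> q (j - 1)"
      using pq[OF c(1)] pq[OF Jj(1)] by (auto simp: q1_def)
    have P1: "ratpt p1 q1 = P c" using Pj1 by (auto simp: p1_def q1_def P_def)
    have q1c: "of_int q1 \<le> (2::real) ^ c" using q1(2) pq[OF c(1)] by (meson of_int_le_iff order.trans)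
    have e1: "norm (of_int q1 *\<^sub>R A - ivec p1) \<le> 2 powr (- (w * real (j - 1)))"
    proof -
      have "norm (of_int q1 *\<^sub>R A - ivec p1) = of_int q1 * norm (A - P (j - 1))"
        using norm_diff_ratpt[OF q1(1), of A p1] unfolding P1 Pj1 by simp
      also have "\<dots> \<le> of_int (q (j - 1)) * norm (A - P (j - 1))"
        using q1(3) by (intro mult_right_mono) auto
      also have "\<dots> = norm (of_int (q (j - 1)) *\<^sub>R A - ivec (p (j - 1)))"
        unfolding P_def using pq[OF Jj(1)] by (intro norm_diff_ratpt) simp
      finally show ?thesis using pq[OF Jj(1)] by linarith
    qed
    have "collinear {P j, P c, P n}"
      using c j by (intro collinear_subset[OF c(3)]) auto
    then have "collinear {0, P j - P c, P n - P c}"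
      by (subst collinear_3[symmetric]) auto
    moreover have "P j - P c \<noteq> 0" using j(3) by simp
    ultimately have "P n - P c = 0 \<or> (\<exists>t. P n - P c = t *\<^sub>R (P j - P c))"
      unfolding collinear_lemma by blast
    then have "\<exists>t. P n - P c = t *\<^sub>R (P j - P c)"
      by (elim disjE) (simp_all add: exI[of _ 0])
    then obtain t where t: "P n - P c = t *\<^sub>R (P j - P c)" by blast
    have qj: "0 < q j" using pq[OF Jj(2)] by blast
    have line: "P n = ratpt p1 q1 + (t / (of_int q1 * of_int (q j))) *\<^sub>R ivec (q1 *s p j - q j *s p1)"
    proof -
      have "P j - P c = (1 / (of_int q1 * of_int (q j))) *\<^sub>R ivec (q1 *s p j - q j *s p1)"
        unfolding P1[symmetric] unfolding P_def ratpt_def ivec_diff ivec_scale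
        using q1(1) qj by (simp add: scaleR_diff_right)
      moreover have "P n = P c + t *\<^sub>R (P j - P c)" by (simp add: t[symmetric])
      ultimately show ?thesis unfolding P1 by simp
    qed
    have long: "w * real c - 5 \<le> (1 - w) * real j" if "J < c"
    proof -
      have Jc1: "J \<le> c - 1" using that by simp
      have nc: "\<not> collinear {P (c - 1), P c, P j}"
      proof
        assume col: "collinear {P (c - 1), P c, P j}"
        have "collinear (insert (P (c - 1)) (P ` {c..n}))"
          by (rule collinear_insert_line[OF j(3)[symmetric] _ _ c(3) col]) (use c(2) j(1,2) in simp_all)
        moreover have "insert (P (c - 1)) (P ` {c..n}) = P ` {c - 1..n}"
        proof -
          have "{c - 1..n} = insert (c - 1) {c..n}" using that c by auto
          then show ?thesis by simp
        qed
        ultimately show False using c_min[OF that] by simp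
      qed
      \<comment> \<open>The exponent of the dominant product, denominator \<open>q j\<close> times
        the errors of the other two points; the other two products are no larger.\<close>
      define x where "x = real j - w * (real c - 1) - w * (real j - 1)"
      let ?e1 = "norm (of_int (q (c - 1)) *\<^sub>R A - ivec (p (c - 1)))"
      let ?e2 = "norm (of_int q1 *\<^sub>R A - ivec p1)"
      let ?e3 = "norm (of_int (q j) *\<^sub>R A - ivec (p j))"
      have b1: "of_int (q (c - 1)) \<le> 2 powr (real c - 1)" "?e1 \<le> 2 powr (- (w * (real c - 1)))"
        using pq[OF Jc1] that powr_realpow[of 2 "c - 1"] by (auto simp: of_nat_diff)
      have b2: "of_int q1 \<le> 2 powr real c" "?e2 \<le> 2 powr (- (w * (real j - 1)))"
        using q1c e1 j by (auto simp: powr_realpow of_nat_diff)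
      have b3: "of_int (q j) \<le> 2 powr real j" "?e3 \<le> 2 powr (- (w * real j))"
        using pq[OF Jj(2)] by (auto simp: powr_realpow)
      have prod: "a * (b * d) \<le> 2 powr x"
        if "a \<le> 2 powr a'" "b \<le> 2 powr b'" "d \<le> 2 powr d'" "0 \<le> a" "0 \<le> b" "0 \<le> d"
           "a' + (b' + d') \<le> x" for a b d a' b' d' :: real
      proof -
        have "a * (b * d) \<le> 2 powr a' * (2 powr b' * 2 powr d')"
          using that by (intro mult_mono mult_nonneg_nonneg) auto
        also have "\<dots> = 2 powr (a' + (b' + d'))" by (simp add: powr_add)
        also have "\<dots> \<le> 2 powr x" using that by simp
        finally show ?thesis .
      qed
      have three: "1 \<le> 2 * (y + y + y)" if "1 \<le> 2 * (a + b + d)" "a \<le> y" "b \<le> y" "d \<le> y"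
        for a b d y :: real using that by simp
      have cj: "w * real c \<le> w * real j" "real c \<le> real j" "1 \<le> real c" using w j that by auto
      have qs: "(0::real) \<le> of_int (q (c - 1))" "(0::real) \<le> of_int q1" "(0::real) \<le> of_int (q j)"
        using pq[OF Jc1] q1 pq[OF Jj(2)] by auto
      have x1: "(real c - 1) + (- (w * (real j - 1)) + - (w * real j)) \<le> x"
        and x2: "real c + (- (w * (real c - 1)) + - (w * real j)) \<le> x"
        and x3: "real j + (- (w * (real c - 1)) + - (w * (real j - 1))) \<le> x"
        using cj w unfolding x_def right_diff_distrib by linarith+
      have "1 \<le> 2 * (of_int (q (c - 1)) * (?e2 * ?e3) + of_int q1 * (?e1 * ?e3) + of_int (q j) * (?e1 * ?e2))"
      proof (rule noncollinear_errors)
        show "\<not> collinear {ratpt (p (c - 1)) (q (c - 1)), ratpt p1 q1, ratpt (p j) (q j)}"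
          using nc unfolding P1 unfolding P_def .
      qed (use pq[OF Jc1] pq[OF Jj(2)] q1(1) in blast)+
      moreover have "of_int (q (c - 1)) * (?e2 * ?e3) \<le> 2 powr x"
        by (rule prod[OF b1(1) b2(2) b3(2)])
          (use qs x1 in simp_all)
      moreover have "of_int q1 * (?e1 * ?e3) \<le> 2 powr x"
        by (rule prod[OF b2(1) b1(2) b3(2)])
          (use qs x2 in simp_all)
      moreover have "of_int (q j) * (?e1 * ?e2) \<le> 2 powr x"
        by (rule prod[OF b3(1) b1(2) b2(2)])
          (use qs x3 in simp_all)
      ultimately have "1 \<le> 2 * (2 powr x + 2 powr x + 2 powr x)" by (rule three)
      also have "\<dots> \<le> 2 powr 3 * 2 powr x" by simp
      also have "\<dots> = 2 powr (3 + x)" by (rule powr_add[symmetric])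
      finally have "1 \<le> 2 powr (3 + x)" .
      \<comment> \<open>The factor 6 is at most \<open>2 powr 3\<close>; together with the two index
        shifts by 1 this gives the constant \<open>3 + 2 * w\<close>, which is at most 5.\<close>
      have "0 \<le> 3 + x"
      proof (rule ccontr)
        assume "\<not> 0 \<le> 3 + x"
        then have "2 powr (3 + x) < 2 powr 0" by (intro powr_less_mono) auto
        then show False using \<open>1 \<le> 2 powr (3 + x)\<close> by simp
      qed
      then show ?thesis using w unfolding x_def by (simp add: algebra_simps)
    qed
    show thesis
    proof (rule change[of c j q1 p1 "t / (of_int q1 * of_int (q j))"])
      show "c = J \<or> w * real c - 5 \<le> (1 - w) * real j" using long c(1) by (cases "c = J") auto
      show "J < c" if "\<not> collinear (P ` {J..n})"
      proof (rule ccontr)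
        assume "\<not> J < c"
        then have "c = J" using c(1) by simp
        then show False using that c(3) by simp
      qed
    qed (fact c j q1 q1c e1 line)+
  qed
qed

section \<open>Coverings of sets of approximable points\<close>

lemma card_int_abs_le:
  assumes "0 \<le> B"
  shows "finite {k :: int. \<bar>real_of_int k\<bar> \<le> B}" "real (card {k :: int. \<bar>real_of_int k\<bar> \<le> B}) \<le> 2 * B + 1"
proof -
  have eq: "{k :: int. \<bar>real_of_int k\<bar> \<le> B} = {- \<lfloor>B\<rfloor>..\<lfloor>B\<rfloor>}"
    by (auto simp: abs_le_iff le_floor_iff) linarith+
  show "finite {k :: int. \<bar>real_of_int k\<bar> \<le> B}" unfolding eq by simp
  have "0 \<le> \<lfloor>B\<rfloor>" using assms by simp
  then have "real (card {- \<lfloor>B\<rfloor>..\<lfloor>B\<rfloor>}) = 2 * of_int \<lfloor>B\<rfloor> + 1" by simp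
  also have "\<dots> \<le> 2 * B + 1" by simp
  finally show "real (card {k :: int. \<bar>real_of_int k\<bar> \<le> B}) \<le> 2 * B + 1" unfolding eq .
qed

lemma card_int_vec_abs_le:
  assumes "0 \<le> B"
  defines "S \<equiv> {p :: int ^ 'm. \<forall>i. \<bar>real_of_int (p $ i)\<bar> \<le> B}"
  shows "finite S" "real (card S) \<le> (2 * B + 1) ^ CARD('m)"
proof -
  let ?I = "{k :: int. \<bar>real_of_int k\<bar> \<le> B}"
  note I = card_int_abs_le[OF assms(1)]
  have sub: "S \<subseteq> (\<lambda>f. \<chi> i. f i) ` (PiE UNIV (\<lambda>_. ?I))"
  proof
    fix p assume "p \<in> S"
    then have "(\<lambda>i. p $ i) \<in> PiE UNIV (\<lambda>_. ?I)" by (auto simp: S_def)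
    then show "p \<in> (\<lambda>f. \<chi> i. f i) ` (PiE UNIV (\<lambda>_. ?I))"
      by (intro image_eqI[where x = "\<lambda>i. p $ i"]) simp_all
  qed
  have fin: "finite (PiE (UNIV :: 'm set) (\<lambda>_. ?I))" using I(1) by (intro finite_PiE) auto
  then show "finite S" using sub by (meson finite_imageI finite_subset)
  have "card S \<le> card (PiE (UNIV :: 'm set) (\<lambda>_. ?I))"
    using sub fin by (meson card_image_le card_mono finite_imageI order.trans)
  also have "\<dots> = card ?I ^ CARD('m)" by (simp add: card_PiE)
  finally have "real (card S) \<le> real (card ?I) ^ CARD('m)" by (metis of_nat_le_iff of_nat_power)
  also have "\<dots> \<le> (2 * B + 1) ^ CARD('m)" using I(2) by (intro power_mono) auto
  finally show "real (card S) \<le> (2 * B + 1) ^ CARD('m)" .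
qed

text \<open>The numerator bound is what \<open>norm A \<le> M\<close> and an error of at most 1
  force. Negative and zero denominators are let in because only an upper bound on the cardinality
  matters.\<close>

definition ratpts :: "real \<Rightarrow> real \<Rightarrow> (real ^ 'm) set" where
  "ratpts M B = (\<lambda>(p, q). ratpt p q) `
    ({p. \<forall>i. \<bar>real_of_int (p $ i)\<bar> \<le> (M + 1) * B} \<times> {q. \<bar>real_of_int q\<bar> \<le> B})"

lemma card_ratpts:
  assumes "0 \<le> M" "1 \<le> B"
  shows "finite (ratpts M B :: (real ^ 'm) set)"
    "real (card (ratpts M B :: (real ^ 'm) set)) \<le> 3 * (2 * M + 3) ^ CARD('m) * B ^ (CARD('m) + 1)"
proof -
  let ?S = "{p :: int ^ 'm. \<forall>i. \<bar>real_of_int (p $ i)\<bar> \<le> (M + 1) * B}"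
  let ?I = "{q :: int. \<bar>real_of_int q\<bar> \<le> B}"
  have "0 \<le> (M + 1) * B" using assms by simp
  note S = card_int_vec_abs_le[OF this, where 'm = 'm]
  have "0 \<le> B" using assms by simp
  note I = card_int_abs_le[OF this]
  show "finite (ratpts M B :: (real ^ 'm) set)" unfolding ratpts_def using S(1) I(1) by blast
  have "card (ratpts M B :: (real ^ 'm) set) \<le> card (?S \<times> ?I)"
    unfolding ratpts_def using S(1) I(1) by (intro card_image_le finite_cartesian_product)
  then have "real (card (ratpts M B :: (real ^ 'm) set)) \<le> real (card ?S) * real (card ?I)"
    by (simp add: card_cartesian_product flip: of_nat_mult)
  also have "\<dots> \<le> (2 * ((M + 1) * B) + 1) ^ CARD('m) * (2 * B + 1)"
    using S(2) I(2) assms by (intro mult_mono) auto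
  also have "\<dots> \<le> ((2 * M + 3) * B) ^ CARD('m) * (3 * B)"
  proof (intro mult_mono power_mono)
    show "2 * ((M + 1) * B) + 1 \<le> (2 * M + 3) * B" using assms by (simp add: algebra_simps)
  qed (use assms in auto)
  also have "\<dots> = 3 * (2 * M + 3) ^ CARD('m) * B ^ (CARD('m) + 1)"
    by (simp add: power_mult_distrib)
  finally show "real (card (ratpts M B :: (real ^ 'm) set)) \<le> \<dots>" .
qed

lemma ratpt_in_ratpts:
  assumes "0 < q" "of_int q \<le> B" "norm A \<le> M" "norm (of_int q *\<^sub>R A - ivec p) \<le> 1"
  shows "ratpt p q \<in> ratpts M B"
proof -
  have q1: "1 \<le> real_of_int q" using assms(1) by simp
  have "\<bar>real_of_int (p $ i)\<bar> \<le> (M + 1) * B" for i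
  proof -
    have "\<bar>(of_int q *\<^sub>R A - ivec p) $ i\<bar> \<le> 1"
      using component_le_norm_cart[of "of_int q *\<^sub>R A - ivec p" i] assms(4) by linarith
    then have "\<bar>real_of_int (p $ i)\<bar> \<le> \<bar>of_int q * A $ i\<bar> + 1" by simp
    also have "\<bar>of_int q * A $ i\<bar> \<le> of_int q * M"
      using component_le_norm_cart[of A i] assms(1,3) by (simp add: abs_mult)
    also have "of_int q * M + 1 \<le> of_int q * M + of_int q" using q1 by simp
    also have "\<dots> = (M + 1) * of_int q" by (simp add: algebra_simps)
    also have "\<dots> \<le> (M + 1) * B"
      using assms(2,3) norm_ge_zero[of A] by (intro mult_left_mono) linarith+
    finally show ?thesis by simp
  qed
  then show ?thesis
    unfolding ratpts_def using assms(1,2) by (intro image_eqI[of _ _ "(p, q)"]) auto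
qed

lemma two_powr_neg_le_1: "0 \<le> x \<Longrightarrow> 2 powr (- x) \<le> (1 :: real)"
  using powr_mono[of "- x" 0 2] by simp

lemma two_powr_neg_tendsto_0:
  assumes "0 < (a::real)"
  shows "(\<lambda>n. 2 powr (- (a * real n))) \<longlonglongrightarrow> 0"
proof -
  have "(\<lambda>n. (2 powr (- a)) ^ n) \<longlonglongrightarrow> 0"
    using assms powr_less_mono[of "- a" 0 2] by (intro LIMSEQ_realpow_zero) auto
  then show ?thesis by (simp only: two_powr_power mult_minus_left)
qed

text \<open>If all later points lay on one line, that line would be rational and closed, hence would
  contain the limit \<open>A\<close>, whose exponent would then be at least 1.\<close>

lemma noncollinear_tail:
  fixes A :: "real ^ 'm" and p :: "nat \<Rightarrow> int ^ 'm" and q :: "nat \<Rightarrow> int"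
  assumes N: "is_norm N" and N1: "is_norm N1" and A: "uniform_exponent N N1 A < 1" and w: "0 < w"
    and pq: "\<And>j. J \<le> j \<Longrightarrow> 0 < q j \<and> of_int (q j) \<le> (2::real) ^ j \<and>
      norm (of_int (q j) *\<^sub>R A - ivec (p j)) \<le> 2 powr (- (w * real j))"
  defines "P \<equiv> \<lambda>j. ratpt (p j) (q j)"
  shows "\<exists>n\<ge>J. \<not> collinear (P ` {J..n})"
proof (rule ccontr)
  assume "\<not> (\<exists>n\<ge>J. \<not> collinear (P ` {J..n}))"
  then have col: "collinear (P ` {J..n})" if "J \<le> n" for n using that by blast
  \<comment> \<open>The value 0 stands for a constant sequence, where the limit is itself a rational
    point; otherwise the direction is a difference of two rational points.\<close>
  have "\<exists>v. (v = 0 \<or> (\<exists>i\<ge>J. v = P i - P J)) \<and> (\<forall>k\<ge>J. P k - P J \<in> span {v})"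
  proof (cases "\<exists>i\<ge>J. P i \<noteq> P J")
    case False
    have "P k - P J \<in> span {0}" if "J \<le> k" for k
    proof -
      have "P k = P J" using False that by blast
      then show ?thesis by (simp only: diff_self span_zero)
    qed
    then show ?thesis by blast
  next
    case True
    then obtain i where i: "J \<le> i" "P i \<noteq> P J" by blast
    have "P k - P J \<in> span {P i - P J}" if k: "J \<le> k" for k
    proof -
      have "collinear {P i, P J, P k}"
        using i k by (intro collinear_subset[OF col[of "max i k"]]) auto
      then have "collinear {0, P i - P J, P k - P J}"
        by (subst collinear_3[symmetric]) auto
      moreover have "P i - P J \<noteq> 0" using i(2) by simp
      ultimately have "P k - P J = 0 \<or> (\<exists>t. P k - P J = t *\<^sub>R (P i - P J))"
        unfolding collinear_lemma by blast
      then show ?thesis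
        by (elim disjE exE) (simp_all only: span_zero span_scale span_base[OF singletonI])
    qed
    then show ?thesis using i(1) by blast
  qed
  then obtain v where v: "v = 0 \<or> (\<exists>i\<ge>J. v = P i - P J)" "\<And>k. k \<ge> J \<Longrightarrow> P k - P J \<in> span {v}"
    by blast
  have "P \<longlonglongrightarrow> A"
  proof (rule LIM_zero_cancel, rule Lim_null_comparison)
    show "\<forall>\<^sub>F k in sequentially. norm (P k - A) \<le> 2 powr (- (w * real k))"
      using eventually_ge_at_top[of J]
    proof eventually_elim
      case (elim k)
      then show ?case
        using norm_diff_ratpt_le[of "q k" A "p k"] pq[of k]
        unfolding P_def norm_minus_commute[of _ A] by linarith
    qed
    show "(\<lambda>k. 2 powr (- (w * real k))) \<longlonglongrightarrow> 0" by (rule two_powr_neg_tendsto_0[OF w])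
  qed
  then have "(\<lambda>k. P k - P J) \<longlonglongrightarrow> A - P J" by (intro tendsto_diff tendsto_const)
  moreover have "\<forall>\<^sub>F k in sequentially. P k - P J \<in> span {v}"
    using eventually_ge_at_top[of J] by eventually_elim (rule v(2))
  ultimately have "A - P J \<in> span {v}"
    by (intro Lim_in_closed_set[OF closed_subspace[OF subspace_span]]) auto
  then obtain s where "A - P J = s *\<^sub>R v" unfolding span_singleton by blast
  then have s: "A = P J + s *\<^sub>R v" by (simp only: diff_eq_eq add.commute)
  have qJ: "0 < q J" using pq[of J] by blast
  have PJ: "of_int (q J) *\<^sub>R P J = ivec (p J)" using qJ by (simp add: P_def ratpt_def)
  from v(1) have "1 \<le> uniform_exponent N N1 A"
  proof (elim disjE exE conjE)
    assume "v = 0"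
    then have "of_int (q J) *\<^sub>R A = ivec (p J) + 0 *\<^sub>R ivec (p J)" using s PJ by simp
    then show ?thesis by (rule exponent_ge_1_rational_line[OF N N1 qJ])
  next
    fix i assume i: "J \<le> i" "v = P i - P J"
    have qi: "0 < q i" using pq[of i] i by blast
    have Pi: "of_int (q i) *\<^sub>R P i = ivec (p i)" using qi by (simp add: P_def ratpt_def)
    have "of_int (q J * q i) *\<^sub>R A = of_int (q i) *\<^sub>R (of_int (q J) *\<^sub>R P J)
        + s *\<^sub>R (of_int (q J) *\<^sub>R (of_int (q i) *\<^sub>R P i) - of_int (q i) *\<^sub>R (of_int (q J) *\<^sub>R P J))"
      unfolding s i(2) by (simp add: algebra_simps)
    also have "\<dots> = ivec (q i *s p J) + s *\<^sub>R ivec (q J *s p i - q i *s p J)"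
      unfolding PJ Pi ivec_scale ivec_diff ..
    finally show ?thesis
      by (rule exponent_ge_1_rational_line[OF N N1 mult_pos_pos[OF qJ qi]])
  qed
  then show False using A by simp
qed

lemma approximableE:
  assumes "A \<in> approximable w J"
  obtains p q where "\<And>j. J \<le> j \<Longrightarrow> 0 < q j \<and> of_int (q j) \<le> (2::real) ^ j \<and>
      norm (of_int (q j) *\<^sub>R A - ivec (p j)) \<le> 2 powr (- (w * real j))"
proof -
  have "\<forall>j. \<exists>z. J \<le> j \<longrightarrow> 0 < snd z \<and> of_int (snd z) \<le> (2::real) ^ j \<and>
      norm (of_int (snd z) *\<^sub>R A - ivec (fst z)) \<le> 2 powr (- (w * real j))"
    using assms unfolding approximable_def by auto
  from choice[OF this] obtain f where f: "\<forall>j. J \<le> j \<longrightarrow> 0 < snd (f j) \<and> of_int (snd (f j)) \<le> (2::real) ^ j \<and>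
      norm (of_int (snd (f j)) *\<^sub>R A - ivec (fst (f j))) \<le> 2 powr (- (w * real j))" by blast
  show thesis
    by (rule that[of "\<lambda>j. snd (f j)" "\<lambda>j. fst (f j)"]) (use f in blast)
qed

text \<open>Up to a constant there are at most 2^(c (m + 1)) candidate centres with denominators
  bounded by 2^c. The exponent is chosen so that \<open>r c powr s\<close> decays like 2^(-2 c (m +
  1)), which leaves a convergent series.\<close>

lemma hausdorff_measure_approximable:
  fixes N :: "real ^ 'm \<Rightarrow> real"
  assumes N: "is_norm N" and N1: "is_norm N1" and w: "1/2 \<le> w" "w < 1" and M: "0 \<le> M"
  shows "hausdorff_measure (8 * (1 - w) * real (CARD('m) + 1))
    {A \<in> approximable w J. norm A \<le> M \<and> uniform_exponent N N1 A < 1} = 0" (is "hausdorff_measure ?s ?S = 0")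
proof -
  define \<eta> where "\<eta> = 1 - w"
  have \<eta>: "0 < \<eta>" using w by (simp add: \<eta>_def)
  \<comment> \<open>From \<open>w * c - 5 \<le> \<eta> * j\<close> and \<open>w \<ge> 1/2\<close>
    follows \<open>w * j \<ge> (c / 4 - 5) / \<eta>\<close>; passing from \<open>j\<close> to
    \<open>j - 1\<close> costs at most 1 in the exponent.\<close>
  define r where "r c = 2 powr (1 + 5 / \<eta> - real c / (4 * \<eta>))" for c
  define X where "X c = (ratpts M (2 ^ c) :: (real ^ 'm) set)" for c :: nat
  let ?m = "CARD('m)"
  have r_eq: "r c = 2 powr (1 + 5 / \<eta>) * 2 powr (- (1 / (4 * \<eta>) * real c))" for c
    unfolding r_def by (simp flip: powr_add)
  show ?thesis
  proof (rule hausdorff_measure_limsup_eq_0[where X = X and r = r])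
    fix A :: "real ^ 'm" and c0 :: nat
    assume "A \<in> ?S"
    then have A: "A \<in> approximable w J" "norm A \<le> M" "uniform_exponent N N1 A < 1" by auto
    obtain p q where pq: "\<And>j. J \<le> j \<Longrightarrow> 0 < q j \<and> of_int (q j) \<le> (2::real) ^ j \<and>
        norm (of_int (q j) *\<^sub>R A - ivec (p j)) \<le> 2 powr (- (w * real j))"
      using approximableE[OF A(1)] by blast
    \<comment> \<open>Starting at \<open>J'\<close> forces \<open>c \<ge> c0\<close>. With
      \<open>n\<close> large enough for noncollinearity, the constant case and the case
      \<open>c = J'\<close> are both excluded, so every \<open>c0\<close> yields a genuine change of
      line.\<close>
    define J' where "J' = max J c0"
    have pq': "0 < q j \<and> of_int (q j) \<le> (2::real) ^ j \<and>
        norm (of_int (q j) *\<^sub>R A - ivec (p j)) \<le> 2 powr (- (w * real j))" if "J' \<le> j" for j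
      using pq[of j] that by (simp add: J'_def)
    have w0: "0 < w" using w by simp
    obtain n where n: "J' \<le> n" "\<not> collinear ((\<lambda>j. ratpt (p j) (q j)) ` {J'..n})"
      using noncollinear_tail[OF N N1 A(3) w0 pq'] by blast
    show "\<exists>c\<ge>c0. \<exists>y\<in>X c. dist A y \<le> r c"
    proof (rule change_of_line[OF w0 w(2) n(1) pq'])
      assume const: "\<forall>j\<in>{J'..n}. ratpt (p j) (q j) = ratpt (p J') (q J')"
      have "(\<lambda>j. ratpt (p j) (q j)) ` {J'..n} \<subseteq> {ratpt (p J') (q J')}"
        using bspec[OF const] by (intro image_subsetI singleton_iff[THEN iffD2])
      then have "collinear ((\<lambda>j. ratpt (p j) (q j)) ` {J'..n})"
        by (rule collinear_subset[OF collinear_sing])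
      with n(2) show ?thesis by simp
    next
      fix c j q1 p1 s
      assume c: "J' \<le> c" "c < j" "j \<le> n" "0 < q1" "of_int q1 \<le> (2::real) ^ c"
        "norm (of_int q1 *\<^sub>R A - ivec p1) \<le> 2 powr (- (w * real (j - 1)))"
        "c = J' \<or> w * real c - 5 \<le> (1 - w) * real j"
        "\<not> collinear ((\<lambda>j. ratpt (p j) (q j)) ` {J'..n}) \<Longrightarrow> J' < c"
      have "J' < c" using c(8) n(2) by blast
      then have wc: "w * real c - 5 \<le> \<eta> * real j" using c(7) by (auto simp: \<eta>_def)
      have "norm (of_int q1 *\<^sub>R A - ivec p1) \<le> 1"
        using c(6) two_powr_neg_le_1[of "w * real (j - 1)"] w0 by simp
      then have "ratpt p1 q1 \<in> X c"
        unfolding X_def using c(4,5) A(2) by (intro ratpt_in_ratpts) auto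
      moreover have "dist A (ratpt p1 q1) \<le> r c"
      proof -
        have "dist A (ratpt p1 q1) \<le> 2 powr (- (w * real (j - 1)))"
          using norm_diff_ratpt_le[OF c(4), of A p1] c(6) by (simp add: dist_norm)
        also have "\<dots> \<le> r c"
          unfolding r_def
        proof (rule powr_mono)
          have "1/4 * real c - 5 \<le> w * w * real c - w * 5"
          proof -
            have "1/2 * (1/2) \<le> w * w" using w by (intro mult_mono) auto
            then have "1/4 * real c \<le> w * w * real c" by (intro mult_right_mono) auto
            then show ?thesis using w by linarith
          qed
          also have "\<dots> = w * (w * real c - 5)" by (simp add: algebra_simps)
          also have "\<dots> \<le> w * (\<eta> * real j)" using wc w0 by (intro mult_left_mono) auto
          finally have "(1/4 * real c - 5) / \<eta> \<le> w * real j" using \<eta> by (simp add: field_simps)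
          moreover have "(1/4 * real c - 5) / \<eta> = real c / (4 * \<eta>) - 5 / \<eta>"
            by (simp add: diff_divide_distrib)
          moreover have "w * real (j - 1) = w * real j - w"
            using c(2) by (simp add: of_nat_diff algebra_simps)
          ultimately show "- (w * real (j - 1)) \<le> 1 + 5 / \<eta> - real c / (4 * \<eta>)"
            using w by linarith
        qed simp
        finally show ?thesis .
      qed
      moreover have "c0 \<le> c" using c(1) by (simp add: J'_def)
      ultimately show ?thesis by blast
    qed
  next
    show "finite (X c)" for c unfolding X_def using M by (intro card_ratpts) auto
    show "0 \<le> r c" for c by (simp add: r_def)
    have "(\<lambda>c. 2 powr (1 + 5 / \<eta>) * 2 powr (- (1 / (4 * \<eta>) * real c))) \<longlonglongrightarrow> 2 powr (1 + 5 / \<eta>) * 0"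
      using \<eta> by (intro tendsto_mult_left two_powr_neg_tendsto_0) simp
    then show "r \<longlonglongrightarrow> 0" unfolding r_eq[abs_def] by simp
    show "0 < ?s" using w by simp
    define K where "K = 3 * (2 * M + 3) ^ ?m * 2 powr ((1 + 5 / \<eta>) * ?s)"
    show "summable (\<lambda>c. real (card (X c)) * r c powr ?s)"
    proof (rule summable_comparison_test')
      show "summable (\<lambda>c. K * (2 powr (- real (?m + 1))) ^ c)"
        using powr_less_mono[of "- real (?m + 1)" 0 2]
        by (intro summable_mult summable_geometric) simp
      fix c :: nat
      have rs: "r c powr ?s = 2 powr ((1 + 5 / \<eta>) * ?s) * 2 powr (- (2 * real c * real (?m + 1)))"
      proof -
        have e: "(1 + 5 / \<eta> - real c / (4 * \<eta>)) * ?s = (1 + 5 / \<eta>) * ?s + - (2 * real c * real (?m + 1))"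
          using \<eta> unfolding \<eta>_def[symmetric] by (simp add: field_simps)
        show ?thesis by (simp only: r_def powr_powr e powr_add)
      qed
      have pc: "((2::real) ^ c) ^ (?m + 1) = 2 powr (real c * real (?m + 1))"
        by (simp only: power_mult[symmetric] of_nat_mult[symmetric] powr_realpow)
      have "real (card (X c)) * r c powr ?s
          \<le> (3 * (2 * M + 3) ^ ?m * (2 ^ c) ^ (?m + 1)) * r c powr ?s"
        unfolding X_def using M by (intro mult_right_mono card_ratpts) auto
      also have "\<dots> = K * (2 powr (real c * real (?m + 1)) * 2 powr (- (2 * real c * real (?m + 1))))"
        unfolding rs pc K_def by (simp only: mult_ac)
      also have "\<dots> = K * (2 powr (- real (?m + 1))) ^ c"
        unfolding two_powr_power powr_add[symmetric] by (simp add: algebra_simps)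
      finally have "real (card (X c)) * r c powr ?s \<le> K * (2 powr (- real (?m + 1))) ^ c" .
      moreover have "0 \<le> real (card (X c)) * r c powr ?s" by (intro mult_nonneg_nonneg) simp_all
      ultimately show "norm (real (card (X c)) * r c powr ?s) \<le> K * (2 powr (- real (?m + 1))) ^ c"
        unfolding real_norm_def by (simp only: abs_of_nonneg)
    qed
  qed
qed

text \<open>A net of spacing \<open>d\<close> along a line, with \<open>sgn v\<close> as direction:
  it is a unit vector, or 0 for \<open>v = 0\<close>, where \<open>z = x\<close> and the claim
  remains true.\<close>

lemma sgn_segment_point:
  fixes x z v :: "'a::real_normed_vector"
  assumes z: "z = x + s *\<^sub>R v" and d: "0 < d" and l: "norm (z - x) \<le> l"
  shows "\<exists>k :: int. \<bar>of_int k\<bar> \<le> l / d + 1 \<and> dist z (x + (of_int k * d) *\<^sub>R sgn v) \<le> d"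
proof -
  define t where "t = s * norm v"
  have zt: "z = x + t *\<^sub>R sgn v"
    using z by (cases "v = 0") (simp_all add: t_def sgn_div_norm)
  have tl: "\<bar>t\<bar> \<le> l" using l z by (simp add: t_def abs_mult)
  define k where "k = \<lfloor>t / d\<rfloor>"
  have k: "of_int k \<le> t / d" "t / d < of_int k + 1" unfolding k_def by linarith+
  have "\<bar>t / d\<bar> \<le> l / d" using tl d by (simp add: divide_right_mono)
  then have "\<bar>of_int k\<bar> \<le> l / d + 1" using k by linarith
  moreover have "dist z (x + (of_int k * d) *\<^sub>R sgn v) = \<bar>t - of_int k * d\<bar> * norm (sgn v)"
  proof -
    have "z - (x + (of_int k * d) *\<^sub>R sgn v) = (t - of_int k * d) *\<^sub>R sgn v"
      unfolding zt by (simp add: algebra_simps)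
    then show ?thesis unfolding dist_norm by simp
  qed
  moreover have "\<bar>t - of_int k * d\<bar> * norm (sgn v) \<le> d * 1"
  proof (intro mult_mono)
    have "of_int k * d \<le> t" "t < of_int k * d + d" using k d by (simp_all add: field_simps)
    then show "\<bar>t - of_int k * d\<bar> \<le> d" by linarith
    show "norm (sgn v) \<le> 1" by (simp add: norm_sgn)
  qed (use d in auto)
  ultimately show ?thesis by (intro exI[of _ k]) simp
qed

text \<open>The total length of the segments on the rational lines that come into play at scale
  \<open>\<rho>\<close> is bounded independently of \<open>\<rho>\<close>.\<close>

lemma approximable_covering:
  fixes w M :: real and J :: nat
  assumes w: "w < 1" "(1 - w) * (3 * real CARD('m) + 3) \<le> 1/2" and M: "0 \<le> M"
  shows "\<exists>C\<ge>0. \<forall>\<rho>. 0 < \<rho> \<and> \<rho> \<le> 1 \<longrightarrow> (\<exists>X. finite X \<and> real (card X) \<le> C * \<rho> powr (- 1) \<and>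
    (\<forall>A \<in> {A \<in> approximable w J :: (real ^ 'm) set. norm A \<le> M}. \<exists>y\<in>X. dist A y \<le> \<rho>))"
proof -
  let ?m = "CARD('m)"
  define \<eta> where "\<eta> = 1 - w"
  have \<eta>: "0 < \<eta>" "\<eta> * (3 * real ?m + 3) \<le> 1/2" using w by (auto simp: \<eta>_def)
  have "\<eta> * 1 \<le> \<eta> * (3 * real ?m + 3)" using \<eta>(1) by (intro mult_left_mono) auto
  then have w2: "1/2 \<le> w" "0 < w" using \<eta>(2) by (auto simp: \<eta>_def)
  \<comment> \<open>Bounds for a segment whose point moves on at index \<open>j\<close>:
    \<open>b j\<close> for the denominator of its initial point, since \<open>c\<close> is at most
    \<open>J + 10 + 2 * \<eta> * j\<close>; \<open>V j\<close> for the entries of its integer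
    direction; \<open>l j\<close> for its length.\<close>
  define b :: "nat \<Rightarrow> real" where "b j = 2 powr (real J + 10 + 2 * \<eta> * real j)" for j
  define V :: "nat \<Rightarrow> real" where "V j = 4 * 2 powr (\<eta> * real j)" for j
  define l :: "nat \<Rightarrow> real" where "l j = 2 * 2 powr (- (w * (real j - 1)))" for j
  define Vs where "Vs j = {v :: int ^ 'm. \<forall>i. \<bar>real_of_int (v $ i)\<bar> \<le> V j}" for j
  define Ks where "Ks j \<rho> = {k :: int. \<bar>real_of_int k\<bar> \<le> l j / (\<rho>/2) + 1}" for j \<rho>
  define X where "X j \<rho> = (\<lambda>(x, v, k). x + (of_int k * (\<rho>/2)) *\<^sub>R sgn (ivec v)) ` (ratpts M (b j) \<times> Vs j \<times> Ks j \<rho>)"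
    for j \<rho>
  define K where "K = 189 * (2 * M + 3) ^ ?m * 9 ^ ?m * 2 powr ((real J + 10) * real (?m + 1) + 2)"
  have K0: "0 \<le> K" using M by (simp add: K_def)
  define g :: real where "g = 2 powr (- (1/2))"
  have g: "0 < g" "g < 1" unfolding g_def using powr_less_mono[of "- (1/2)" 0 "2::real"] by auto
  define C0 where "C0 = 3 * (2 * M + 3) ^ ?m * ((2::real) ^ J) ^ (?m + 1)"
  have C00: "0 \<le> C0" using M by (simp add: C0_def)
  have b1: "1 \<le> b j" for j
    unfolding b_def using \<eta>(1) by (intro ge_one_powr_ge_zero) auto
  have V0: "0 \<le> V j" and l0: "0 \<le> l j" for j by (simp_all add: V_def l_def)
  have Kb: "0 \<le> l j / (\<rho>/2) + 1" if "0 < \<rho>" for j \<rho>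
    using l0[of j] that by simp
  have X_card: "finite (X j \<rho>) \<and> real (card (X j \<rho>)) \<le> K / \<rho> * g ^ j" if \<rho>: "0 < \<rho>" "\<rho> < l j" for j \<rho>
  proof
    note R = card_ratpts[OF M b1[of j], where 'm = 'm]
    note Vc = card_int_vec_abs_le[OF V0[of j], where 'm = 'm, folded Vs_def]
    note Kc = card_int_abs_le[OF Kb[OF \<rho>(1), of j], folded Ks_def]
    have fin: "finite (ratpts M (b j) \<times> Vs j \<times> Ks j \<rho> :: ((real ^ 'm) \<times> (int ^ 'm) \<times> int) set)"
      using R(1) Vc(1) Kc(1) by (intro finite_cartesian_product)
    then show "finite (X j \<rho>)" unfolding X_def by (rule finite_imageI)
    have "card (X j \<rho>) \<le> card (ratpts M (b j) \<times> Vs j \<times> Ks j \<rho> :: ((real ^ 'm) \<times> (int ^ 'm) \<times> int) set)"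
      unfolding X_def using fin by (rule card_image_le)
    then have "card (X j \<rho>) \<le> card (ratpts M (b j) :: (real ^ 'm) set) * (card (Vs j) * card (Ks j \<rho>))"
      by (simp only: card_cartesian_product)
    then have "real (card (X j \<rho>)) \<le> real (card (ratpts M (b j) :: (real ^ 'm) set)) * (real (card (Vs j)) * real (card (Ks j \<rho>)))"
      by (simp only: of_nat_le_iff of_nat_mult[symmetric])
    also have "\<dots> \<le> (3 * (2 * M + 3) ^ ?m * b j ^ (?m + 1)) * ((9 * 2 powr (\<eta> * real j)) ^ ?m * (7 * l j / \<rho>))"
    proof (intro mult_mono R(2) order.trans[OF Vc(2)] order.trans[OF Kc(2)] power_mono)
      have "(1::real) \<le> 2 powr (\<eta> * real j)" using \<eta>(1) by (intro ge_one_powr_ge_zero) auto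
      then show "2 * V j + 1 \<le> 9 * 2 powr (\<eta> * real j)" by (simp add: V_def)
      \<comment> \<open>The additive constants in the count are absorbed because
        \<open>\<rho> < l j\<close>.\<close>
      have "3 \<le> 3 * (l j / \<rho>)" using \<rho> by (simp add: field_simps)
      then show "2 * (l j / (\<rho>/2) + 1) + 1 \<le> 7 * l j / \<rho>" by simp
    qed (use M b1[of j] V0[of j] l0[of j] \<rho> in auto)
    also have "\<dots> = 21 * (2 * M + 3) ^ ?m * 9 ^ ?m / \<rho> * (b j ^ (?m + 1) * (2 powr (\<eta> * real j)) ^ ?m * l j)"
      by (simp add: power_mult_distrib mult_ac)
    also have "\<dots> \<le> 21 * (2 * M + 3) ^ ?m * 9 ^ ?m / \<rho> * (9 * 2 powr ((real J + 10) * real (?m + 1) + 2) * g ^ j)"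
    proof (rule mult_left_mono)
      have "b j ^ (?m + 1) * (2 powr (\<eta> * real j)) ^ ?m * l j
          = 2 powr (1 + ((real J + 10 + 2 * \<eta> * real j) * real (?m + 1) + \<eta> * real j * real ?m - w * (real j - 1)))"
      proof -
        have dbl: "2 * 2 powr x = 2 powr (1 + x)" for x :: real by (simp add: powr_add)
        show ?thesis
          unfolding b_def l_def two_powr_power dbl powr_add[symmetric] by (simp add: algebra_simps)
      qed
      also have "\<dots> \<le> 2 powr ((real J + 10) * real (?m + 1) + 2 + - (1/2) * real j)"
      proof (rule powr_mono)
        \<comment> \<open>The initial points contribute 2 \<eta> (m + 1) per index to the exponent,
          the directions \<eta> m and the length -w = \<eta> - 1. The total \<eta> (3 m + 3) - 1 is
          at most -1/2 by hypothesis, which is the ratio \<open>g\<close>.\<close>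
        have "real j * (\<eta> * (3 * real ?m + 3)) \<le> real j * (1/2)"
          using \<eta>(2) by (intro mult_left_mono) auto
        then have "real j * (\<eta> * (3 * real ?m + 3)) - real j \<le> - (1/2) * real j" by simp
        moreover have "1 + ((real J + 10 + 2 * \<eta> * real j) * real (?m + 1) + \<eta> * real j * real ?m - w * (real j - 1))
            = (real J + 10) * real (?m + 1) + 1 + w + (real j * (\<eta> * (3 * real ?m + 3)) - real j)"
          unfolding \<eta>_def by (simp add: algebra_simps)
        ultimately show "1 + ((real J + 10 + 2 * \<eta> * real j) * real (?m + 1) + \<eta> * real j * real ?m - w * (real j - 1))
            \<le> (real J + 10) * real (?m + 1) + 2 + - (1/2) * real j"
          using w(1) by linarith
      qed simp
      also have "\<dots> = 2 powr ((real J + 10) * real (?m + 1) + 2) * g ^ j"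
        unfolding g_def two_powr_power by (simp only: powr_add mult_minus_left)
      also have "\<dots> \<le> 9 * 2 powr ((real J + 10) * real (?m + 1) + 2) * g ^ j"
        using g(1) by simp
      finally show "b j ^ (?m + 1) * (2 powr (\<eta> * real j)) ^ ?m * l j
          \<le> 9 * 2 powr ((real J + 10) * real (?m + 1) + 2) * g ^ j" .
    qed (use M \<rho> in auto)
    also have "\<dots> = K / \<rho> * g ^ j" by (simp add: K_def)
    finally show "real (card (X j \<rho>)) \<le> K / \<rho> * g ^ j" .
  qed
  have main: "\<exists>X. finite X \<and> real (card X) \<le> (C0 + K * (1 / (1 - g))) * \<rho> powr (- 1) \<and>
    (\<forall>A \<in> {A \<in> approximable w J :: (real ^ 'm) set. norm A \<le> M}. \<exists>y\<in>X. dist A y \<le> \<rho>)"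
    if \<rho>: "0 < \<rho>" "\<rho> \<le> 1" for \<rho>
  proof -
    have "\<forall>\<^sub>F n in sequentially. 2 powr (- (w * real n)) < \<rho>/2"
      using \<rho> by (intro order_tendstoD(2)[OF two_powr_neg_tendsto_0[OF w2(2)]]) simp
    then obtain n0 where n0: "\<And>n. n \<ge> n0 \<Longrightarrow> 2 powr (- (w * real n)) < \<rho>/2"
      unfolding eventually_sequentially by blast
    \<comment> \<open>The first time at which the approximating point is within
      \<open>\<rho>/2\<close> of \<open>A\<close>. Minimality yields \<open>\<rho> < l j\<close> for
      all \<open>j\<close> in question, as needed for counting net points.\<close>
    define n where "n = (LEAST n. J \<le> n \<and> 2 powr (- (w * real n)) \<le> \<rho>/2)"
    have "J \<le> n \<and> 2 powr (- (w * real n)) \<le> \<rho>/2"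
      unfolding n_def by (rule LeastI[of _ "max J n0"]) (use n0[of "max J n0"] in simp)
    then have n: "J \<le> n" "2 powr (- (w * real n)) \<le> \<rho>/2" by blast+
    have lj: "\<rho> < l j" if j: "J < j" "j \<le> n" for j
    proof -
      have "j - 1 < n" using j by simp
      then have "\<not> (J \<le> j - 1 \<and> 2 powr (- (w * real (j - 1))) \<le> \<rho>/2)"
        unfolding n_def by (rule not_less_Least)
      moreover have "J \<le> j - 1" using j by simp
      ultimately have "\<not> 2 powr (- (w * real (j - 1))) \<le> \<rho>/2" by blast
      then show ?thesis using j by (simp add: l_def of_nat_diff)
    qed
    define Y where "Y = ratpts M (2 ^ J) \<union> (\<Union>j\<in>{J<..n}. X j \<rho>)"
    have finX: "finite (X j \<rho>)" if "j \<in> {J<..n}" for j using X_card[OF \<rho>(1) lj] that by simp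
    have fin: "finite Y" unfolding Y_def using finX card_ratpts(1)[OF M, of "2 ^ J"] by simp
    have "real (card Y) \<le> real (card (ratpts M (2 ^ J) :: (real ^ 'm) set)) + real (card (\<Union>j\<in>{J<..n}. X j \<rho>))"
      unfolding Y_def using card_Un_le of_nat_mono by (metis of_nat_add)
    also have "\<dots> \<le> C0 + (\<Sum>j\<in>{J<..n}. real (card (X j \<rho>)))"
    proof (intro add_mono)
      show "real (card (ratpts M (2 ^ J) :: (real ^ 'm) set)) \<le> C0"
        unfolding C0_def using M by (intro card_ratpts) auto
      have "card (\<Union>j\<in>{J<..n}. X j \<rho>) \<le> (\<Sum>j\<in>{J<..n}. card (X j \<rho>))" by (rule card_UN_le) simp
      then show "real (card (\<Union>j\<in>{J<..n}. X j \<rho>)) \<le> (\<Sum>j\<in>{J<..n}. real (card (X j \<rho>)))"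
        by (simp only: of_nat_le_iff of_nat_sum[symmetric])
    qed
    also have "\<dots> \<le> C0 + (\<Sum>j\<in>{J<..n}. K / \<rho> * g ^ j)"
      using X_card[OF \<rho>(1) lj] by (intro add_left_mono sum_mono) auto
    also have "\<dots> = C0 + K / \<rho> * (\<Sum>j\<in>{J<..n}. g ^ j)" by (simp only: sum_distrib_left)
    also have "\<dots> \<le> C0 / \<rho> + K / \<rho> * (1 / (1 - g))"
    proof (intro add_mono mult_left_mono)
      show "C0 \<le> C0 / \<rho>" using C00 \<rho> by (simp add: field_simps mult_left_le)
      have "(\<Sum>j\<in>{J<..n}. g ^ j) \<le> (\<Sum>j. g ^ j)"
        using g by (intro sum_le_suminf summable_geometric) auto
      then show "(\<Sum>j\<in>{J<..n}. g ^ j) \<le> 1 / (1 - g)" using g by (simp add: suminf_geometric)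
    qed (use K0 \<rho> in auto)
    also have "\<dots> = (C0 + K * (1 / (1 - g))) * \<rho> powr (- 1)"
      using \<rho> by (simp add: powr_minus divide_inverse algebra_simps)
    finally have card: "real (card Y) \<le> (C0 + K * (1 / (1 - g))) * \<rho> powr (- 1)" .
    have "\<exists>y\<in>Y. dist A y \<le> \<rho>" if "A \<in> approximable w J" "norm A \<le> M" for A :: "real ^ 'm"
    proof -
      obtain p q where pq: "\<And>j. J \<le> j \<Longrightarrow> 0 < q j \<and> of_int (q j) \<le> (2::real) ^ j \<and>
          norm (of_int (q j) *\<^sub>R A - ivec (p j)) \<le> 2 powr (- (w * real j))"
        using approximableE[OF \<open>A \<in> approximable w J\<close>] by blast
      have An: "dist A (ratpt (p n) (q n)) \<le> \<rho>/2"
        using norm_diff_ratpt_le[of "q n" A "p n"] pq[OF n(1)] n(2) by (simp add: dist_norm)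
      show ?thesis
      proof (rule change_of_line[OF w2(2) w(1) n(1) pq])
        assume const: "\<forall>j\<in>{J..n}. ratpt (p j) (q j) = ratpt (p J) (q J)"
        have "ratpt (p n) (q n) = ratpt (p J) (q J)" by (rule bspec[OF const]) (use n(1) in simp)
        moreover have "ratpt (p J) (q J) \<in> ratpts M (2 ^ J)"
          using pq[of J] \<open>norm A \<le> M\<close> two_powr_neg_le_1[of "w * real J"] w2(2)
          by (intro ratpt_in_ratpts) (blast, blast, blast, force)
        ultimately show ?thesis using An \<rho>(1) by (intro bexI[of _ "ratpt (p J) (q J)"]) (auto simp: Y_def)
      next
        fix c j q1 p1 s
        assume c: "J \<le> c" "c < j" "j \<le> n" "0 < q1" "of_int q1 \<le> (2::real) ^ c"
          "norm (of_int q1 *\<^sub>R A - ivec p1) \<le> 2 powr (- (w * real (j - 1)))"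
          "ratpt (p n) (q n) = ratpt p1 q1 + s *\<^sub>R ivec (q1 *s p j - q j *s p1)"
          "c = J \<or> w * real c - 5 \<le> (1 - w) * real j"
        define v where "v = q1 *s p j - q j *s p1"
        have j1: "real (j - 1) = real j - 1" using c(2) by (simp add: of_nat_diff)
        have "2 powr (- (w * real (j - 1))) \<le> (1::real)"
          using w2(2) by (intro two_powr_neg_le_1) simp
        then have e1: "norm (of_int q1 *\<^sub>R A - ivec p1) \<le> 1" using c(6) by linarith
        have cb: "(2::real) ^ c \<le> b j"
        proof -
          have "real c \<le> real J + 10 + 2 * \<eta> * real j"
            using c(8)
          proof
            assume "w * real c - 5 \<le> (1 - w) * real j"
            moreover have "1/2 * real c \<le> w * real c" using w2(1) by (rule mult_right_mono) simp
            ultimately show ?thesis unfolding \<eta>_def mult.assoc by linarith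
          qed (use \<eta>(1) in simp)
          then have "2 powr real c \<le> b j" unfolding b_def by (intro powr_mono) auto
          then show ?thesis by (simp add: powr_realpow)
        qed
        have P1: "ratpt p1 q1 \<in> ratpts M (b j)"
          by (rule ratpt_in_ratpts[OF c(4) order.trans[OF c(5) cb] \<open>norm A \<le> M\<close> e1])
        have Jj: "J \<le> j" using c by simp
        have v: "v \<in> Vs j"
        proof -
          \<comment> \<open>The multiples of \<open>A\<close> cancel, so the direction is a
            combination of two errors and much smaller than its numerators suggest.\<close>
          have "ivec v = of_int (q j) *\<^sub>R (of_int q1 *\<^sub>R A - ivec p1) - of_int q1 *\<^sub>R (of_int (q j) *\<^sub>R A - ivec (p j))"
            unfolding v_def ivec_diff ivec_scale by (simp add: algebra_simps)
          then have "norm (ivec v) \<le> norm (of_int (q j) *\<^sub>R (of_int q1 *\<^sub>R A - ivec p1))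
              + norm (of_int q1 *\<^sub>R (of_int (q j) *\<^sub>R A - ivec (p j)))"
            by (simp only: norm_triangle_ineq4)
          also have "\<dots> \<le> 2 powr real j * 2 powr (- (w * real (j - 1))) + 2 powr real j * 2 powr (- (w * real j))"
          proof (intro add_mono)
            have qj: "0 < q j" "of_int (q j) \<le> (2::real) powr real j"
              using pq[OF Jj] by (auto simp: powr_realpow)
            have "(2::real) ^ c \<le> 2 ^ j" using c(2) by (intro power_increasing) auto
            then have "of_int q1 \<le> (2::real) ^ j" by (rule order.trans[OF c(5)])
            then have q1: "of_int q1 \<le> (2::real) powr real j" by (simp only: powr_realpow zero_less_numeral)
            show "norm (of_int (q j) *\<^sub>R (of_int q1 *\<^sub>R A - ivec p1)) \<le> 2 powr real j * 2 powr (- (w * real (j - 1)))"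
              unfolding norm_scaleR using qj c(6) by (intro mult_mono) auto
            show "norm (of_int q1 *\<^sub>R (of_int (q j) *\<^sub>R A - ivec (p j))) \<le> 2 powr real j * 2 powr (- (w * real j))"
              unfolding norm_scaleR using q1 c(4) pq[OF Jj] by (intro mult_mono) auto
          qed
          also have "\<dots> = 2 powr (\<eta> * real j) * 2 powr w + 2 powr (\<eta> * real j)"
            unfolding powr_add[symmetric] j1 \<eta>_def by (simp add: algebra_simps)
          also have "\<dots> \<le> 2 powr (\<eta> * real j) * 2 powr 1 + 2 powr (\<eta> * real j)"
            using w(1) by (intro add_right_mono mult_left_mono powr_mono) auto
          also have "\<dots> \<le> V j" by (simp add: V_def)
          finally have "norm (ivec v) \<le> V j" .
          moreover have "\<bar>real_of_int (v $ i)\<bar> \<le> norm (ivec v)" for i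
            using component_le_norm_cart[of "ivec v" i] by simp
          ultimately show ?thesis unfolding Vs_def by (auto intro: order.trans)
        qed
        have "norm (ratpt (p n) (q n) - ratpt p1 q1) \<le> l j"
        proof -
          have "dist A (ratpt p1 q1) \<le> 2 powr (- (w * (real j - 1)))"
            using norm_diff_ratpt_le[OF c(4), of A p1] c(6) unfolding dist_norm j1 by linarith
          moreover have "\<rho>/2 \<le> 2 powr (- (w * (real j - 1)))"
            using lj[of j] c by (simp add: l_def)
          ultimately show ?thesis
            using An dist_triangle2[of "ratpt (p n) (q n)" "ratpt p1 q1" A]
            by (simp add: l_def dist_norm[symmetric] dist_commute)
        qed
        then obtain k :: int where k: "\<bar>of_int k\<bar> \<le> l j / (\<rho>/2) + 1"
            "dist (ratpt (p n) (q n)) (ratpt p1 q1 + (of_int k * (\<rho>/2)) *\<^sub>R sgn (ivec v)) \<le> \<rho>/2"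
          using sgn_segment_point[OF c(7)[folded v_def], of "\<rho>/2" "l j"] \<rho>(1) by auto
        have "ratpt p1 q1 + (of_int k * (\<rho>/2)) *\<^sub>R sgn (ivec v) \<in> X j \<rho>"
          unfolding X_def using P1 v k(1)
          by (intro image_eqI[of _ _ "(ratpt p1 q1, v, k)"]) (simp_all add: Ks_def)
        then have "ratpt p1 q1 + (of_int k * (\<rho>/2)) *\<^sub>R sgn (ivec v) \<in> Y"
          unfolding Y_def using c(1-3) by auto
        moreover have "dist A (ratpt p1 q1 + (of_int k * (\<rho>/2)) *\<^sub>R sgn (ivec v)) \<le> \<rho>"
          using An k(2) dist_triangle[of A "ratpt p1 q1 + (of_int k * (\<rho>/2)) *\<^sub>R sgn (ivec v)" "ratpt (p n) (q n)"]
          by linarith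
        ultimately show ?thesis by blast
      qed
    qed
    then show ?thesis using fin card by blast
  qed
  have "0 \<le> C0 + K * (1 / (1 - g))" using C00 K0 g by simp
  then show ?thesis using main by blast
qed

section \<open>Points with a prescribed uniform exponent\<close>

text \<open>The bound on \<open>K\<close> makes \<open>n (Suc j)\<close> at least
  \<open>n j powr (2 * lam)\<close>, so each denominator outgrows the time at which the preceding
  approximation fails.\<close>

locale tower =
  fixes K :: nat and lam :: real
  assumes lam: "3 \<le> lam" and K: "4 * lam \<le> real K"
begin

definition base :: "nat \<Rightarrow> nat" where
  "base j = (if even j then 2 else 3)"

definition n :: "nat \<Rightarrow> nat" where
  "n j = base j ^ (K ^ j)"

text \<open>The intended size of the tail after index \<open>j\<close>: the denominator
  \<open>n j * n (Suc j)\<close> then leaves the error \<open>n (Suc j) powr (1 - lam)\<close> up to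
  a constant.\<close>

definition \<delta> :: "nat \<Rightarrow> real" where
  "\<delta> j = 1 / (real (n j) * real (n (Suc j)) powr lam)"

text \<open>The number of choices for the digit of index \<open>j\<close>. A term
  \<open>g j / n j\<close> has the size of \<open>\<delta> (j - 2)\<close>, because the term of
  index \<open>j\<close> heads the tail after \<open>j - 2\<close> on the same coordinate. The first
  two indices head no tail and carry no freedom.\<close>

definition g :: "nat \<Rightarrow> nat" where
  "g j = (if j < 2 then 1 else nat \<lfloor>\<delta> (j - 2) * real (n j)\<rfloor>)"

lemma K12: "12 \<le> K"
  using lam K by linarith

lemma base_cases: "base j = 2 \<or> base j = 3"
  by (simp add: base_def)

lemma n_ge: "2 ^ (K ^ j) \<le> n j"
  unfolding n_def by (rule power_mono) (simp_all add: base_def)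

lemma n_ge_2: "2 \<le> n j"
proof -
  have "2 ^ 1 \<le> (2::nat) ^ (K ^ j)" using K12 by (intro power_increasing) auto
  then show ?thesis using n_ge[of j] by simp
qed

lemma n_gt_0 [simp]: "0 < n j"
  using n_ge_2[of j] by simp

lemma n_neq_0 [simp]: "n j \<noteq> 0"
  using n_gt_0[of j] by linarith

lemma n_ge_self: "j \<le> n j"
proof -
  have "j < 2 ^ j" by (rule less_exp)
  also have "(2::nat) ^ j \<le> 2 ^ (K ^ j)"
  proof (intro power_increasing)
    have "j < K ^ j" using K12 power_gt_expt[of K j] by simp
    then show "j \<le> K ^ j" by simp
  qed simp
  finally show ?thesis using n_ge[of j] by simp
qed

text \<open>The exponent is \<open>K / 2\<close> and not \<open>K\<close> because the base may drop
  from 3 to 2; the estimate uses 3 \<le> 4 = 2^2.\<close>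

lemma n_growth: "real (n j) powr (real K / 2) \<le> real (n (Suc j))"
proof -
  have "real (n j) \<le> real (4 ^ (K ^ j))"
    unfolding n_def of_nat_le_iff by (rule power_mono) (simp_all add: base_def)
  also have "\<dots> = 2 ^ (2 * K ^ j)" by (simp add: power_mult)
  also have "\<dots> = 2 powr (2 * real (K ^ j))" using powr_realpow[of 2 "2 * K ^ j"] by simp
  finally have "real (n j) powr (real K / 2) \<le> (2 powr (2 * real (K ^ j))) powr (real K / 2)"
    by (intro powr_mono2) auto
  also have "\<dots> = 2 powr real (K ^ Suc j)" by (simp add: powr_powr mult.commute)
  also have "\<dots> = real (2 ^ (K ^ Suc j))" using powr_realpow[of 2 "K ^ Suc j"] by simp
  also have "\<dots> \<le> real (n (Suc j))" using n_ge[of "Suc j"] by (simp only: of_nat_le_iff)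
  finally show ?thesis .
qed

lemma n_powr_le_Suc:
  assumes "x \<le> real K / 2"
  shows "real (n j) powr x \<le> real (n (Suc j))"
proof -
  have "real (n j) powr x \<le> real (n j) powr (real K / 2)"
    using assms n_ge_2[of j] by (intro powr_mono) auto
  then show ?thesis using n_growth[of j] by linarith
qed

lemma n_cube_le: "real (n j) ^ 3 \<le> real (n (Suc j))"
proof -
  have "real (n j) powr 3 \<le> real (n (Suc j))" using K12 by (intro n_powr_le_Suc) simp
  then show ?thesis using powr_realpow[of "real (n j)" 3] by simp
qed

lemma two_n_le: "2 * real (n j) \<le> real (n (Suc j))"
proof -
  have "2 * real (n j) \<le> real (n j) ^ 2 * real (n j)"
    using n_ge_2[of j] power_mono[of 2 "real (n j)" 2] by (intro mult_right_mono) auto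
  also have "\<dots> = real (n j) ^ 3" by (simp add: power2_eq_square power3_eq_cube)
  finally show ?thesis using n_cube_le[of j] by linarith
qed

lemma n_le_Suc: "real (n j) \<le> real (n (Suc j))"
  using two_n_le[of j] by linarith

lemma n_mono: "i \<le> j \<Longrightarrow> real (n i) \<le> real (n j)"
  by (rule lift_Suc_mono_le[of "\<lambda>j. real (n j)"]) (rule n_le_Suc)

lemma n_real_ge_2: "2 \<le> real (n j)"
  using n_ge_2[of j] by linarith

lemma n_powr_ge: "1 \<le> x \<Longrightarrow> real (n j) \<le> real (n j) powr x"
  using powr_mono[of 1 x "real (n j)"] n_real_ge_2[of j] by simp

lemma n_powr_lam_ge: "real (n j) ^ 3 \<le> real (n j) powr lam"
  using powr_mono[of 3 lam "real (n j)"] lam n_real_ge_2[of j] powr_realpow[of "real (n j)" 3] by simp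

lemma \<delta>_pos [simp]: "0 < \<delta> j"
  by (simp add: \<delta>_def)

lemma \<delta>_nonneg [simp]: "0 \<le> \<delta> j"
  by (rule less_imp_le) simp

lemma \<delta>_le_half: "\<delta> (Suc j) \<le> \<delta> j / 2"
proof -
  have "2 * (real (n j) * real (n (Suc j)) powr lam) = real (n (Suc j)) powr lam * (2 * real (n j))"
    by simp
  also have "\<dots> \<le> real (n (Suc (Suc j))) powr lam * real (n (Suc j))"
    using two_n_le[of j] n_le_Suc[of "Suc j"] lam by (intro mult_mono powr_mono2) auto
  finally have "2 * (real (n j) * real (n (Suc j)) powr lam)
      \<le> real (n (Suc j)) * real (n (Suc (Suc j))) powr lam" by (simp only: mult.commute)
  then have "1 / (real (n (Suc j)) * real (n (Suc (Suc j))) powr lam)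
      \<le> 1 / (2 * (real (n j) * real (n (Suc j)) powr lam))"
    by (intro divide_left_mono) simp_all
  then show ?thesis by (simp add: \<delta>_def)
qed

lemma \<delta>_add_le: "\<delta> (j + k) \<le> \<delta> j * (1/2) ^ k"
proof (induction k)
  case (Suc k)
  then show ?case using \<delta>_le_half[of "j + k"] by simp
qed simp

lemma \<delta>_le_inverse: "100 * (real (n j) * \<delta> j) \<le> 1"
proof -
  have "64 * 64 \<le> real (n (Suc j)) powr lam"
  proof -
    have "(2::real) ^ 12 \<le> 2 ^ (K ^ Suc j)"
    proof (rule power_increasing)
      have "K ^ 1 \<le> K ^ Suc j" using K12 by (intro power_increasing) auto
      then show "12 \<le> K ^ Suc j" unfolding power_one_right by (rule order.trans[OF K12])
    qed simp
    also have "\<dots> = real (2 ^ (K ^ Suc j))" by simp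
    also have "\<dots> \<le> real (n (Suc j))" using n_ge[of "Suc j"] by (simp only: of_nat_le_iff)
    also have "\<dots> \<le> real (n (Suc j)) powr lam" using lam by (intro n_powr_ge) simp
    finally show ?thesis by simp
  qed
  then have "100 \<le> real (n (Suc j)) powr lam" by linarith
  then show ?thesis by (simp add: \<delta>_def)
qed

lemma inverse_\<delta>_le: "1 / \<delta> j \<le> real (n (Suc j)) powr (lam + 1)"
proof -
  have "1 / \<delta> j = real (n j) * real (n (Suc j)) powr lam" by (simp add: \<delta>_def)
  also have "\<dots> \<le> real (n (Suc j)) * real (n (Suc j)) powr lam"
    by (intro mult_right_mono n_le_Suc) simp
  also have "\<dots> = real (n (Suc j)) powr (lam + 1)" by (simp add: powr_add)
  finally show ?thesis .
qed

text \<open>\<open>1 / \<delta> j\<close> is at most \<open>n (Suc j) powr (lam + 1)\<close>, a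
  small power of the next denominator when \<open>K\<close> is large. Hence almost
  \<open>n (Suc (Suc j))\<close> digits are available at that index, which is the source of packing
  dimension 1.\<close>

lemma \<delta>_n_ge:
  "real (n (Suc (Suc j))) powr (1 - 2 * (lam + 1) / real K) \<le> \<delta> j * real (n (Suc (Suc j)))"
proof -
  let ?N = "real (n (Suc (Suc j)))"
  have K0: "0 < real K" using K12 by simp
  have "real (n (Suc j)) powr (lam + 1) = (real (n (Suc j)) powr (real K / 2)) powr (2 * (lam + 1) / real K)"
  proof -
    have "real K / 2 * (2 * (lam + 1) / real K) = lam + 1" using K0 by (simp add: field_simps)
    then show ?thesis by (simp only: powr_powr)
  qed
  also have "\<dots> \<le> ?N powr (2 * (lam + 1) / real K)"
    using n_growth[of "Suc j"] lam K0 by (intro powr_mono2) auto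
  finally have "1 / \<delta> j \<le> ?N powr (2 * (lam + 1) / real K)" using inverse_\<delta>_le[of j] by linarith
  then have "1 / ?N powr (2 * (lam + 1) / real K) \<le> \<delta> j" by (simp add: field_simps)
  then have "1 / ?N powr (2 * (lam + 1) / real K) * ?N \<le> \<delta> j * ?N" by (rule mult_right_mono) simp
  then show ?thesis by (simp add: powr_diff)
qed

text \<open>This third is the origin of the factor 3 in the Hoelder exponent
  \<open>1 / (3 * (lam + 1))\<close>.\<close>

lemma exponent_ge_third: "1/3 \<le> 1 - 2 * (lam + 1) / real K"
proof -
  have "6 * lam + 6 \<le> 2 * real K" using lam K by linarith
  then have "2 * (lam + 1) / real K \<le> 2/3" using K12 by (simp add: field_simps)
  then show ?thesis by simp
qed

lemma \<delta>_n_ge_1: "1 \<le> \<delta> j * real (n (Suc (Suc j)))"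
proof -
  have "0 \<le> 1 - 2 * (lam + 1) / real K" using exponent_ge_third by linarith
  then have "1 \<le> real (n (Suc (Suc j))) powr (1 - 2 * (lam + 1) / real K)"
    using n_real_ge_2[of "Suc (Suc j)"] by (intro ge_one_powr_ge_zero) linarith+
  then show ?thesis using \<delta>_n_ge[of j] by linarith
qed

lemma g_bounds:
  "\<delta> j * real (n (Suc (Suc j))) / 2 \<le> real (g (Suc (Suc j)))"
  "real (g (Suc (Suc j))) \<le> \<delta> j * real (n (Suc (Suc j)))"
proof -
  define x where "x = \<delta> j * real (n (Suc (Suc j)))"
  have "1 \<le> \<lfloor>x\<rfloor>" using \<delta>_n_ge_1[of j] by (simp add: x_def)
  then have "real (g (Suc (Suc j))) = of_int \<lfloor>x\<rfloor>" by (simp add: g_def x_def)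
  moreover have "of_int \<lfloor>x\<rfloor> \<le> x" "x < of_int \<lfloor>x\<rfloor> + 1" by linarith+
  ultimately show "x / 2 \<le> real (g (Suc (Suc j)))" "real (g (Suc (Suc j))) \<le> x"
    using \<open>1 \<le> \<lfloor>x\<rfloor>\<close> by linarith+
qed

lemma g_gt_0 [simp]: "0 < g j"
proof (cases "j < 2")
  case False
  then obtain i where "j = Suc (Suc i)" by (metis add_2_eq_Suc le_Suc_ex not_less)
  moreover have "1 \<le> \<lfloor>\<delta> i * real (n (Suc (Suc i)))\<rfloor>" using \<delta>_n_ge_1[of i] by simp
  ultimately show ?thesis by (simp add: g_def)
qed (simp add: g_def)

lemma n_div: "n (Suc (Suc j)) = n j * base j ^ (K ^ Suc (Suc j) - K ^ j)"
  "0 < K ^ Suc (Suc j) - K ^ j"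
proof -
  have "K ^ j < K ^ Suc (Suc j)" using K12 by (intro power_strict_increasing) auto
  then show "0 < K ^ Suc (Suc j) - K ^ j" by simp
  have "base (Suc (Suc j)) = base j" by (simp add: base_def)
  then show "n (Suc (Suc j)) = n j * base j ^ (K ^ Suc (Suc j) - K ^ j)"
    unfolding n_def power_add[symmetric] le_add_diff_inverse[OF less_imp_le[OF \<open>K ^ j < K ^ Suc (Suc j)\<close>]]
    by (rule arg_cong)
qed

lemma coprime_n: "coprime (int (n j)) (int (n (Suc j)))"
proof -
  have "coprime (2::int) 3" using coprime_add_one_right[of "2::int"] by simp
  then have "coprime (3::int) 2" by (simp add: coprime_commute)
  have "coprime (int (base j)) (int (base (Suc j)))"
    using \<open>coprime (2::int) 3\<close> \<open>coprime (3::int) 2\<close> by (simp add: base_def)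
  then show ?thesis unfolding n_def by simp
qed

end

section \<open>Digits of t and the coordinates they encode\<close>

context tower
begin

text \<open>The mixed radix expansion of \<open>t\<close> with radices \<open>g i\<close>:
  \<open>\<lfloor>t * cells j\<rfloor>\<close> numbers the interval of level \<open>j\<close>
  containing \<open>t\<close>, and \<open>digit t j\<close> is the last digit of that
  number.\<close>

definition cells :: "nat \<Rightarrow> nat" where
  "cells j = (\<Prod>i\<le>j. g i)"

definition digit :: "real \<Rightarrow> nat \<Rightarrow> int" where
  "digit t j = \<lfloor>t * real (cells j)\<rfloor> mod int (g j)"

text \<open>The shift by \<open>g j\<close> keeps each term of full size, so that tails are bounded
  below; the residue 1 modulo 6 makes numerators coprime to both bases; the spacing 6 outweighs what
  later terms can change.\<close>

definition term_num :: "real \<Rightarrow> nat \<Rightarrow> int" where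
  "term_num t j = 6 * (int (g j) + digit t j) + 1"

text \<open>The numerator, over \<open>n j\<close>, of the partial sum of the terms whose index has
  the parity of \<open>j\<close>.\<close>

fun num :: "real \<Rightarrow> nat \<Rightarrow> int" where
  "num t 0 = 1"
| "num t (Suc 0) = 1"
| "num t (Suc (Suc j)) = num t j * int (base j ^ (K ^ Suc (Suc j) - K ^ j)) + term_num t (Suc (Suc j))"

definition tail_term :: "real \<Rightarrow> nat \<Rightarrow> real" where
  "tail_term t j = of_int (term_num t (Suc (Suc j))) / real (n (Suc (Suc j)))"

definition tail :: "real \<Rightarrow> nat \<Rightarrow> real" where
  "tail t j = (\<Sum>k. tail_term t (j + 2 * k))"

text \<open>By \<open>coord_Suc_Suc\<close> the value depends only on the parity of
  \<open>j\<close>; the index merely selects where the series is cut.\<close>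

definition coord :: "real \<Rightarrow> nat \<Rightarrow> real" where
  "coord t j = of_int (num t j) / real (n j) + tail t j"

lemma cells_gt_0 [simp]: "0 < cells j"
  unfolding cells_def by (simp add: prod_pos)

lemma cells_neq_0 [simp]: "cells j \<noteq> 0"
  using cells_gt_0[of j] by linarith

lemma cells_Suc: "cells (Suc j) = cells j * g (Suc j)"
  by (simp add: cells_def)

lemma g_le_cells: "g j \<le> cells j"
proof (cases j)
  case (Suc i)
  have "1 * g (Suc i) \<le> cells i * g (Suc i)" using cells_gt_0[of i] by (intro mult_right_mono) linarith+
  then show ?thesis using Suc by (simp add: cells_Suc)
qed (simp add: cells_def)

lemma floor_cells_Suc:
  "\<lfloor>t * real (cells (Suc j))\<rfloor> = \<lfloor>t * real (cells j)\<rfloor> * int (g (Suc j)) + digit t (Suc j)"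
proof -
  have "real (g (Suc j)) \<noteq> 0" by (metis g_gt_0 less_numeral_extra(3) of_nat_eq_0_iff)
  then have "t * real (cells j) = t * real (cells (Suc j)) / real_of_int (int (g (Suc j)))"
    unfolding cells_Suc of_nat_mult of_int_of_nat_eq mult.assoc[symmetric]
    by (rule nonzero_mult_div_cancel_right[symmetric])
  then have "\<lfloor>t * real (cells j)\<rfloor> = \<lfloor>t * real (cells (Suc j))\<rfloor> div int (g (Suc j))"
    by (simp only: floor_divide_real_eq_div of_nat_0_le_iff)
  then show ?thesis by (simp add: digit_def)
qed

lemma floor_cells_0: "t \<in> {0..<1} \<Longrightarrow> \<lfloor>t * real (cells 0)\<rfloor> = 0"
  by (simp add: cells_def g_def floor_eq_iff)

lemma digit_bounds: "0 \<le> digit t j" "digit t j < int (g j)"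
  by (simp_all add: digit_def)

lemma tail_term_bounds: "3 * \<delta> j \<le> tail_term t j" "tail_term t j \<le> 12 * \<delta> j"
proof -
  let ?G = "real (g (Suc (Suc j)))" and ?N = "real (n (Suc (Suc j)))"
  have N: "0 < ?N" by simp
  have "6 * int (g (Suc (Suc j))) \<le> term_num t (Suc (Suc j))"
    "term_num t (Suc (Suc j)) \<le> 12 * int (g (Suc (Suc j)))"
    using digit_bounds[of t "Suc (Suc j)"] by (auto simp: term_num_def)
  then have "6 * ?G \<le> of_int (term_num t (Suc (Suc j)))" "of_int (term_num t (Suc (Suc j))) \<le> 12 * ?G"
    by linarith+
  then have "3 * \<delta> j * ?N \<le> of_int (term_num t (Suc (Suc j)))"
    "of_int (term_num t (Suc (Suc j))) \<le> 12 * \<delta> j * ?N"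
    using g_bounds[of j] by linarith+
  then show "3 * \<delta> j \<le> tail_term t j" "tail_term t j \<le> 12 * \<delta> j"
    unfolding tail_term_def using N by (simp_all add: pos_le_divide_eq pos_divide_le_eq)
qed

lemma tail_term_pos: "0 < tail_term t j"
  using tail_term_bounds(1)[of j t] \<delta>_pos[of j] by linarith

lemma tail_term_le: "tail_term t (j + 2 * k) \<le> 12 * \<delta> j * (1/2) ^ k"
proof -
  have "tail_term t (j + 2 * k) \<le> 12 * \<delta> (j + 2 * k)" by (rule tail_term_bounds)
  also have "\<dots> \<le> 12 * (\<delta> j * (1/2) ^ (2 * k))" using \<delta>_add_le[of j "2 * k"] by simp
  also have "\<dots> \<le> 12 * (\<delta> j * (1/2) ^ k)"
    using less_imp_le[OF \<delta>_pos[of j]] by (intro mult_left_mono power_decreasing) auto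
  finally show ?thesis by (simp add: mult.assoc)
qed

lemma summable_tail_term: "summable (\<lambda>k. tail_term t (j + 2 * k))"
proof (rule summable_comparison_test')
  show "summable (\<lambda>k. 12 * \<delta> j * (1/2) ^ k)" by (intro summable_mult summable_geometric) simp
  show "norm (tail_term t (j + 2 * k)) \<le> 12 * \<delta> j * (1/2) ^ k" for k
    using tail_term_le[of t j k] tail_term_pos[of t "j + 2 * k"] by simp
qed

lemma tail_bounds: "3 * \<delta> j \<le> tail t j" "tail t j \<le> 24 * \<delta> j"
proof -
  have "(\<Sum>k\<in>{0}. tail_term t (j + 2 * k)) \<le> tail t j"
    unfolding tail_def using tail_term_pos less_imp_le by (intro sum_le_suminf summable_tail_term) auto
  then show "3 * \<delta> j \<le> tail t j" using tail_term_bounds(1)[of j t] by simp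
  have "tail t j \<le> (\<Sum>k. 12 * \<delta> j * (1/2) ^ k)"
    unfolding tail_def by (intro suminf_le tail_term_le summable_tail_term summable_mult summable_geometric) simp
  also have "\<dots> = 12 * \<delta> j * (\<Sum>k. (1/2) ^ k)" by (intro suminf_mult summable_geometric) simp
  also have "\<dots> = 24 * \<delta> j" by (simp add: suminf_geometric)
  finally show "tail t j \<le> 24 * \<delta> j" .
qed

lemma tail_nonneg [simp]: "0 \<le> tail t j"
  using tail_bounds(1)[where t = t and j = j] \<delta>_nonneg[of j] by linarith

lemma tail_Suc_Suc: "tail t j = tail_term t j + tail t (Suc (Suc j))"
  unfolding tail_def using suminf_split_head[OF summable_tail_term[of t j]] by simp

lemma coord_Suc_Suc [simp]: "coord t (Suc (Suc j)) = coord t j"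
proof -
  have "base j \<noteq> 0" by (simp add: base_def)
  have "of_int (num t (Suc (Suc j))) / real (n (Suc (Suc j)))
      = of_int (num t j) / real (n j) + tail_term t j"
    unfolding tail_term_def num.simps of_int_add of_int_mult add_divide_distrib n_div(1)[of j]
    using \<open>base j \<noteq> 0\<close> by simp
  then show ?thesis unfolding coord_def tail_Suc_Suc[of t j] by simp
qed

text \<open>Modulo the base, the previous numerator is multiplied by a positive power of the base
  and the digit part by 6, so only the final 1 of \<open>term_num\<close> survives.\<close>

lemma coprime_num_base: "coprime (num t j) (int (base j))"
proof (induction t j rule: num.induct)
  case (3 t j)
  let ?b = "int (base j)"
  have "?b dvd num t (Suc (Suc j)) - 1"
  proof -
    have "?b dvd int (base j ^ (K ^ Suc (Suc j) - K ^ j))"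
      using n_div(2)[of j] by (simp add: dvd_power)
    moreover have "?b dvd 6" using base_cases[of j] by auto
    ultimately have "?b dvd num t j * int (base j ^ (K ^ Suc (Suc j) - K ^ j))
        + 6 * (int (g (Suc (Suc j))) + digit t (Suc (Suc j)))"
      by (intro dvd_add dvd_mult dvd_mult2)
    then show ?thesis by (simp add: term_num_def)
  qed
  moreover have "base (Suc (Suc j)) = base j" by (simp add: base_def)
  ultimately show ?case
  proof (intro coprimeI)
    fix d assume "?b dvd num t (Suc (Suc j)) - 1" "d dvd num t (Suc (Suc j))" "d dvd int (base (Suc (Suc j)))"
      "base (Suc (Suc j)) = base j"
    then have "d dvd num t (Suc (Suc j)) - 1" by (metis dvd_trans)
    with \<open>d dvd num t (Suc (Suc j))\<close> have "d dvd num t (Suc (Suc j)) - (num t (Suc (Suc j)) - 1)"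
      by (rule dvd_diff)
    moreover have "num t (Suc (Suc j)) - (num t (Suc (Suc j)) - 1) = 1" by linarith
    ultimately show "is_unit d" by (simp only:)
  qed
qed simp_all

lemma coprime_num: "coprime (num t j) (int (n j))"
  unfolding n_def using coprime_num_base[of t j] by simp

lemma digit_cong_num:
  assumes "\<And>i. i \<le> j \<Longrightarrow> digit t i = digit u i"
  shows "num t j = num u j"
  using assms
proof (induction t j rule: num.induct)
  case (3 t j)
  then have "num t j = num u j" "term_num t (Suc (Suc j)) = term_num u (Suc (Suc j))"
    by (simp_all add: term_num_def)
  then show ?case by simp
qed simp_all

lemma floor_cells_cong:
  assumes "t \<in> {0..<1}" "u \<in> {0..<1}" "\<And>i. i \<le> j \<Longrightarrow> digit t i = digit u i"
  shows "\<lfloor>t * real (cells j)\<rfloor> = \<lfloor>u * real (cells j)\<rfloor>"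
  using assms(3)
proof (induction j)
  case 0
  then show ?case using floor_cells_0 assms(1,2) by simp
next
  case (Suc j)
  have "\<lfloor>t * real (cells j)\<rfloor> = \<lfloor>u * real (cells j)\<rfloor>" using Suc.prems by (intro Suc.IH) simp
  moreover have "digit t (Suc j) = digit u (Suc j)" by (rule Suc.prems) simp
  ultimately show ?case unfolding floor_cells_Suc by simp
qed

lemma digit_less_2: "j < 2 \<Longrightarrow> digit t j = 0"
  by (simp add: digit_def g_def)

text \<open>Take the first index \<open>i\<close> with different digits. The earlier terms agree, so
  on that coordinate the points differ by \<open>6 * D / n i\<close> up to tails worth at most
  \<open>1 / n i\<close>. The digit gap \<open>d\<close> is kept in both conclusions because the
  Hoelder estimate compares it with \<open>g i\<close>.\<close>

lemma first_difference:
  assumes t: "t \<in> {0..<1}" and u: "u \<in> {0..<1}"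
    and ne: "\<lfloor>t * real (cells j)\<rfloor> \<noteq> \<lfloor>u * real (cells j)\<rfloor>"
  obtains i d where "2 \<le> i" "i \<le> j" "1 \<le> d" "d \<le> real (g i)"
    "d \<le> real (n i) * \<bar>coord t i - coord u i\<bar>" "\<bar>t - u\<bar> * real (cells i) \<le> 2 * d"
proof -
  have "\<exists>i\<le>j. digit t i \<noteq> digit u i"
    using floor_cells_cong[OF t u, of j] ne by blast
  then obtain i where i: "i \<le> j" "digit t i \<noteq> digit u i"
      and least: "\<And>k. k < i \<Longrightarrow> digit t k = digit u k"
    using exists_least_iff[of "\<lambda>i. i \<le> j \<and> digit t i \<noteq> digit u i"]
    by (metis le_trans less_imp_le_nat)
  have "2 \<le> i" using digit_less_2[of i] i(2) by (metis not_le)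
  then obtain k where k: "i = Suc (Suc k)" by (metis add_2_eq_Suc le_Suc_ex)
  define D :: real where "D = of_int (digit t i) - of_int (digit u i)"
  define d where "d = \<bar>D\<bar>"
  have d1: "1 \<le> d" unfolding d_def D_def using i(2) by linarith
  have dg: "d \<le> real (g i)"
    unfolding d_def D_def using digit_bounds[of t i] digit_bounds[of u i] by linarith
  have numk: "num t k = num u k" using least k by (intro digit_cong_num) simp
  have "real (n i) * (coord t i - coord u i)
      = 6 * D + real (n i) * (tail t i - tail u i)"
    unfolding D_def coord_def k num.simps numk term_num_def by (simp add: field_simps)
  moreover have "\<bar>real (n i) * (tail t i - tail u i)\<bar> \<le> 1"
  proof -
    have "\<bar>tail t i - tail u i\<bar> \<le> 100 * \<delta> i"
      using tail_bounds[where t = t and j = i] tail_bounds[where t = u and j = i] \<delta>_pos[of i] by linarith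
    then have "real (n i) * \<bar>tail t i - tail u i\<bar> \<le> real (n i) * (100 * \<delta> i)" by (rule mult_left_mono) simp
    moreover have "\<bar>real (n i) * (tail t i - tail u i)\<bar> = real (n i) * \<bar>tail t i - tail u i\<bar>"
      by (simp add: abs_mult)
    moreover have "real (n i) * (100 * \<delta> i) = 100 * (real (n i) * \<delta> i)" by simp
    ultimately show ?thesis using \<delta>_le_inverse[of i] by linarith
  qed
  ultimately have "d \<le> \<bar>real (n i) * (coord t i - coord u i)\<bar>" using d1 unfolding d_def by linarith
  then have sep: "d \<le> real (n i) * \<bar>coord t i - coord u i\<bar>" by (simp add: abs_mult)
  have "\<lfloor>t * real (cells (Suc k))\<rfloor> = \<lfloor>u * real (cells (Suc k))\<rfloor>"
    using least k by (intro floor_cells_cong[OF t u]) simp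
  then have "\<lfloor>t * real (cells i)\<rfloor> - \<lfloor>u * real (cells i)\<rfloor> = digit t i - digit u i"
    unfolding k floor_cells_Suc[of _ "Suc k"] by simp
  then have "of_int \<lfloor>t * real (cells i)\<rfloor> - of_int \<lfloor>u * real (cells i)\<rfloor>
      = D" unfolding D_def by (metis of_int_diff)
  \<comment> \<open>Rounding down changes a difference by less than 1, and \<open>d \<ge> 1\<close>
    absorbs this into \<open>2 * d\<close>.\<close>
  then have "\<bar>t * real (cells i) - u * real (cells i)\<bar> \<le> d + 1" unfolding d_def by linarith
  then have "\<bar>t - u\<bar> * real (cells i) \<le> 2 * d"
    using d1 by (simp add: left_diff_distrib[symmetric] abs_mult)
  then show thesis using that[OF \<open>2 \<le> i\<close> i(1) d1 dg sep] by blast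
qed

end

section \<open>Good and bad denominators for the constructed coordinates\<close>

context tower
begin

definition \<omega> :: real where
  "\<omega> = 1 - 1 / lam"

lemma lam_\<omega>: "lam * \<omega> = lam - 1"
  using lam by (simp add: \<omega>_def algebra_simps)

lemma \<omega>_bounds: "2/3 \<le> \<omega>" "\<omega> < 1"
  using lam by (simp_all add: \<omega>_def field_simps)

text \<open>The worst time for approximation is \<open>n i powr lam\<close>; the identity expresses
  that the error reached there corresponds exactly to the exponent \<open>\<omega>\<close>.\<close>

lemma n_lam_\<omega>: "(real (n i) powr lam) powr (- \<omega>) = real (n i) powr (1 - lam)"
  by (simp add: powr_powr lam_\<omega>)

lemma mult_coord:
  assumes "int (n j) dvd q"
  shows "\<exists>p. of_int q * coord t j - of_int p = of_int q * tail t j"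
proof -
  obtain k where k: "q = int (n j) * k" using assms by (auto elim: dvdE)
  have "of_int q * coord t j = of_int (k * num t j) + of_int q * tail t j"
    by (simp add: k coord_def field_simps)
  then show ?thesis by (intro exI[of _ "k * num t j"]) simp
qed

text \<open>Between \<open>n i powr lam\<close> and \<open>n (Suc i) powr lam\<close> one first uses multiples of \<open>n i\<close>, given by
  Dirichlet's theorem, and then the single denominator \<open>n i * n (Suc i)\<close>.\<close>

lemma approximation_exists:
  assumes R: "real (n i) powr lam \<le> R" "R < real (n (Suc i)) powr lam"
  shows "\<exists>q p p'. 0 < q \<and> of_int q \<le> R \<and> \<bar>of_int q * coord t i - of_int p\<bar> \<le> 24 * R powr (- \<omega>) \<and>
    \<bar>of_int q * coord t (Suc i) - of_int p'\<bar> \<le> 24 * R powr (- \<omega>)"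
proof -
  let ?a = "real (n i)" and ?b = "real (n (Suc i))"
  have a: "2 \<le> ?a" and b: "2 \<le> ?b" and ab: "?a \<le> ?b" using n_real_ge_2 n_le_Suc by auto
  have R0: "0 < R" using R(1) a by (simp add: order.strict_trans2[OF _ R(1)])
  have aR: "?a ^ 3 \<le> R" using n_powr_lam_ge[of i] R(1) by linarith
  have aaR: "?a \<le> R"
    using aR self_le_power[of ?a 3] a by linarith
  show ?thesis
  proof (cases "R \<le> ?a * ?b")
    case True
    \<comment> \<open>With \<open>q\<close> a multiple of \<open>n i\<close>, Dirichlet's theorem
      for \<open>n i * coord t (Suc i)\<close> may use multipliers up to \<open>x\<close>. The error
      is at most \<open>2 * n i / R\<close>, and \<open>n i \<le> R powr (1 / lam)\<close> turns
      this into a multiple of \<open>R powr (- \<omega>)\<close>.\<close>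
    define x where "x = R / ?a"
    have x1: "1 \<le> x" using aaR a by (simp add: x_def)
    define N where "N = nat \<lfloor>x\<rfloor>"
    have "1 \<le> \<lfloor>x\<rfloor>" using x1 by simp
    then have "real N = of_int \<lfloor>x\<rfloor>" "0 < N" by (auto simp: N_def)
    moreover have "of_int \<lfloor>x\<rfloor> \<le> x" "x < of_int \<lfloor>x\<rfloor> + 1" by linarith+
    ultimately have N: "0 < N" "real N \<le> x" "x \<le> 2 * real N" by linarith+
    obtain h k where hk: "0 < k" "k \<le> int N" "\<bar>of_int k * (?a * coord t (Suc i)) - of_int h\<bar> < 1 / real N"
      using Dirichlet_approx[OF N(1)] by blast
    define q where "q = k * int (n i)"
    have q0: "0 < q" using hk(1) by (simp add: q_def)
    have qR: "of_int q \<le> R"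
    proof -
      have "of_int k \<le> real N" using hk(2) of_int_le_iff[of k "int N", where 'a = real] by simp
      then have "of_int k * ?a \<le> x * ?a" using N(2) by (intro mult_right_mono) auto
      also have "x * ?a = R" using a by (simp add: x_def)
      finally show ?thesis by (simp add: q_def)
    qed
    have "\<bar>of_int q * coord t (Suc i) - of_int h\<bar> \<le> 24 * R powr (- \<omega>)"
    proof -
      have "\<bar>of_int q * coord t (Suc i) - of_int h\<bar> \<le> 1 / real N"
        using hk(3) by (simp add: q_def mult.assoc)
      also have "\<dots> \<le> 2 / x" using N x1 by (simp add: field_simps)
      also have "\<dots> = 2 * ?a / R" by (simp add: x_def)
      also have "\<dots> \<le> 2 * R powr (1 / lam) / R"
      proof -
        have "?a = (?a powr lam) powr (1 / lam)" using lam a by (simp add: powr_powr)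
        also have "\<dots> \<le> R powr (1 / lam)" using R(1) lam by (intro powr_mono2) auto
        finally show ?thesis using R0 by (simp add: divide_right_mono)
      qed
      also have "\<dots> = 2 * R powr (- \<omega>)" using R0 by (simp add: \<omega>_def powr_diff powr_minus field_simps)
      also have "\<dots> \<le> 24 * R powr (- \<omega>)" by simp
      finally show ?thesis .
    qed
    moreover obtain p where "of_int q * coord t i - of_int p = of_int q * tail t i"
      using mult_coord[of i q t] by (auto simp: q_def)
    moreover have "\<bar>of_int q * tail t i\<bar> \<le> 24 * R powr (- \<omega>)"
    proof -
      have "\<bar>of_int q * tail t i\<bar> \<le> R * (24 * \<delta> i)"
        unfolding abs_mult using qR q0 tail_bounds[where t = t and j = i] \<delta>_pos[of i] by (intro mult_mono) auto
      also have "\<dots> = 24 * (R * \<delta> i)" by simp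
      also have "R * \<delta> i \<le> R powr (- \<omega>)"
      proof -
        \<comment> \<open>Since \<open>R\<close> is at most the product of the two denominators, the
          chain ends below \<open>1 / \<delta> i\<close>; this is where \<open>lam \<ge> 3\<close>
          enters.\<close>
        have "R powr (1 + \<omega>) \<le> R powr 2"
          using \<omega>_bounds aaR a by (intro powr_mono) auto
        also have "\<dots> = R ^ 2" using powr_realpow[OF R0, of 2] by simp
        also have "\<dots> \<le> (?a * ?b) ^ 2" using True R0 by (intro power_mono) auto
        also have "\<dots> = ?a * (?a * ?b ^ 2)" by (simp add: power2_eq_square)
        also have "\<dots> \<le> ?a * (?b * ?b ^ 2)" using ab by (intro mult_left_mono mult_right_mono) auto
        also have "\<dots> = ?a * ?b ^ 3" by (simp add: power3_eq_cube power2_eq_square)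
        also have "\<dots> \<le> ?a * ?b powr lam" by (intro mult_left_mono n_powr_lam_ge) simp
        finally have "R powr (1 + \<omega>) * \<delta> i \<le> 1" by (simp add: \<delta>_def field_simps)
        then have "(R powr (1 + \<omega>) * \<delta> i) * R powr (- \<omega>) \<le> 1 * R powr (- \<omega>)"
          by (rule mult_right_mono) simp
        moreover have "R powr (1 + \<omega>) * R powr (- \<omega>) = R"
          unfolding powr_add[symmetric] using R0 by simp
        moreover have "(R powr (1 + \<omega>) * \<delta> i) * R powr (- \<omega>) = (R powr (1 + \<omega>) * R powr (- \<omega>)) * \<delta> i"
          by (simp only: mult_ac)
        ultimately show ?thesis by (simp only: mult_1)
      qed
      finally show ?thesis by simp
    qed
    ultimately show ?thesis using q0 qR by (intro exI[of _ q] exI[of _ p] exI[of _ h]) auto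
  next
    case False
    \<comment> \<open>The product clears both fractions. Its errors are at most 24 times
      \<open>n (Suc i) powr (1 - lam)\<close>, which is small enough because
      \<open>R < n (Suc i) powr lam\<close>.\<close>
    define q where "q = int (n i) * int (n (Suc i))"
    have q: "0 < q" "of_int q \<le> R" "of_int q = ?a * ?b" using False by (simp_all add: q_def)
    obtain p where p: "of_int q * coord t i - of_int p = of_int q * tail t i"
      using mult_coord[of i q t] by (auto simp: q_def)
    obtain p' where p': "of_int q * coord t (Suc i) - of_int p' = of_int q * tail t (Suc i)"
      using mult_coord[of "Suc i" q t] by (auto simp: q_def)
    have le: "?b powr (1 - lam) \<le> R powr (- \<omega>)"
      unfolding n_lam_\<omega>[symmetric] using R(2) R0 \<omega>_bounds by (intro powr_mono2') auto
    have "\<bar>of_int q * tail t i\<bar> \<le> 24 * ?b powr (1 - lam)"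
    proof -
      have "\<bar>of_int q * tail t i\<bar> \<le> (?a * ?b) * (24 * \<delta> i)"
        unfolding abs_mult q(3)[symmetric] using q(1) tail_bounds[where t = t and j = i] \<delta>_pos[of i]
        by (intro mult_mono) auto
      also have "\<dots> = 24 * ?b powr (1 - lam)" by (simp add: \<delta>_def powr_diff)
      finally show ?thesis .
    qed
    moreover have "\<bar>of_int q * tail t (Suc i)\<bar> \<le> 24 * ?b powr (1 - lam)"
    proof -
      let ?c = "real (n (Suc (Suc i)))"
      have "\<bar>of_int q * tail t (Suc i)\<bar> \<le> (?a * ?b) * (24 * \<delta> (Suc i))"
        unfolding abs_mult q(3)[symmetric] using q(1) tail_bounds[where t = t and j = "Suc i"] \<delta>_pos[of "Suc i"]
        by (intro mult_mono) auto
      also have "\<dots> = 24 * (?a * ?c powr (- lam))" by (simp add: \<delta>_def powr_minus divide_inverse)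
      also have "\<dots> \<le> 24 * (?b * ?b powr (- lam))"
        using ab lam b n_le_Suc[of "Suc i"] by (intro mult_left_mono mult_mono powr_mono2') auto
      also have "\<dots> = 24 * ?b powr (1 - lam)" by (simp add: powr_diff powr_minus divide_inverse)
      finally show ?thesis .
    qed
    ultimately show ?thesis
      using q p p' le by (intro exI[of _ q] exI[of _ p] exI[of _ p']) auto
  qed
qed

lemma int_fraction_dist:
  fixes N :: nat and k p :: int
  assumes "\<not> int N dvd k" "0 < N"
  shows "1 / real N \<le> \<bar>of_int k / real N - of_int p\<bar>"
proof -
  have "k - p * int N \<noteq> 0" using assms(1) by (metis dvd_triv_right eq_iff_diff_eq_0)
  then have "1 \<le> \<bar>of_int (k - p * int N) :: real\<bar>" by linarith
  moreover have "of_int k / real N - of_int p = of_int (k - p * int N) / real N"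
    using assms(2) by (simp add: field_simps)
  ultimately show ?thesis using assms(2) by (simp add: divide_right_mono)
qed

text \<open>By coprimality \<open>q * num t j\<close> is not divisible by \<open>n j\<close>, so the
  main fraction stays \<open>1 / n j\<close> away from the integers, and the tail takes back at most
  a quarter of that.\<close>

lemma no_multiple_dist:
  assumes "\<not> int (n j) dvd q" "0 \<le> q" "4 * (real (n j) * (of_int q * tail t j)) \<le> 1"
  shows "3 / (4 * real (n j)) \<le> \<bar>of_int q * coord t j - of_int p\<bar>"
proof -
  have "\<not> int (n j) dvd q * num t j"
    using assms(1) coprime_num[of t j] by (simp add: coprime_dvd_mult_left_iff coprime_commute)
  then have "1 / real (n j) \<le> \<bar>of_int (q * num t j) / real (n j) - of_int p\<bar>"
    by (rule int_fraction_dist) simp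
  moreover have "of_int q * coord t j - of_int p = (of_int (q * num t j) / real (n j) - of_int p) + of_int q * tail t j"
    by (simp add: coord_def algebra_simps)
  moreover have "of_int q * tail t j \<le> 1 / (4 * real (n j))"
    using assms(3) by (simp add: field_simps)
  moreover have "0 \<le> of_int q * tail t j"
    using assms(2) by simp
  moreover have "1 / real (n j) = 1 / (4 * real (n j)) + 3 / (4 * real (n j))" by (simp add: field_simps)
  moreover have "h \<le> \<bar>y\<bar>" if "e \<le> \<bar>x\<bar>" "y = x + z" "z \<le> f" "0 \<le> z" "e = f + h" for e f h x y z :: real
    using that by linarith
  ultimately show ?thesis by blast
qed

text \<open>If \<open>q\<close> misses one of the two denominators, that coordinate has an error of
  order \<open>1 / n (Suc j)\<close> or more. If it is a multiple of both, coprimality makes it at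
  least their product, and then the lower bound for the tail after \<open>j\<close> takes effect.
  The factor 100 keeps \<open>q\<close> times the tail below 1/4, so that it cannot come close to
  another integer.\<close>

lemma approximation_fails:
  assumes q: "0 < q" "100 * of_int q \<le> real (n (Suc j)) powr lam"
  shows "real (n (Suc j)) powr (1 - lam) \<le> \<bar>of_int q * coord t j - of_int p\<bar> \<or>
    real (n (Suc j)) powr (1 - lam) \<le> \<bar>of_int q * coord t (Suc j) - of_int p'\<bar>"
proof -
  let ?a = "real (n j)" and ?b = "real (n (Suc j))"
  have a: "2 \<le> ?a" and b: "2 \<le> ?b" and ab: "?a \<le> ?b" using n_real_ge_2 n_le_Suc by auto
  have small: "?b powr (1 - lam) \<le> 3 / (4 * ?b)"
  proof -
    have "?b powr (1 - lam) \<le> ?b powr (- 2)" using lam b by (intro powr_mono) auto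
    also have "\<dots> = 1 / ?b ^ 2" using b powr_realpow[of ?b 2] by (simp add: powr_minus divide_inverse)
    also have "\<dots> \<le> 3 / (4 * ?b)" using b by (simp add: power2_eq_square field_simps)
    finally show ?thesis .
  qed
  have tail_j: "of_int q * tail t j \<le> 1 / (4 * ?a)"
  proof -
    have "of_int q * tail t j \<le> of_int q * (24 * \<delta> j)"
      using q(1) tail_bounds[where t = t and j = j] by (intro mult_left_mono) auto
    also have "\<dots> \<le> ?b powr lam / 100 * (24 * \<delta> j)"
      using q(2) \<delta>_pos[of j] by (intro mult_right_mono) auto
    also have "\<dots> \<le> 1 / (4 * ?a)" using a by (simp add: \<delta>_def field_simps)
    finally show ?thesis .
  qed
  have tail_Sj: "of_int q * tail t (Suc j) \<le> 1 / (4 * ?b)"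
  proof -
    let ?c = "real (n (Suc (Suc j)))"
    have "of_int q * tail t (Suc j) \<le> of_int q * (24 * \<delta> (Suc j))"
      using q(1) tail_bounds[where t = t and j = "Suc j"] by (intro mult_left_mono) auto
    also have "\<dots> \<le> ?c powr lam / 100 * (24 * \<delta> (Suc j))"
    proof (intro mult_right_mono)
      have "?b powr lam \<le> ?c powr lam" using n_le_Suc[of "Suc j"] lam by (intro powr_mono2) auto
      then show "of_int q \<le> ?c powr lam / 100" using q(2) by linarith
    qed (use \<delta>_pos[of "Suc j"] in simp)
    also have "\<dots> \<le> 1 / (4 * ?b)" using b by (simp add: \<delta>_def field_simps)
    finally show ?thesis .
  qed
  show ?thesis
  proof (cases "int (n j) dvd q")
    case False
    have "3 / (4 * ?a) \<le> \<bar>of_int q * coord t j - of_int p\<bar>"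
      using False q(1) tail_j a by (intro no_multiple_dist) (auto simp: field_simps)
    moreover have "3 / (4 * ?b) \<le> 3 / (4 * ?a)" using a ab by (simp add: field_simps)
    ultimately show ?thesis using small by linarith
  next
    case j: True
    show ?thesis
    proof (cases "int (n (Suc j)) dvd q")
      case False
      have "3 / (4 * ?b) \<le> \<bar>of_int q * coord t (Suc j) - of_int p'\<bar>"
        using False q(1) tail_Sj b by (intro no_multiple_dist) (auto simp: field_simps)
      then show ?thesis using small by linarith
    next
      case True
      have "int (n j) * int (n (Suc j)) dvd q" using j True coprime_n by (rule divides_mult)
      then have "int (n j) * int (n (Suc j)) \<le> q" using q(1) by (rule zdvd_imp_le)
      then have nq: "?a * ?b \<le> of_int q" by (metis of_int_le_iff of_int_mult of_int_of_nat_eq)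
      obtain p0 where p0: "of_int q * coord t j - of_int p0 = of_int q * tail t j"
        using mult_coord[OF j] by blast
      have "?b powr (1 - lam) \<le> 3 * ?b powr (1 - lam)" by simp
      also have "\<dots> = (?a * ?b) * (3 * \<delta> j)" by (simp add: \<delta>_def powr_diff)
      also have "\<dots> \<le> of_int q * tail t j"
        using q(1) by (intro mult_mono nq tail_bounds(1)) simp_all
      finally have lower: "?b powr (1 - lam) \<le> of_int q * tail t j" .
      have "1 / (4 * ?a) \<le> 1 / 4" using a by (simp add: field_simps)
      then have upper: "of_int q * tail t j \<le> 1 / 4" using tail_j by linarith
      have "of_int q * tail t j \<le> \<bar>of_int q * coord t j - of_int p\<bar>"
      proof (cases "p = p0")
        case False
        then have "1 \<le> \<bar>of_int p0 - of_int p :: real\<bar>" by linarith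
        then show ?thesis using p0 upper lower powr_ge_zero[of ?b "1 - lam"] by linarith
      qed (use p0 in simp)
      then show ?thesis using lower by linarith
    qed
  qed
qed

end

section \<open>The resulting curve: exponent, Hoelder bound and separation\<close>

context tower
begin

lemma n_at_top: "filterlim (\<lambda>j. real (n j)) at_top sequentially"
  by (rule filterlim_at_top_mono[OF filterlim_real_sequentially]) (simp add: n_ge_self)

lemma cells_ge:
  "real (n (Suc (Suc j))) powr (1 - 2 * (lam + 1) / real K) / 2 \<le> real (cells (Suc (Suc j)))"
proof -
  have "real (g (Suc (Suc j))) \<le> real (cells (Suc (Suc j)))" using g_le_cells by (simp only: of_nat_le_iff)
  then show ?thesis using \<delta>_n_ge[of j] g_bounds(1)[of j] by linarith
qed

lemma coord_parity: "coord t j = (if even j then coord t 0 else coord t 1)"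
  by (induction j rule: induct_nat_012) simp_all

definition point :: "'m::finite \<Rightarrow> 'm \<Rightarrow> real \<Rightarrow> real ^ 'm" where
  "point a b t = (\<chi> i. if i = a then coord t 0 else if i = b then coord t 1 else 0)"

lemma point_nth:
  assumes "a \<noteq> b"
  shows "point a b t $ (if even j then a else b) = coord t j"
  using assms coord_parity[of t j] by (auto simp: point_def)

lemma coord_diff_le_dist:
  assumes "a \<noteq> b"
  shows "\<bar>coord t j - coord u j\<bar> \<le> dist (point a b t) (point a b u)"
  using component_le_norm_cart[of "point a b t - point a b u" "if even j then a else b"]
  unfolding vector_minus_component point_nth[OF assms] dist_norm .

lemma bracket:
  assumes "real (n 0) powr lam \<le> R"
  obtains i where "real (n i) powr lam \<le> R" "R < real (n (Suc i)) powr lam"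
proof -
  obtain m where m: "R < real m" using reals_Archimedean2 by blast
  have "real m \<le> real (n m)" using n_ge_self by simp
  also have "\<dots> \<le> real (n m) powr lam" using lam by (intro n_powr_ge) simp
  finally have ex: "R < real (n m) powr lam" using m by linarith
  define l where "l = (LEAST l. R < real (n l) powr lam)"
  have l: "R < real (n l) powr lam" unfolding l_def by (rule LeastI[of _ m]) (rule ex)
  have "l \<noteq> 0" using l assms by (metis not_le)
  then obtain i where i: "l = Suc i" using not0_implies_Suc by blast
  have "i < l" using i by simp
  then have "\<not> R < real (n i) powr lam" unfolding l_def by (rule not_less_Least)
  then show thesis using that[of i] l i by simp
qed

lemma uniform_exponent_ge:
  fixes N :: "real ^ 'm \<Rightarrow> real"
  assumes N: "is_norm N" and N1: "is_norm N1" and ab: "a \<noteq> b"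
  shows "ereal \<omega> \<le> uniform_exponent N N1 (point a b t)"
proof (rule ccontr)
  let ?A = "point a b t"
  assume "\<not> ereal \<omega> \<le> uniform_exponent N N1 ?A"
  then have lt: "uniform_exponent N N1 ?A < ereal \<omega>" by (simp only: not_le)
  obtain v where v: "uniform_exponent N N1 ?A < ereal v" "ereal v < ereal \<omega>"
    using ereal_dense2[OF lt] by blast
  have v\<omega>: "v < \<omega>" using v(2) by simp
  obtain C where C: "C > 0" "\<And>x. N x \<le> C * norm x" using is_norm_le_norm[OF N] by blast
  define k where "k = N1 1"
  have k: "k > 0" "N1 x = \<bar>x\<bar> * k" for x
    unfolding k_def using is_norm_real[OF N1] by blast+
  define D where "D = C * (real CARD('m) * 24) * k powr \<omega>"
  have D0: "0 \<le> D" using C(1) by (simp add: D_def)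
  have "((\<lambda>Q. Q powr (- (\<omega> - v))) \<longlongrightarrow> 0) at_top"
    using v\<omega> by (intro tendsto_neg_powr filterlim_ident) auto
  then have "((\<lambda>Q. D * Q powr (- (\<omega> - v))) \<longlongrightarrow> D * 0) at_top"
    by (intro tendsto_mult tendsto_const)
  then have "\<forall>\<^sub>F Q in at_top. D * Q powr (- (\<omega> - v)) < 1"
    by (rule order_tendstoD(2)) simp
  moreover have "\<forall>\<^sub>F Q in at_top. k * real (n 0) powr lam \<le> Q" "\<forall>\<^sub>F Q in at_top. (0::real) < Q"
    by (rule eventually_ge_at_top, rule eventually_gt_at_top)
  ultimately have "\<forall>\<^sub>F Q in at_top. \<exists>(p :: int ^ 'm) q. N (of_int q *\<^sub>R ?A + ivec p) \<le> Q powr (- v) \<and>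
       0 < N1 (of_int q) \<and> N1 (of_int q) \<le> Q"
  proof eventually_elim
    case (elim Q)
    define R where "R = Q / k"
    have R0: "0 < R" using elim(3) k(1) by (simp add: R_def)
    have "real (n 0) powr lam \<le> R" using elim(2) k(1) by (simp add: R_def field_simps)
    then obtain i where "real (n i) powr lam \<le> R" "R < real (n (Suc i)) powr lam"
      by (rule bracket)
    then obtain q p p' where qp: "0 < q" "of_int q \<le> R"
        "\<bar>of_int q * coord t i - of_int p\<bar> \<le> 24 * R powr (- \<omega>)"
        "\<bar>of_int q * coord t (Suc i) - of_int p'\<bar> \<le> 24 * R powr (- \<omega>)"
      using approximation_exists[of i R t] by blast
    \<comment> \<open>Which of \<open>a\<close> and \<open>b\<close> carries the coordinate of index
      \<open>i\<close> depends on its parity; all remaining entries of the point vanish and get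
      numerator 0.\<close>
    define r where "r = (\<chi> l. if l = (if even i then a else b) then - p
      else if l = (if even (Suc i) then a else b) then - p' else 0)"
    have "\<bar>(of_int q *\<^sub>R ?A + ivec r) $ l\<bar> \<le> 24 * R powr (- \<omega>)" for l
    proof -
      consider "l = (if even i then a else b)" | "l = (if even (Suc i) then a else b)" | "l \<noteq> a" "l \<noteq> b"
        by (cases "even i") auto
      then show ?thesis
      proof cases
        case 1
        then have "(of_int q *\<^sub>R ?A + ivec r) $ l = of_int q * coord t i - of_int p"
          unfolding vector_add_component vector_scaleR_component 1 point_nth[OF ab] by (simp add: r_def)
        then show ?thesis using qp(3) by simp
      next
        case 2
        then have "(of_int q *\<^sub>R ?A + ivec r) $ l = of_int q * coord t (Suc i) - of_int p'"
          unfolding vector_add_component vector_scaleR_component 2 point_nth[OF ab] using ab by (simp add: r_def)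
        then show ?thesis using qp(4) by simp
      next
        case 3
        then have "(of_int q *\<^sub>R ?A + ivec r) $ l = 0" by (simp add: r_def point_def)
        then show ?thesis by simp
      qed
    qed
    then have "norm (of_int q *\<^sub>R ?A + ivec r) \<le> (\<Sum>l\<in>(UNIV::'m set). 24 * R powr (- \<omega>))"
      by (intro order.trans[OF norm_le_l1_cart] sum_mono)
    then have "norm (of_int q *\<^sub>R ?A + ivec r) \<le> real CARD('m) * (24 * R powr (- \<omega>))" by simp
    then have "C * norm (of_int q *\<^sub>R ?A + ivec r) \<le> C * (real CARD('m) * (24 * R powr (- \<omega>)))"
      using C(1) by (intro mult_left_mono) auto
    then have "N (of_int q *\<^sub>R ?A + ivec r) \<le> C * (real CARD('m) * (24 * R powr (- \<omega>)))"
      using C(2)[of "of_int q *\<^sub>R ?A + ivec r"] by linarith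
    also have "R powr (- \<omega>) = k powr \<omega> * Q powr (- \<omega>)"
      unfolding R_def using elim(3) k(1) by (simp add: powr_divide powr_minus field_simps)
    also have "C * (real CARD('m) * (24 * (k powr \<omega> * Q powr (- \<omega>)))) = (D * Q powr (- (\<omega> - v))) * Q powr (- v)"
      unfolding D_def using elim(3) by (simp add: powr_diff powr_minus field_simps)
    also have "\<dots> \<le> 1 * Q powr (- v)"
      using elim(1) by (intro mult_right_mono) auto
    finally have "N (of_int q *\<^sub>R ?A + ivec r) \<le> Q powr (- v)" by simp
    moreover have "of_int q * k \<le> Q" using qp(2) k(1) by (simp add: R_def field_simps)
    ultimately show ?case
      using k qp(1) by (intro exI[of _ r] exI[of _ q]) simp
  qed
  then have "ereal v \<le> uniform_exponent N N1 ?A"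
    unfolding uniform_exponent_def ivec_def by (intro Sup_upper) auto
  then show False using v(1) by simp
qed

text \<open>The exponent condition is tested only at
  \<open>Q = k / 100 * n (Suc j) powr lam\<close>, the largest times to which
  \<open>approximation_fails\<close> applies. An exponent \<open>v > \<omega>\<close> would bring
  the error there below \<open>n (Suc j) powr (1 - lam)\<close>, constants included.\<close>

lemma uniform_exponent_le:
  fixes N :: "real ^ 'm \<Rightarrow> real"
  assumes N: "is_norm N" and N1: "is_norm N1" and ab: "a \<noteq> b"
  shows "uniform_exponent N N1 (point a b t) \<le> ereal \<omega>"
proof (rule ccontr)
  let ?A = "point a b t"
  assume "\<not> uniform_exponent N N1 ?A \<le> ereal \<omega>"
  then have "ereal \<omega> < uniform_exponent N N1 ?A" by (simp only: not_le)
  from exponent_set_downward[OF this] obtain v where v: "\<omega> < v" and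
    ev: "\<forall>\<^sub>F Q in at_top. \<exists>p q. N (of_int q *\<^sub>R ?A + ivec p) \<le> Q powr (- v) \<and>
      0 < N1 (of_int q) \<and> N1 (of_int q) \<le> Q" by blast
  obtain c where c: "c > 0" "\<And>x. c * norm x \<le> N x" using is_norm_ge_norm[OF N] by blast
  define k where "k = N1 1"
  have k: "k > 0" "N1 x = \<bar>x\<bar> * k" for x
    unfolding k_def using is_norm_real[OF N1] by blast+
  define f where "f j = real (n (Suc j))" for j
  have f: "filterlim f at_top sequentially"
    unfolding f_def using n_at_top by (rule filterlim_compose) (rule filterlim_Suc)
  have "filterlim (\<lambda>j. k / 100 * f j powr lam) at_top sequentially"
  proof (rule filterlim_tendsto_pos_mult_at_top[OF tendsto_const])
    show "filterlim (\<lambda>j. f j powr lam) at_top sequentially"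
    proof (rule filterlim_at_top_mono[OF f], rule always_eventually, rule allI)
      show "f j \<le> f j powr lam" for j unfolding f_def using lam by (intro n_powr_ge) simp
    qed
  qed (use k(1) in simp)
  from eventually_compose_filterlim[OF ev this]
  have ev1: "\<forall>\<^sub>F j in sequentially. \<exists>p q. N (of_int q *\<^sub>R ?A + ivec p) \<le> (k / 100 * f j powr lam) powr (- v) \<and>
      0 < N1 (of_int q) \<and> N1 (of_int q) \<le> k / 100 * f j powr lam" .
  have "0 < lam * (v - \<omega>)" using v lam by simp
  then have "((\<lambda>j. f j powr (- (lam * (v - \<omega>)))) \<longlongrightarrow> 0) sequentially"
    by (intro tendsto_neg_powr f) simp
  then have "((\<lambda>j. (k / 100) powr (- v) * f j powr (- (lam * (v - \<omega>)))) \<longlongrightarrow> (k / 100) powr (- v) * 0) sequentially"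
    by (intro tendsto_mult tendsto_const)
  then have "\<forall>\<^sub>F j in sequentially. (k / 100) powr (- v) * f j powr (- (lam * (v - \<omega>))) < c"
    by (rule order_tendstoD(2)) (use c(1) in simp)
  with ev1 have "\<forall>\<^sub>F j in sequentially. False"
  proof eventually_elim
    case (elim j)
    then obtain p q where pq: "N (of_int q *\<^sub>R ?A + ivec p) \<le> (k / 100 * f j powr lam) powr (- v)"
      "0 < N1 (of_int q)" "N1 (of_int q) \<le> k / 100 * f j powr lam" by blast
    have fj: "0 < f j" by (simp add: f_def)
    have q: "0 < \<bar>q\<bar>" "100 * of_int \<bar>q\<bar> \<le> f j powr lam"
      using pq(2,3) k(1) unfolding k(2) by auto
    have err: "\<bar>of_int \<bar>q\<bar> * coord t i - of_int (- (sgn q * p $ (if even i then a else b)))\<bar>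
        \<le> (k / 100 * f j powr lam) powr (- v) / c" for i
    proof -
      have "of_int \<bar>q\<bar> * coord t i - of_int (- (sgn q * p $ (if even i then a else b)))
          = of_int (sgn q) * (of_int q *\<^sub>R ?A + ivec p) $ (if even i then a else b)"
        unfolding vector_add_component vector_scaleR_component point_nth[OF ab]
        by (cases "q < 0") (use q(1) in simp_all)
      also have "\<bar>\<dots>\<bar> = \<bar>(of_int q *\<^sub>R ?A + ivec p) $ (if even i then a else b)\<bar>"
        using q(1) unfolding abs_mult by (simp add: sgn_if)
      also have "\<dots> \<le> norm (of_int q *\<^sub>R ?A + ivec p)" by (rule component_le_norm_cart)
      also have "\<dots> \<le> (k / 100 * f j powr lam) powr (- v) / c"
        using c(2)[of "of_int q *\<^sub>R ?A + ivec p"] pq(1) c(1) by (simp add: field_simps)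
      finally show ?thesis .
    qed
    have "f j powr (1 - lam) \<le> (k / 100 * f j powr lam) powr (- v) / c"
      using approximation_fails[OF q(1) q(2)[unfolded f_def], folded f_def] err[of j] err[of "Suc j"]
      by (meson order.trans)
    then have "c * f j powr (1 - lam) \<le> (k / 100 * f j powr lam) powr (- v)"
      using c(1) by (simp add: field_simps)
    also have "\<dots> = (k / 100) powr (- v) * f j powr (- (lam * (v - \<omega>))) * f j powr (1 - lam)"
    proof -
      have "- (lam * (v - \<omega>)) + (1 - lam) = - (lam * v)" using lam_\<omega> by (simp add: algebra_simps)
      moreover have "(k / 100 * f j powr lam) powr (- v) = (k / 100) powr (- v) * f j powr (- (lam * v))"
        using k(1) fj by (simp only: powr_mult powr_powr mult_minus_right)
      ultimately show ?thesis by (metis mult.assoc powr_add)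
    qed
    finally have "c \<le> (k / 100) powr (- v) * f j powr (- (lam * (v - \<omega>)))"
      using fj by simp
    then show False using elim(2) by linarith
  qed
  then show False by simp
qed

lemma point_in_Sing:
  assumes "is_norm N" "is_norm N1" "a \<noteq> b"
  shows "point a b t \<in> Sing N N1 \<omega>"
  unfolding Sing_def using uniform_exponent_le[OF assms] uniform_exponent_ge[OF assms] by (auto intro: antisym)

text \<open>At the first differing digit \<open>i = k + 2\<close> the quotient
  \<open>d / g i\<close> is at most 1, hence at most its power \<open>s\<close>, and it is bounded
  by \<open>2 * n (k + 1) powr (lam + 1)\<close> times the distance. Raised to the power
  \<open>s\<close> this leaves the factor \<open>n (k + 1) powr (1/3)\<close>, which the earlier
  digits, through \<open>cells (k + 1)\<close>, compensate.\<close>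

lemma Hoelder_inverse:
  assumes ab: "(a :: 'm::finite) \<noteq> b" and t: "t \<in> {0..<1}" and u: "u \<in> {0..<1}"
  defines "s \<equiv> 1 / (3 * (lam + 1))"
  shows "\<bar>t - u\<bar> \<le> 8 * real (n 1) * dist (point a b t) (point a b u) powr s"
proof (cases "t = u")
  case False
  have s: "0 < s" "s \<le> 1" using lam by (simp_all add: s_def)
  have "\<exists>j. 1 \<le> \<bar>t - u\<bar> * real (cells (Suc (Suc j)))"
  proof -
    obtain m where m: "2 / \<bar>t - u\<bar> < real m" using reals_Archimedean2 by blast
    \<comment> \<open>The cube is taken because \<open>cells\<close> is only bounded below by half
      the cube root of the denominator.\<close>
    let ?N = "real (n (Suc (Suc (m ^ 3))))"
    have "real m = (real (m ^ 3)) powr (1/3)"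
    proof (cases "m = 0")
      case False
      then show ?thesis using powr_realpow[of "real m" 3] by (simp add: powr_powr flip: powr_numeral)
    qed simp
    also have "\<dots> \<le> ?N powr (1/3)"
    proof (intro powr_mono2)
      have "m ^ 3 \<le> n (Suc (Suc (m ^ 3)))" using n_ge_self[of "Suc (Suc (m ^ 3))"] by linarith
      then show "real (m ^ 3) \<le> ?N" by (simp only: of_nat_le_iff)
    qed simp_all
    also have "\<dots> \<le> ?N powr (1 - 2 * (lam + 1) / real K)"
      using exponent_ge_third n_real_ge_2[of "Suc (Suc (m ^ 3))"] by (intro powr_mono) linarith+
    also have "\<dots> \<le> 2 * real (cells (Suc (Suc (m ^ 3))))" using cells_ge[of "m ^ 3"] by simp
    finally have "2 / \<bar>t - u\<bar> < 2 * real (cells (Suc (Suc (m ^ 3))))" using m by linarith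
    then have "1 < \<bar>t - u\<bar> * real (cells (Suc (Suc (m ^ 3))))" using False by (simp add: field_simps)
    then show ?thesis by (intro exI[of _ "m ^ 3"]) simp
  qed
  then obtain j where j: "1 \<le> \<bar>t - u\<bar> * real (cells j)" by blast
  have "\<bar>t * real (cells j) - u * real (cells j)\<bar> = \<bar>t - u\<bar> * real (cells j)"
    by (simp add: left_diff_distrib[symmetric] abs_mult)
  then have "\<lfloor>t * real (cells j)\<rfloor> \<noteq> \<lfloor>u * real (cells j)\<rfloor>" using j by linarith
  then obtain i d where i: "2 \<le> i" "1 \<le> d" "d \<le> real (g i)"
      "d \<le> real (n i) * \<bar>coord t i - coord u i\<bar>" "\<bar>t - u\<bar> * real (cells i) \<le> 2 * d"
    using first_difference[OF t u] by metis
  obtain k where k: "i = Suc (Suc k)" using i(1) by (metis add_2_eq_Suc le_Suc_ex)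
  define x where "x = dist (point a b t) (point a b u)"
  have x: "\<bar>coord t i - coord u i\<bar> \<le> x" unfolding x_def by (rule coord_diff_le_dist[OF ab])
  have x0: "0 \<le> x" by (simp add: x_def)
  let ?G = "real (g i)" and ?N = "real (n (Suc k))" and ?c = "real (cells (Suc k))"
  have G: "0 < ?G" by simp
  have c: "0 < ?c" by simp
  have "\<bar>t - u\<bar> \<le> 2 * (d / ?G) / ?c"
    using i(5) G c unfolding k cells_Suc[of "Suc k"] by (simp add: field_simps)
  also have "\<dots> \<le> 2 * (2 * x powr s * (2 * real (n 1) * ?c)) / ?c"
  proof -
    have "d / ?G \<le> (d / ?G) powr s"
      using powr_mono'[of s 1 "d / ?G"] s i(2,3) G by simp
    also have "\<dots> \<le> (2 * x * ?N powr (lam + 1)) powr s"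
    proof (rule powr_mono2)
      have "real (n i) * \<bar>coord t i - coord u i\<bar> \<le> real (n i) * x" by (rule mult_left_mono[OF x]) simp
      then have "d \<le> real (n i) * x" using i(4) by linarith
      also have "\<dots> \<le> ?G * (2 * (1 / \<delta> k)) * x"
        using g_bounds(1)[of k] \<delta>_pos[of k] x0 unfolding k by (intro mult_right_mono) (simp_all add: field_simps)
      also have "\<dots> \<le> ?G * (2 * ?N powr (lam + 1)) * x"
        using inverse_\<delta>_le[of k] x0 by (intro mult_left_mono mult_right_mono) auto
      finally show "d / ?G \<le> 2 * x * ?N powr (lam + 1)" using G by (simp add: field_simps)
    qed (use s i(2) in simp_all)
    also have "\<dots> = 2 powr s * x powr s * ?N powr (1/3)"
    proof -
      have e: "(lam + 1) * s = 1/3" using lam by (simp add: s_def field_simps)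
      show ?thesis by (simp only: powr_mult powr_powr e)
    qed
    also have "\<dots> \<le> 2 * x powr s * (2 * real (n 1) * ?c)"
    proof (intro mult_mono)
      show "2 powr s \<le> 2" using powr_mono[of s 1 "2::real"] s by simp
      have c1: "1 \<le> ?c" using cells_gt_0[of "Suc k"] by linarith
      show "?N powr (1/3) \<le> 2 * real (n 1) * ?c"
      \<comment> \<open>For \<open>k = 0\<close> there is a single cell of level 1, and the constant
        \<open>n 1\<close> makes up for the missing growth.\<close>
      proof (cases k)
        case 0
        have "?N powr (1/3) \<le> ?N powr 1" using n_real_ge_2[of "Suc k"] by (intro powr_mono) auto
        also have "\<dots> = real (n 1)" by (simp add: 0)
        also have "\<dots> \<le> real (n 1) * (2 * ?c)"
          using mult_left_mono[of 1 "2 * ?c" "real (n 1)"] c1 by simp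
        finally show ?thesis by (simp only: mult_ac)
      next
        case (Suc l)
        have "?N powr (1/3) \<le> ?N powr (1 - 2 * (lam + 1) / real K)"
          using exponent_ge_third n_real_ge_2[of "Suc k"] by (intro powr_mono) linarith+
        also have "\<dots> \<le> 2 * ?c" using cells_ge[of l] by (simp add: Suc)
        also have "\<dots> \<le> real (n 1) * (2 * ?c)"
          using mult_right_mono[of 1 "real (n 1)" "2 * ?c"] n_real_ge_2[of 1] by simp
        finally show ?thesis by (simp only: mult_ac)
      qed
    qed simp_all
    finally have "d / ?G \<le> 2 * x powr s * (2 * real (n 1) * ?c)" .
    then show ?thesis using c by (intro divide_right_mono mult_left_mono) auto
  qed
  also have "\<dots> = 8 * real (n 1) * x powr s" using c by simp
  finally show ?thesis by (simp add: x_def)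
qed simp

lemma tower_hausdorff_dim_ge:
  fixes N :: "real ^ 'm \<Rightarrow> real"
  assumes N: "is_norm N" and N1: "is_norm N1" and m: "CARD('m) \<ge> 2"
  shows "ereal (1 / (3 * (lam + 1))) \<le> hausdorff_dim (Sing N N1 \<omega>)"
proof -
  obtain a b :: 'm where ab: "a \<noteq> b" using m by (metis card_2_iff' ex_card)
  show ?thesis
  proof (rule hausdorff_dim_ge_Hoelder_inverse[where A = "point a b" and C = "8 * real (n 1)"])
    show "point a b t \<in> Sing N N1 \<omega>" for t by (rule point_in_Sing[OF N N1 ab])
    show "\<bar>t - u\<bar> \<le> 8 * real (n 1) * dist (point a b t) (point a b u) powr (1 / (3 * (lam + 1)))"
      if "t \<in> {0..<1}" "u \<in> {0..<1}" for t u
      by (rule Hoelder_inverse[OF ab that])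
  qed (use lam in simp_all)
qed

text \<open>Points in different cells of level \<open>j\<close> are at least \<open>1 / n j\<close>
  apart, and the number of cells is about \<open>n j\<close> to the power \<open>e\<close> at least.
  For \<open>s < e\<close> the packing sums therefore tend to infinity.\<close>

lemma tower_packing_measure_neq_0:
  fixes N :: "real ^ 'm \<Rightarrow> real"
  assumes N: "is_norm N" and N1: "is_norm N1" and m: "CARD('m) \<ge> 2"
    and s: "0 \<le> s" "s < 1 - 2 * (lam + 1) / real K"
  shows "packing_measure s (Sing N N1 \<omega>) \<noteq> 0"
proof -
  obtain a b :: 'm where ab: "a \<noteq> b" using m by (metis card_2_iff' ex_card)
  define e where "e = 1 - 2 * (lam + 1) / real K"
  define r where "r j = 1 / (4 * real (n j))" for j
  show ?thesis
  proof (rule packing_measure_neq_0[where A = "point a b" and M = cells and r = r])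
    show "point a b t \<in> Sing N N1 \<omega>" for t by (rule point_in_Sing[OF N N1 ab])
    show "0 < cells j" for j by simp
    show "0 < r j" for j by (simp add: r_def)
    have "(\<lambda>j. 1/4 * (1 / real (n j))) \<longlonglongrightarrow> 1/4 * 0"
      by (intro tendsto_mult tendsto_const tendsto_divide_0[OF tendsto_const]
          filterlim_at_top_imp_at_infinity n_at_top)
    then show "r \<longlonglongrightarrow> 0" unfolding r_def by simp
    show "2 * r j < dist (point a b t) (point a b u)"
      if tu: "t \<in> {0..<1}" "u \<in> {0..<1}" and ne: "\<lfloor>t * real (cells j)\<rfloor> \<noteq> \<lfloor>u * real (cells j)\<rfloor>" for j t u
    proof -
      obtain i d where i: "i \<le> j" "1 \<le> d" "d \<le> real (n i) * \<bar>coord t i - coord u i\<bar>"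
        using first_difference[OF tu ne] by metis
      have "1 \<le> real (n i) * \<bar>coord t i - coord u i\<bar>" using i by linarith
      also have "\<dots> \<le> real (n j) * dist (point a b t) (point a b u)"
        by (intro mult_mono n_mono[OF i(1)] coord_diff_le_dist[OF ab]) simp_all
      finally have "1 / real (n j) \<le> dist (point a b t) (point a b u)" by (simp add: field_simps)
      moreover have "2 * r j < 1 / real (n j)" by (simp add: r_def field_simps)
      ultimately show ?thesis by linarith
    qed
    have lim: "filterlim (\<lambda>j. (1/2) powr s / 2 * real (n j) powr (e - s)) at_top sequentially"
    proof (rule filterlim_tendsto_pos_mult_at_top[OF tendsto_const])
      show "filterlim (\<lambda>j. real (n j) powr (e - s)) at_top sequentially"
        using s by (intro filterlim_compose[OF real_powr_at_top n_at_top]) (simp add: e_def)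
    qed simp
    show "filterlim (\<lambda>j. real (cells j) * (2 * r j) powr s) at_top sequentially"
    proof (rule filterlim_at_top_mono[OF lim])
      show "\<forall>\<^sub>F j in sequentially. (1/2) powr s / 2 * real (n j) powr (e - s) \<le> real (cells j) * (2 * r j) powr s"
        using eventually_ge_at_top[of 2]
      proof eventually_elim
        case (elim j)
        then obtain k where k: "j = Suc (Suc k)" by (metis add_2_eq_Suc le_Suc_ex)
        have "(2 * r j) powr s = (1/2 * (1 / real (n j))) powr s" by (simp add: r_def)
        also have "\<dots> = (1/2) powr s * real (n j) powr (- s)"
          by (simp only: powr_mult powr_divide powr_one_eq_one powr_minus inverse_eq_divide)
        finally have "(1/2) powr s / 2 * real (n j) powr (e - s) = real (n j) powr e / 2 * (2 * r j) powr s"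
          by (simp add: powr_diff powr_minus field_simps)
        also have "\<dots> \<le> real (cells j) * (2 * r j) powr s"
          using cells_ge[of k] unfolding k e_def by (intro mult_right_mono) auto
        finally show ?case .
      qed
    qed
  qed
qed

end

section \<open>Dimension of the singular sets\<close>

lemma Sing_subset_approximable:
  fixes N :: "real ^ 'm \<Rightarrow> real"
  assumes N: "is_norm N" and N1: "is_norm N1" and w: "w < \<omega>" "\<omega> < 1"
  shows "Sing N N1 \<omega> \<subseteq>
    (\<Union>J. \<Union>k. {A \<in> approximable w J. norm A \<le> real k \<and> uniform_exponent N N1 A < 1})"
proof
  fix A assume "A \<in> Sing N N1 \<omega>"
  then have A: "uniform_exponent N N1 A = ereal \<omega>" by (simp add: Sing_def)
  then have "A \<in> (\<Union>J. approximable w J)"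
    using w(1) by (intro approximable_of_exponent[OF N N1]) simp
  moreover obtain k where "norm A \<le> real k" using real_arch_simple by blast
  moreover have "uniform_exponent N N1 A < 1" using A w(2) by simp
  ultimately show "A \<in> (\<Union>J. \<Union>k. {A \<in> approximable w J. norm A \<le> real k \<and> uniform_exponent N N1 A < 1})"
    by blast
qed

lemma hausdorff_dim_Sing_le:
  fixes N :: "real ^ 'm \<Rightarrow> real"
  assumes N: "is_norm N" and N1: "is_norm N1" and \<omega>: "3/4 \<le> \<omega>" "\<omega> < 1"
  shows "hausdorff_dim (Sing N N1 \<omega>) \<le> ereal (16 * (real CARD('m) + 1) * (1 - \<omega>))"
proof (rule hausdorff_dim_le)
  \<comment> \<open>\<open>1 - w\<close> is twice \<open>1 - \<omega>\<close>: strictly below the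
    exponent at the cost of a factor 2, and still at least 1/2.\<close>
  define w where "w = 2 * \<omega> - 1"
  have w: "1/2 \<le> w" "w < 1" "w < \<omega>" using \<omega> by (auto simp: w_def)
  define s where "s = 8 * (1 - w) * real (CARD('m) + 1)"
  have s: "s = 16 * (real CARD('m) + 1) * (1 - \<omega>)" by (simp add: s_def w_def algebra_simps)
  have "hausdorff_measure s (\<Union>J. \<Union>k. {A \<in> approximable w J. norm A \<le> real k \<and> uniform_exponent N N1 A < 1}) = 0"
    unfolding s_def by (intro hausdorff_measure_UN_eq_0 hausdorff_measure_approximable[OF N N1 w(1,2)]) simp
  then have "hausdorff_measure s (Sing N N1 \<omega>) = 0"
    using hausdorff_measure_mono[OF Sing_subset_approximable[OF N N1 w(3) \<omega>(2)], of s] by simp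
  then show "hausdorff_measure (16 * (real CARD('m) + 1) * (1 - \<omega>)) (Sing N N1 \<omega>) = 0"
    by (simp only: s)
  show "0 \<le> 16 * (real CARD('m) + 1) * (1 - \<omega>)" using \<omega> by simp
qed

lemma packing_dim_Sing_le:
  fixes N :: "real ^ 'm \<Rightarrow> real"
  assumes N: "is_norm N" and N1: "is_norm N1"
    and \<omega>: "1 - 1 / (6 * (real CARD('m) + 1)) < \<omega>" "\<omega> < 1"
  shows "packing_dim (Sing N N1 \<omega>) \<le> 1"
proof -
  \<comment> \<open>The value for which \<open>(1 - w) * (3 * m + 3)\<close>, the growth rate in
    \<open>approximable_covering\<close>, is exactly 1/2.\<close>
  define w where "w = 1 - 1 / (6 * (real CARD('m) + 1))"
  have w: "w < 1" "(1 - w) * (3 * real CARD('m) + 3) \<le> 1/2" "w < \<omega>"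
    using \<omega>(1) by (auto simp: w_def field_simps)
  define E where "E i = (case prod_decode i of (J, k) \<Rightarrow>
    {A \<in> approximable w J :: (real ^ 'm) set. norm A \<le> real k})" for i
  have "packing_dim (Sing N N1 \<omega>) \<le> ereal 1"
  proof (rule packing_dim_le[where E = E])
    show "Sing N N1 \<omega> \<subseteq> (\<Union>i. E i)"
    proof
      fix A assume "A \<in> Sing N N1 \<omega>"
      then obtain J k where "A \<in> approximable w J" "norm A \<le> real k"
        using Sing_subset_approximable[OF N N1 w(3) \<omega>(2)] by blast
      then have "A \<in> E (prod_encode (J, k))" by (simp add: E_def)
      then show "A \<in> (\<Union>i. E i)" by blast
    qed
    show "\<exists>C\<ge>0. \<forall>\<rho>. 0 < \<rho> \<and> \<rho> \<le> 1 \<longrightarrow>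
      (\<exists>X. finite X \<and> real (card X) \<le> C * \<rho> powr (- 1) \<and> (\<forall>x\<in>E i. \<exists>y\<in>X. dist x y \<le> \<rho>))" for i
    proof -
      obtain J k where Jk: "prod_decode i = (J, k)" by fastforce
      have "E i = {A \<in> approximable w J :: (real ^ 'm) set. norm A \<le> real k}"
        by (simp add: E_def Jk)
      then show ?thesis using approximable_covering[OF w(1,2), of "real k" J] by simp
    qed
  qed simp
  then show ?thesis by (simp add: one_ereal_def)
qed

lemma hausdorff_dim_Sing_ge:
  fixes N :: "real ^ 'm \<Rightarrow> real"
  assumes N: "is_norm N" and N1: "is_norm N1" and m: "CARD('m) \<ge> 2" and \<omega>: "3/4 \<le> \<omega>" "\<omega> < 1"
  shows "ereal ((1 - \<omega>) / 6) \<le> hausdorff_dim (Sing N N1 \<omega>)"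
proof -
  define lam where "lam = 1 / (1 - \<omega>)"
  obtain K where K_ge: "4 * lam \<le> real K" using real_arch_simple by blast
  interpret tower K lam
    using K_ge \<omega> by unfold_locales (simp_all add: lam_def field_simps)
  have "tower.\<omega> lam = \<omega>" unfolding \<omega>_def by (simp add: lam_def)
  \<comment> \<open>As \<open>lam \<ge> 1\<close>, the factor \<open>lam + 1\<close> is at most
    \<open>2 * lam\<close>.\<close>
  moreover have "(1 - \<omega>) / 6 \<le> 1 / (3 * (lam + 1))" using \<omega> by (simp add: lam_def field_simps)
  ultimately show ?thesis
    using tower_hausdorff_dim_ge[OF N N1 m] by (metis ereal_less_eq(3) order.trans)
qed

lemma packing_dim_Sing_ge:
  fixes N :: "real ^ 'm \<Rightarrow> real"
  assumes N: "is_norm N" and N1: "is_norm N1" and m: "CARD('m) \<ge> 2" and \<omega>: "3/4 \<le> \<omega>" "\<omega> < 1"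
  shows "1 \<le> packing_dim (Sing N N1 \<omega>)"
  unfolding packing_dim_def
proof (rule Inf_greatest, clarsimp)
  fix s :: real
  assume s: "0 \<le> s" "packing_measure s (Sing N N1 \<omega>) = 0"
  show "1 \<le> s"
  proof (rule ccontr)
    assume "\<not> 1 \<le> s"
    define lam where "lam = 1 / (1 - \<omega>)"
    have lam: "3 \<le> lam" using \<omega> by (simp add: lam_def field_simps)
    \<comment> \<open>For the given \<open>s < 1\<close>, \<open>K\<close> is taken so large that
      the exponent \<open>1 - 2 * (lam + 1) / K\<close> of the separated points exceeds
      \<open>s\<close>.\<close>
    obtain K where K_gt: "max (4 * lam) (2 * (lam + 1) / (1 - s)) < real K" using reals_Archimedean2 by blast
    interpret tower K lam using K_gt lam by unfold_locales simp_all
    have "tower.\<omega> lam = \<omega>" unfolding \<omega>_def by (simp add: lam_def)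
    moreover have "s < 1 - 2 * (lam + 1) / real K"
    proof -
      have "0 < real K" using K_gt lam by simp
      have "0 < 1 - s" using \<open>\<not> 1 \<le> s\<close> by simp
      moreover have "2 * (lam + 1) / (1 - s) < real K"
        using K_gt unfolding max_less_iff_conj by (rule conjunct2)
      ultimately have "2 * (lam + 1) < (1 - s) * real K" by (simp only: pos_divide_less_eq mult.commute)
      then have "2 * (lam + 1) / real K < 1 - s" by (simp only: pos_divide_less_eq[OF \<open>0 < real K\<close>])
      then show ?thesis by simp
    qed
    ultimately show False
      using tower_packing_measure_neq_0[OF N N1 m s(1)] s(2) by simp
  qed
qed

text \<open>At \<omega> = 1 the value of \<tau> is (m - 1) / (2 m), so the defect is divisible by 1
  - \<omega>; the cofactor \<open>(m + 1) / (2 * m * (\<omega> + 1))\<close> lies between 1/4 and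
  1.\<close>

lemma tau_defect:
  fixes m \<omega> :: real
  assumes "2 \<le> m" "0 \<le> \<omega>" "\<omega> < 1"
  defines "d \<equiv> (m - 1) / (2 * m) - (\<omega> - 1 / m) / (\<omega> + 1)"
  shows "(1 - \<omega>) / 4 \<le> d" "d \<le> 1 - \<omega>"
proof -
  have d: "d = (1 - \<omega>) * ((m + 1) / (2 * m * (\<omega> + 1)))"
    using assms(1,2) unfolding d_def by (simp add: divide_simps) (simp add: algebra_simps)
  have pos: "0 < 2 * m * (\<omega> + 1)" using assms(1,2) by simp
  have "m * \<omega> \<le> m * 1" using assms by (intro mult_left_mono) auto
  then have "2 * m * (\<omega> + 1) \<le> 4 * (m + 1)" by (simp add: algebra_simps)
  then have "1/4 \<le> (m + 1) / (2 * m * (\<omega> + 1))" unfolding pos_le_divide_eq[OF pos] by simp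
  then have "(1 - \<omega>) * (1/4) \<le> d" unfolding d using assms by (intro mult_left_mono) auto
  then show "(1 - \<omega>) / 4 \<le> d" by simp
  have "0 \<le> m * \<omega>" using assms by simp
  then have "m + 1 \<le> 2 * m * (\<omega> + 1)" using assms(1) by (simp add: algebra_simps)
  then have "(m + 1) / (2 * m * (\<omega> + 1)) \<le> 1" using assms by (simp add: field_simps)
  then have "d \<le> (1 - \<omega>) * 1" unfolding d using assms by (intro mult_left_mono) auto
  then show "d \<le> 1 - \<omega>" by simp
qed

theorem theorem1p7:
  fixes N :: "real ^ 'm \<Rightarrow> real" and N1 :: "real \<Rightarrow> real" and m :: real and \<tau> :: "real \<Rightarrow> real"
  defines "m \<equiv> real CARD('m)"
    and "\<tau> \<equiv> \<lambda>\<omega>. (\<omega> - 1 / m) / (\<omega> + 1)"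
  assumes "CARD('m) \<ge> 2" and "is_norm N" and "is_norm N1"
  shows "\<exists>C \<ge> 1. \<exists>\<epsilon> > 0. \<forall>\<omega>. 1 / m < \<omega> \<and> 1 - \<epsilon> < \<omega> \<and> \<omega> < 1 \<longrightarrow>
    ereal (inverse C * (1 - \<omega>)) \<le> hausdorff_dim (Sing N N1 \<omega>) \<and>
    hausdorff_dim (Sing N N1 \<omega>) \<le> ereal (C * (1 - \<omega>)) \<and>
    ereal (inverse C * ((m - 1) / (2 * m) - \<tau> \<omega>)) \<le> hausdorff_dim (Sing N N1 \<omega>) \<and>
    hausdorff_dim (Sing N N1 \<omega>) \<le> ereal (C * ((m - 1) / (2 * m) - \<tau> \<omega>)) \<and>
    packing_dim (Sing N N1 \<omega>) = 1"
proof -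
  \<comment> \<open>The upper bound has the constant \<open>16 * (m + 1)\<close>, and
    \<open>tau_defect\<close> costs a further factor 4; the inverse is then far below the 1/6 of the
    lower bound. \<open>\<epsilon>\<close> is the threshold of the packing bound and small enough
    for \<open>\<omega> \<ge> 3/4\<close>.\<close>
  define C where "C = 64 * (m + 1)"
  define \<epsilon> where "\<epsilon> = 1 / (6 * (m + 1))"
  have m2: "2 \<le> m" using assms(3) by (simp add: m_def)
  have C: "64 \<le> C" "inverse C \<le> 1/6" using m2 by (simp_all add: C_def field_simps)
  have \<epsilon>: "0 < \<epsilon>" "\<epsilon> \<le> 1/4" using m2 by (simp_all add: \<epsilon>_def field_simps)
  have main: "ereal (inverse C * (1 - \<omega>)) \<le> hausdorff_dim (Sing N N1 \<omega>) \<and>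
    hausdorff_dim (Sing N N1 \<omega>) \<le> ereal (C * (1 - \<omega>)) \<and>
    ereal (inverse C * ((m - 1) / (2 * m) - \<tau> \<omega>)) \<le> hausdorff_dim (Sing N N1 \<omega>) \<and>
    hausdorff_dim (Sing N N1 \<omega>) \<le> ereal (C * ((m - 1) / (2 * m) - \<tau> \<omega>)) \<and>
    packing_dim (Sing N N1 \<omega>) = 1" if \<omega>: "1 - \<epsilon> < \<omega>" "\<omega> < 1" for \<omega>
  proof -
    define d where "d = (m - 1) / (2 * m) - \<tau> \<omega>"
    have \<omega>': "3/4 \<le> \<omega>" using \<omega> \<epsilon> by linarith
    have d: "(1 - \<omega>) / 4 \<le> d" "d \<le> 1 - \<omega>"
      using tau_defect[OF m2, of \<omega>] \<omega> \<omega>' by (auto simp: d_def \<tau>_def)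
    let ?H = "hausdorff_dim (Sing N N1 \<omega>)"
    have lower: "ereal ((1 - \<omega>) / 6) \<le> ?H" by (rule hausdorff_dim_Sing_ge[OF assms(4,5,3) \<omega>' \<omega>(2)])
    have upper: "?H \<le> ereal (16 * (m + 1) * (1 - \<omega>))"
      unfolding m_def by (rule hausdorff_dim_Sing_le[OF assms(4,5) \<omega>' \<omega>(2)])
    have "inverse C * (1 - \<omega>) \<le> 1/6 * (1 - \<omega>)" using C(2) \<omega>(2) by (intro mult_right_mono) auto
    then have l1: "inverse C * (1 - \<omega>) \<le> (1 - \<omega>) / 6" by simp
    have "inverse C * d \<le> inverse C * (1 - \<omega>)" using d(2) C(1) by (intro mult_left_mono) auto
    then have l2: "inverse C * d \<le> (1 - \<omega>) / 6" using l1 by linarith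
    have "C * ((1 - \<omega>) / 4) \<le> C * d" using d(1) C(1) by (intro mult_left_mono) auto
    moreover have "C * ((1 - \<omega>) / 4) = 16 * (m + 1) * (1 - \<omega>)" by (simp add: C_def)
    ultimately have u2: "16 * (m + 1) * (1 - \<omega>) \<le> C * d" by linarith
    have "C * d \<le> C * (1 - \<omega>)" using d(2) C(1) by (intro mult_left_mono) auto
    then have u1: "16 * (m + 1) * (1 - \<omega>) \<le> C * (1 - \<omega>)" using u2 by linarith
    have "packing_dim (Sing N N1 \<omega>) = 1"
    proof (rule antisym)
      show "packing_dim (Sing N N1 \<omega>) \<le> 1"
        using \<omega> unfolding \<epsilon>_def m_def by (intro packing_dim_Sing_le[OF assms(4,5)])
      show "1 \<le> packing_dim (Sing N N1 \<omega>)"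
        by (rule packing_dim_Sing_ge[OF assms(4,5,3) \<omega>' \<omega>(2)])
    qed
    moreover have "ereal x \<le> ?H" if "x \<le> (1 - \<omega>) / 6" for x
      using order.trans[OF _ lower, of "ereal x"] that by (simp only: ereal_less_eq(3))
    moreover have "?H \<le> ereal x" if "16 * (m + 1) * (1 - \<omega>) \<le> x" for x
      using order.trans[OF upper, of "ereal x"] that by (simp only: ereal_less_eq(3))
    ultimately show ?thesis using l1 l2 u1 u2 unfolding d_def by blast
  qed
  show ?thesis
    using C(1) \<epsilon>(1) main by (intro exI[of _ C] exI[of _ \<epsilon>] conjI allI impI) auto
qed

end
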